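(* Let $\Omega\subset\mathbb{R}^n$ be bounded, open and convex, and let $u$ minimize $L$ over $\mathcal U$. Then $\mathcal H^{n-1}(\partial\Omega\setminus\operatorname{dom}D^-u)=0$, and each $x_0\in\partial\Omega\cap\operatorname{dom}D^-u$ at which the outer unit normal $\mathbf n$ to $\Omega$ exists satisfies $$(D^+u(x_0)-x_0)\cdot\mathbf n\ge0.$$
   Context: Let $\mathcal U$ be the set of convex lower semicontinuous functions $u:\overline\Omega\to[0,\infty)$ and $L[u]=\int_\Omega\left(\tfrac12|Du(x)-x|^2+u(x)\right)dx$. The minimizer $u$ is unique and is known to satisfy $u\in C^{1,1}_{\rm loc}(\Omega)\cap C^{0,1}(\Omega)$. The minimal (smallest) convex extension of $u|_\Omega$ to all of $\mathbb{R}^n$ is also denoted $u$. For $x\in\mathbb{R}^n$ let $\partial u(x)=\{y\in\mathbb{R}^n : u(z)\ge u(x)+y\cdot(z-x)\ \forall z\in\mathbb{R}^n\}$, and let $\operatorname{dom}Du$ be the set of $x$ for which $\partial u(x)$ is a singleton. Let $\operatorname{dom}D_{\partial\Omega}u\subset\partial\Omega$ be the set of points at which $\partial\Omega$ is differentiable and the restriction $u|_{\partial\Omega}$ is differentiable. At each such $x$, with outer unit normal $\mathbf n$, one has $\partial u(x)=[y(x),y(x)+\lambda(x)\mathbf n]$ for some $y(x)\in\mathbb{R}^n$, $\lambda(x)\ge0$. Set $\operatorname{dom}D^-u:=(\overline\Omega\cap\operatorname{dom}Du)\cup\operatorname{dom}D_{\partial\Omega}u$. On $\operatorname{dom}D_{\partial\Omega}u$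 put $D^-u(x):=y(x)$ and $D^+u(x):=y(x)+\lambda(x)\mathbf n$; at all other points of $\operatorname{dom}D^-u$ put $D^\pm u(x):=Du(x)$. The outer unit normal $\mathbf n$ is defined at points where $\partial\Omega$ is differentiable. *)

theory Defs
  imports "HOL-Analysis.Analysis"
begin

definition lsc_on :: "'a::topological_space set \<Rightarrow> ('a \<Rightarrow> real) \<Rightarrow> bool" where
  "lsc_on S f \<longleftrightarrow> (\<forall>x\<in>S. \<forall>a<f x. eventually (\<lambda>z. a < f z) (at x within S))"

text \<open>A function on \<open>closure \<Omega>\<close> is represented by a total function whose values off
  \<open>closure \<Omega>\<close> are irrelevant.\<close>

definition admissible :: "'a::euclidean_space set \<Rightarrow> ('a \<Rightarrow> real) set" where
  "admissible \<Omega> =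
     {u. convex_on (closure \<Omega>) u \<and> lsc_on (closure \<Omega>) u \<and> (\<forall>x\<in>closure \<Omega>. 0 \<le> u x)}"

definition grad :: "('a::real_inner \<Rightarrow> real) \<Rightarrow> 'a \<Rightarrow> 'a" where
  "grad u x = (THE D. GDERIV u x :> D)"

text \<open>For admissible \<open>u\<close> the integrand is nonnegative, and \<open>grad u\<close> is meaningful almost
  everywhere on \<open>\<Omega>\<close>; the functional may take the value \<open>\<infinity>\<close>.\<close>

definition energy :: "'a::euclidean_space set \<Rightarrow> ('a \<Rightarrow> real) \<Rightarrow> ennreal" where
  "energy \<Omega> u = (\<integral>\<^sup>+x\<in>\<Omega>. ennreal (1/2 * (norm (grad u x - x))\<^sup>2 + u x) \<partial>lborel)"

text \<open>\<open>Least\<close> refers to the pointwise order on functions. For a minimizer of the energy the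
  least extension exists, and it agrees with the minimizer on \<open>closure \<Omega>\<close>.\<close>

definition min_convex_ext :: "'a::euclidean_space set \<Rightarrow> ('a \<Rightarrow> real) \<Rightarrow> ('a \<Rightarrow> real)" where
  "min_convex_ext \<Omega> u = (LEAST v. convex_on UNIV v \<and> (\<forall>x\<in>\<Omega>. v x = u x))"

definition subdiff :: "('a::euclidean_space \<Rightarrow> real) \<Rightarrow> 'a \<Rightarrow> 'a set" where
  "subdiff w x = {y. \<forall>z. w z \<ge> w x + y \<bullet> (z - x)}"

definition dom_D :: "('a::euclidean_space \<Rightarrow> real) \<Rightarrow> 'a set" where
  "dom_D w = {x. is_singleton (subdiff w x)}"

text \<open>\<open>outer_unit_normal \<Omega> x n\<close>: near the boundary point \<open>x\<close>, the set \<open>\<Omega>\<close> is the strict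
  subgraph, in a unit direction \<open>e\<close>, of a function \<open>f\<close> on the hyperplane orthogonal to \<open>e\<close>;
  \<open>f\<close> is differentiable at the projection of \<open>x\<close>, with gradient \<open>g\<close> in that hyperplane;
  and \<open>n\<close> is the resulting outer unit normal.\<close>

definition outer_unit_normal :: "'a::euclidean_space set \<Rightarrow> 'a \<Rightarrow> 'a \<Rightarrow> bool" where
  "outer_unit_normal \<Omega> x n \<longleftrightarrow> x \<in> frontier \<Omega> \<and>
     (\<exists>e f g r. norm e = 1 \<and> 0 < r \<and>
        (\<forall>z\<in>ball x r. z \<in> \<Omega> \<longleftrightarrow> z \<bullet> e < f (z - (z \<bullet> e) *\<^sub>R e)) \<and>
        g \<bullet> e = 0 \<and>
        (f has_derivative (\<lambda>h. g \<bullet> h)) (at (x - (x \<bullet> e) *\<^sub>R e) within {p. p \<bullet> e = 0}) \<and>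
        n = (e - g) /\<^sub>R norm (e - g))"

definition boundary_differentiable :: "'a::euclidean_space set \<Rightarrow> 'a \<Rightarrow> bool" where
  "boundary_differentiable \<Omega> x \<longleftrightarrow> (\<exists>n. outer_unit_normal \<Omega> x n)"

text \<open>Below, \<open>w\<close> stands for the minimal convex extension, defined on the whole space.
  Differentiability of its restriction to the boundary is differentiability within
  \<open>frontier \<Omega>\<close>; where the boundary is a differentiable graph this is the same as
  differentiability in the graph chart.\<close>

definition dom_D_frontier :: "'a::euclidean_space set \<Rightarrow> ('a \<Rightarrow> real) \<Rightarrow> 'a set" where
  "dom_D_frontier \<Omega> w =
     {x \<in> frontier \<Omega>. boundary_differentiable \<Omega> x \<and> w differentiable (at x within frontier \<Omega>)}"

definition dom_D_minus :: "'a::euclidean_space set \<Rightarrow> ('a \<Rightarrow> real) \<Rightarrow> 'a set" where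
  "dom_D_minus \<Omega> w = (closure \<Omega> \<inter> dom_D w) \<union> dom_D_frontier \<Omega> w"

definition D_minus :: "'a::euclidean_space set \<Rightarrow> ('a \<Rightarrow> real) \<Rightarrow> 'a \<Rightarrow> 'a" where
  "D_minus \<Omega> w x =
     (if x \<in> dom_D_frontier \<Omega> w
      then THE y. \<exists>n l. outer_unit_normal \<Omega> x n \<and> 0 \<le> l \<and>
                    subdiff w x = closed_segment y (y + l *\<^sub>R n)
      else the_elem (subdiff w x))"

definition D_plus :: "'a::euclidean_space set \<Rightarrow> ('a \<Rightarrow> real) \<Rightarrow> 'a \<Rightarrow> 'a" where
  "D_plus \<Omega> w x =
     (if x \<in> dom_D_frontier \<Omega> w
      then THE p. \<exists>y n l. outer_unit_normal \<Omega> x n \<and> 0 \<le> l \<and>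
                    subdiff w x = closed_segment y (y + l *\<^sub>R n) \<and> p = y + l *\<^sub>R n
      else the_elem (subdiff w x))"

text \<open>The \<open>k\<close>-dimensional Hausdorff outer measure. The empty set is treated separately
  because \<open>0 ^ 0 = 1\<close> (so that \<open>k = 0\<close> gives the counting measure), and covering sets must be
  bounded because \<open>diameter\<close> is unspecified on unbounded sets.\<close>

definition hausdorff_content :: "nat \<Rightarrow> real \<Rightarrow> 'a::metric_space set \<Rightarrow> ennreal" where
  "hausdorff_content k \<delta> A =
     (INF C\<in>{C :: nat \<Rightarrow> 'a set. A \<subseteq> (\<Union>i. C i) \<and> (\<forall>i. bounded (C i) \<and> diameter (C i) \<le> \<delta>)}.
        \<Sum>i. if C i = {} then 0
             else ennreal (unit_ball_vol (real k) * (diameter (C i) / 2) ^ k))"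

definition hausdorff_measure :: "nat \<Rightarrow> 'a::metric_space set \<Rightarrow> ennreal" where
  "hausdorff_measure k A = (SUP \<delta>\<in>{0<..}. hausdorff_content k \<delta> A)"

end

theory Submission
  imports Defs
begin

text \<open>
  Existence of the extension: an affine function \<open>z \<mapsto> y \<bullet> z - s\<close> is a product \<open>y\<close> offered at price \<open>s\<close>, and
  a type \<open>x\<close> buying it contributes \<open>|x|\<^sup>2 / 2 + |y|\<^sup>2 / 2 - s\<close> to the energy. Withdrawing every product
  whose price is below its cost \<open>|y|\<^sup>2 / 2\<close> lowers the energy density pointwise, so the minimizer satisfies
  \<open>|Du - x| \<le> |x|\<close> almost everywhere. Hence it is Lipschitz and its least convex extension is real-valued.

  Size of the exceptional set: the gauge of \<open>\<Omega>\<close> and the 1-homogeneous extension of \<open>u + C\<close> from the frontier are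
  both sublinear. The points at which a sublinear function is not differentiable lie in countably many cones,
  each of which is contained in a Lipschitz graph; such a cone meets the frontier in a set of dimension \<open>n - 2\<close>.

  Boundary inequality: if \<open>(D\<^sup>+u(x0) - x0) \<bullet> n < 0\<close>, compare \<open>u\<close> with its maximum with a plane slightly steeper
  and slightly higher than the extremal plane at \<open>x0\<close>. The cap where the plane is larger is star-shaped about \<open>x0\<close>.
  On its contraction by a factor \<open>\<theta> < 1\<close> all gradients of \<open>u\<close> are close to \<open>\<partial>u(x0)\<close>, so that the energy density
  drops by a fixed amount there, and for \<open>\<theta>\<close> close to 1 the remaining part of the cap is negligible.
\<close>

section \<open>Differentiability of convex functions\<close>

text \<open>The regularity of the minimizer is derived here, and it has to be global: the least
  extension takes real values on the whole space, so slopes must stay bounded up to the frontier,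
  which local bounds for convex functions do not give. The obstacle in the boundary inequality is
  that the caps need not shrink to \<open>x0\<close> as the plane descends. Their limit points only
  lie in the set where the extension agrees with the extremal plane, and this set may contain
  segments starting at \<open>x0\<close>. At the far end of such a segment new subgradients can
  appear, and with them all control of the energy density is lost. At inner points of the segment
  every subgradient is also one at \<open>x0\<close>; this is what the contraction by \<theta>
  exploits. Hence the order of the choices: first \<theta>, so that the volume ratio makes the loss
  on the rest of the cap smaller than the gain, and then a height that is small depending on
  \<theta>. For the exceptional set, homogeneity turns both the frontier and the boundary values
  into functions on the whole space, so that one alternative, derivative or kink, serves both kinds
  of differentiability.\<close>

lemma norm_orthogonal_part_le:
  fixes h e :: "'a::real_inner"
  assumes "norm e = 1" shows "norm (h - (h \<bullet> e) *\<^sub>R e) \<le> norm h"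
proof -
  have "e \<bullet> e = 1" using assms by (simp add: dot_square_norm)
  then have "(norm (h - (h \<bullet> e) *\<^sub>R e))\<^sup>2 = (norm h)\<^sup>2 - (h \<bullet> e)\<^sup>2"
    unfolding power2_norm_eq_inner
    by (simp add: inner_diff_left inner_diff_right inner_commute power2_eq_square)
  then have "(norm (h - (h \<bullet> e) *\<^sub>R e))\<^sup>2 \<le> (norm h)\<^sup>2" by simp
  then show ?thesis by (rule power2_le_imp_le) simp
qed

lemma convex_on_bounded_on_cball:
  fixes f :: "'a::euclidean_space \<Rightarrow> real"
  assumes "convex_on S f" "open S" "cball x r \<subseteq> S"
  obtains M where "\<And>z. z \<in> cball x r \<Longrightarrow> \<bar>f z\<bar> \<le> M"
proof -
  have "continuous_on (cball x r) f" using convex_on_continuous[OF assms(2,1)] assms(3) continuous_on_subset by blast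
  then have "bounded (f ` cball x r)" by (intro compact_imp_bounded compact_continuous_image) auto
  then show thesis using that unfolding bounded_iff by (metis imageI real_norm_def)
qed

text \<open>Separate the strict epigraph from the point \<open>(z, f z)\<close>. Since
  \<open>S\<close> is open, \<open>z\<close> can be moved along the horizontal part of the normal,
  which excludes a vertical hyperplane; dividing by the negative vertical part gives the
  slope.\<close>

lemma convex_on_subgradient:
  fixes f :: "'a::euclidean_space \<Rightarrow> real"
  assumes f: "convex_on S f" and S: "open S" and z: "z \<in> S"
  obtains y where "\<And>x. x \<in> S \<Longrightarrow> f x \<ge> f z + y \<bullet> (x - z)"
proof -
  let ?A = "{p. fst p \<in> S \<and> f (fst p) < snd p} :: ('a \<times> real) set"
  have "convex ?A"
  proof (rule convexI)
    fix p q :: "'a \<times> real" and a b :: real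
    assume p: "p \<in> ?A" and q: "q \<in> ?A" and ab: "0 \<le> a" "0 \<le> b" "a + b = 1"
    have 1: "a *\<^sub>R fst p + b *\<^sub>R fst q \<in> S"
      using f p q ab unfolding convex_on_def convex_def by auto
    have "f (a *\<^sub>R fst p + b *\<^sub>R fst q) \<le> a * f (fst p) + b * f (fst q)"
      using f p q ab unfolding convex_on_def by auto
    also have "\<dots> < a * snd p + b * snd q"
    proof (cases "a = 0")
      case True
      then show ?thesis using ab q by auto
    next
      case False
      then have "a * f (fst p) < a * snd p" using ab p by auto
      moreover have "b * f (fst q) \<le> b * snd q"
        using ab q by (intro mult_left_mono) auto
      ultimately show ?thesis by linarith
    qed
    finally show "a *\<^sub>R p + b *\<^sub>R q \<in> ?A" using 1 by auto
  qed
  moreover have "?A \<noteq> {}" using z by (auto intro!: exI[of _ z] exI[of _ "f z + 1"])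
  moreover have "?A \<inter> {(z, f z)} = {}" by auto
  ultimately have "\<exists>p \<beta>. p \<noteq> 0 \<and> (\<forall>v\<in>?A. p \<bullet> v \<le> \<beta>) \<and> (\<forall>v\<in>{(z, f z)}. p \<bullet> v \<ge> \<beta>)"
    by (intro separating_hyperplane_sets) simp_all
  then obtain p \<beta> where p: "p \<noteq> 0" and A: "\<And>v. v \<in> ?A \<Longrightarrow> p \<bullet> v \<le> \<beta>"
    and B: "p \<bullet> (z, f z) \<ge> \<beta>" by blast
  obtain a \<alpha> where pa: "p = (a, \<alpha>)" by (cases p)
  have up: "a \<bullet> x + \<alpha> * t \<le> a \<bullet> z + \<alpha> * f z" if "x \<in> S" "f x < t" for x t
    using A[of "(x, t)"] B that unfolding pa by auto
  have le: "a \<bullet> x + \<alpha> * f x \<le> a \<bullet> z + \<alpha> * f z" if "x \<in> S" for x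
  proof (rule field_le_epsilon)
    fix e :: real assume "e > 0"
    define d where "d = e / (\<bar>\<alpha>\<bar> + 1)"
    have "d > 0" using \<open>e > 0\<close> by (simp add: d_def)
    have "\<bar>\<alpha>\<bar> * d \<le> e" using \<open>e > 0\<close> by (simp add: d_def field_simps)
    moreover have "- (\<bar>\<alpha>\<bar> * d) \<le> \<alpha> * d" using \<open>d > 0\<close> by (simp add: abs_if)
    moreover have "a \<bullet> x + \<alpha> * (f x + d) \<le> a \<bullet> z + \<alpha> * f z" using up[OF that, of "f x + d"] \<open>d > 0\<close> by auto
    ultimately show "a \<bullet> x + \<alpha> * f x \<le> a \<bullet> z + \<alpha> * f z + e" by (simp add: algebra_simps)
  qed
  have "\<alpha> \<le> 0" using up[OF z, of "f z + 1"] by (simp add: algebra_simps)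
  moreover have "\<alpha> \<noteq> 0"
  proof
    assume "\<alpha> = 0"
    then have "a \<noteq> 0" using p pa by (auto simp: zero_prod_def)
    obtain r where r: "r > 0" "ball z r \<subseteq> S" using S z open_contains_ball by blast
    have "z + (r / 2 / norm a) *\<^sub>R a \<in> S" using r \<open>a \<noteq> 0\<close> by (intro subsetD[OF r(2)]) (auto simp: dist_norm)
    from le[OF this] \<open>\<alpha> = 0\<close> have "(r / 2 / norm a) * (a \<bullet> a) \<le> 0" by (simp add: inner_right_distrib)
    moreover have "(r / 2 / norm a) * (a \<bullet> a) > 0" using r \<open>a \<noteq> 0\<close> by simp
    ultimately show False by simp
  qed
  ultimately have neg: "\<alpha> < 0" by simp
  show thesis
  proof (rule that[of "- a /\<^sub>R \<alpha>"])
    fix x assume "x \<in> S"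
    from le[OF this] have "a \<bullet> (x - z) \<le> (- \<alpha>) * (f x - f z)" by (simp add: algebra_simps)
    then have "a \<bullet> (x - z) / (- \<alpha>) \<le> f x - f z" using neg by (subst pos_divide_le_eq) (auto simp: mult.commute)
    then show "f x \<ge> f z + (- a /\<^sub>R \<alpha>) \<bullet> (x - z)" by (simp add: divide_inverse mult.commute)
  qed
qed

text \<open>The lines of slope \<open>c - e\<close> and \<open>c + e\<close> both support the
  restriction of \<open>f\<close> to the line through \<open>x\<close> along \<open>b\<close>.
  Fixing \<open>c\<close> and \<open>e\<close> makes the condition closed, and lets the terms with
  \<open>c\<close> cancel when two points of the set are compared.\<close>

definition kink :: "('a::real_vector \<Rightarrow> real) \<Rightarrow> 'a \<Rightarrow> real \<Rightarrow> real \<Rightarrow> 'a set" where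
  "kink f b c e = {x. \<forall>t. f (x + t *\<^sub>R b) \<ge> f x + c * t + e * \<bar>t\<bar>}"

lemma convex_on_ray_le:
  fixes e :: "'a::real_vector \<Rightarrow> real"
  assumes "convex_on UNIV e" "e 0 = 0" "0 \<le> t" "t \<le> s" "s > 0"
  shows "e (t *\<^sub>R v) \<le> t / s * e (s *\<^sub>R v)"
proof -
  have "e ((1 - t / s) *\<^sub>R 0 + (t / s) *\<^sub>R (s *\<^sub>R v)) \<le> (1 - t / s) * e 0 + (t / s) * e (s *\<^sub>R v)"
    using assms by (intro convex_onD[OF assms(1)]) auto
  then show ?thesis using assms by simp
qed

text \<open>For convex functions, derivatives along the axes already give differentiability.
  Subtracting a support plane leaves \<open>e \<ge> 0\<close> with \<open>e 0 = 0\<close>. Either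
  \<open>e\<close> is o(t) along every axis, or the slope along some axis jumps at 0, and a rational
  number inside the jump produces a kink.\<close>

lemma convex_gderiv_or_kink:
  fixes f :: "'a::euclidean_space \<Rightarrow> real"
  assumes f: "convex_on UNIV f"
  shows "(\<exists>D. GDERIV f x :> D) \<or> (\<exists>b\<in>Basis. \<exists>c\<in>\<rat>. \<exists>m::nat. x \<in> kink f b c (1 / real (Suc m)))"
proof (rule disjCI)
  assume nk: "\<not> (\<exists>b\<in>Basis. \<exists>c\<in>\<rat>. \<exists>m::nat. x \<in> kink f b c (1 / real (Suc m)))"
  obtain q where q: "\<And>z. f z \<ge> f x + q \<bullet> (z - x)"
    using convex_on_subgradient[OF f] by auto
  define e where "e h = f (x + h) - f x - q \<bullet> h" for h
  have e0: "e 0 = 0" and epos: "e h \<ge> 0" for h using q[of "x + h"] by (auto simp: e_def)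
  have conv: "convex_on UNIV e"
  proof (rule convex_onI)
    fix t :: real and y z :: 'a assume t: "0 < t" "t < 1"
    have "f ((1 - t) *\<^sub>R (x + y) + t *\<^sub>R (x + z)) \<le> (1 - t) * f (x + y) + t * f (x + z)"
      using t by (intro convex_onD[OF f]) auto
    moreover have "(1 - t) *\<^sub>R (x + y) + t *\<^sub>R (x + z) = x + ((1 - t) *\<^sub>R y + t *\<^sub>R z)"
      by (simp add: algebra_simps)
    ultimately show "e ((1 - t) *\<^sub>R y + t *\<^sub>R z) \<le> (1 - t) * e y + t * e z"
      by (simp add: e_def algebra_simps)
  qed auto
  \<comment> \<open>If \<open>e\<close> grows at rate at least \<open>A\<close> on the side
    \<open>s\<close>, the supporting slopes fill an interval of length \<open>A\<close> with one end
    at \<open>q \<bullet> b\<close>, to its right for \<open>s = 1\<close> and to its left for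
    \<open>s = - 1\<close>. The rational \<open>c\<close> is chosen at distance more than
    \<open>\<epsilon>\<close> from both ends.\<close>
  have side: "\<exists>t>0. e (t *\<^sub>R (s *\<^sub>R b)) < A * t" if b: "b \<in> Basis" and A: "A > 0" and s: "s = 1 \<or> s = - 1"
    for b :: 'a and A s :: real
  proof (rule ccontr)
    assume "\<not> ?thesis"
    then have ge: "e (t *\<^sub>R (s *\<^sub>R b)) \<ge> A * t" if "t > 0" for t using that by (meson not_less)
    obtain m where m: "inverse (real (Suc m)) < A / 2" using reals_Archimedean[of "A/2"] A by auto
    define \<epsilon> where "\<epsilon> = 1 / real (Suc m)"
    have \<epsilon>: "\<epsilon> > 0" "\<epsilon> < A / 2" using m by (auto simp: \<epsilon>_def inverse_eq_divide)
    obtain c where c: "c \<in> \<rat>" "q \<bullet> b + (if s = 1 then \<epsilon> else \<epsilon> - A) < c" "c < q \<bullet> b + (if s = 1 then A - \<epsilon> else - \<epsilon>)"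
      using Rats_dense_in_real[of "q \<bullet> b + (if s = 1 then \<epsilon> else \<epsilon> - A)" "q \<bullet> b + (if s = 1 then A - \<epsilon> else - \<epsilon>)"] \<epsilon>
      by (cases "s = 1") auto
    have "x \<in> kink f b c \<epsilon>" unfolding kink_def
    proof (intro CollectI allI)
      fix t :: real
      have ft: "f (x + t *\<^sub>R b) = f x + t * (q \<bullet> b) + e (t *\<^sub>R b)" by (simp add: e_def)
      consider "t = 0" | "t \<noteq> 0" "s * t > 0" | "s * t < 0" using s by fastforce
      then have "t * (q \<bullet> b) + e (t *\<^sub>R b) \<ge> c * t + \<epsilon> * \<bar>t\<bar>"
      proof cases
        case 2
        have E: "e (t *\<^sub>R b) \<ge> A * \<bar>t\<bar>" using ge[of "s * t"] 2 s by (auto simp: abs_if)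
        show ?thesis
        proof (cases "s = 1")
          case True
          then have "t > 0" using 2 by auto
          then have "t * (c + \<epsilon>) \<le> t * (q \<bullet> b + A)" using c True by (intro mult_left_mono) auto
          then show ?thesis using E \<open>t > 0\<close> by (simp add: algebra_simps)
        next
          case False
          then have "t < 0" using 2 s by auto
          then have "(- t) * (\<epsilon> - c) \<le> (- t) * (A - q \<bullet> b)" using c False by (intro mult_left_mono) auto
          then show ?thesis using E \<open>t < 0\<close> by (simp add: algebra_simps)
        qed
      next
        case 3
        have E: "e (t *\<^sub>R b) \<ge> 0" by (rule epos)
        show ?thesis
        proof (cases "s = 1")
          case True
          then have "t < 0" using 3 by auto
          then have "(- t) * (q \<bullet> b + \<epsilon>) \<le> (- t) * c" using c True by (intro mult_left_mono) auto
          then show ?thesis using E \<open>t < 0\<close> by (simp add: algebra_simps)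
        next
          case False
          then have "t > 0" using 3 s by auto
          then have "t * (c + \<epsilon>) \<le> t * (q \<bullet> b)" using c False by (intro mult_left_mono) auto
          then show ?thesis using E \<open>t > 0\<close> by (simp add: algebra_simps)
        qed
      qed (use epos e0 in simp)
      then show "f (x + t *\<^sub>R b) \<ge> f x + c * t + \<epsilon> * \<bar>t\<bar>" using ft by linarith
    qed
    then show False using nk b c(1) unfolding \<epsilon>_def by blast
  qed
  have small: "\<exists>\<tau>>0. \<forall>t. \<bar>t\<bar> \<le> \<tau> \<longrightarrow> e (t *\<^sub>R b) \<le> A * \<bar>t\<bar>" if b: "b \<in> Basis" and A: "A > 0" for b A
  proof -
    obtain t1 where t1: "t1 > 0" "e (t1 *\<^sub>R b) < A * t1" using side[OF b A, of 1] by auto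
    obtain t2 where t2: "t2 > 0" "e (t2 *\<^sub>R (- b)) < A * t2" using side[OF b A, of "-1"] by auto
    show ?thesis
    proof (intro exI[of _ "min t1 t2"] conjI allI impI)
      fix t :: real assume t: "\<bar>t\<bar> \<le> min t1 t2"
      show "e (t *\<^sub>R b) \<le> A * \<bar>t\<bar>"
      proof (cases "t \<ge> 0")
        case True
        have "e (t *\<^sub>R b) \<le> t / t1 * e (t1 *\<^sub>R b)" using t True t1 by (intro convex_on_ray_le conv e0) auto
        also have "\<dots> \<le> t / t1 * (A * t1)" using t1 True by (intro mult_left_mono) auto
        finally show ?thesis using t1 True by (simp add: mult.commute)
      next
        case False
        have "e ((- t) *\<^sub>R (- b)) \<le> (- t) / t2 * e (t2 *\<^sub>R (- b))" using t False t2 by (intro convex_on_ray_le conv e0) auto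
        also have "\<dots> \<le> (- t) / t2 * (A * t2)" using t2 False by (intro mult_left_mono) (auto simp: divide_nonpos_pos)
        finally show ?thesis using t2 False by (simp add: mult.commute)
      qed
    qed (use t1 t2 in auto)
  qed
  define N where "N = real DIM('a)"
  have N: "N > 0" by (simp add: N_def)
  \<comment> \<open>\<open>h\<close> is the mean of the \<open>N\<close> axis vectors
    \<open>(N * (h \<bullet> b)) *\<^sub>R b\<close>, so Jensen's inequality reduces
    \<open>e h\<close> to values on the axes.\<close>
  have esum: "e h \<le> (\<Sum>b\<in>Basis. (1 / N) * e ((N * (h \<bullet> b)) *\<^sub>R b))" for h
  proof -
    have "e (\<Sum>b\<in>Basis. (1 / N) *\<^sub>R ((N * (h \<bullet> b)) *\<^sub>R b)) \<le> (\<Sum>b\<in>Basis. (1 / N) * e ((N * (h \<bullet> b)) *\<^sub>R b))"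
      using N by (intro convex_on_sum[OF _ _ conv]) (auto simp: N_def)
    moreover have "(\<Sum>b\<in>Basis. (1 / N) *\<^sub>R ((N * (h \<bullet> b)) *\<^sub>R b)) = h"
      using N by (simp add: euclidean_representation)
    ultimately show ?thesis by simp
  qed
  have "GDERIV f x :> q" unfolding gderiv_def has_derivative_at_alt
  proof (intro conjI allI impI)
    show "bounded_linear (\<lambda>h. h \<bullet> q)" by (rule bounded_linear_inner_left)
    fix \<eta> :: real assume \<eta>: "\<eta> > 0"
    define A where "A = \<eta> / N"
    have A: "A > 0" using \<eta> N by (simp add: A_def)
    have "\<forall>b\<in>Basis. \<exists>\<tau>>0. \<forall>t. \<bar>t\<bar> \<le> \<tau> \<longrightarrow> e (t *\<^sub>R b) \<le> A * \<bar>t\<bar>" using small A by blast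
    then obtain \<tau> where \<tau>: "\<And>b::'a. b \<in> Basis \<Longrightarrow> \<tau> b > 0"
      "\<And>b t. b \<in> Basis \<Longrightarrow> \<bar>t\<bar> \<le> \<tau> b \<Longrightarrow> e (t *\<^sub>R b) \<le> A * \<bar>t\<bar>" by metis
    define d where "d = Min (\<tau> ` Basis) / N"
    have "Min (\<tau> ` Basis) > 0" using \<tau>(1) by (subst Min_gr_iff) auto
    then have "d > 0" using N by (simp add: d_def)
    have dle: "N * d \<le> \<tau> b" if "b \<in> Basis" for b
      using N that by (simp add: d_def)
    show "\<exists>d>0. \<forall>y. norm (y - x) < d \<longrightarrow> norm (f y - f x - (y - x) \<bullet> q) \<le> \<eta> * norm (y - x)"
    proof (intro exI[of _ d] conjI allI impI \<open>d > 0\<close>)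
      fix y assume y: "norm (y - x) < d"
      define h where "h = y - x"
      have "e h \<le> (\<Sum>b\<in>Basis. (1 / N) * e ((N * (h \<bullet> b)) *\<^sub>R b))" by (rule esum)
      also have "\<dots> \<le> (\<Sum>b\<in>(Basis::'a set). (1 / N) * (A * (N * norm h)))"
      proof (intro sum_mono mult_left_mono)
        fix b :: 'a assume b: "b \<in> Basis"
        have hb: "\<bar>h \<bullet> b\<bar> \<le> norm h" using Basis_le_norm[OF b, of h] .
        have "\<bar>h \<bullet> b\<bar> \<le> d" by (rule order_trans[OF hb less_imp_le[OF y[folded h_def]]])
        have "\<bar>N * (h \<bullet> b)\<bar> = N * \<bar>h \<bullet> b\<bar>" by (simp only: abs_mult abs_of_pos[OF N])
        also have "\<dots> \<le> N * d" by (rule mult_left_mono[OF \<open>\<bar>h \<bullet> b\<bar> \<le> d\<close> less_imp_le[OF N]])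
        also have "\<dots> \<le> \<tau> b" by (rule dle[OF b])
        finally have "e ((N * (h \<bullet> b)) *\<^sub>R b) \<le> A * \<bar>N * (h \<bullet> b)\<bar>" by (intro \<tau>(2) b)
        also have "\<dots> \<le> A * (N * norm h)" using N A hb by (auto simp: abs_mult)
        finally show "e ((N * (h \<bullet> b)) *\<^sub>R b) \<le> A * (N * norm h)" .
      qed (use N in auto)
      also have "\<dots> = \<eta> * norm h" using N by (simp add: A_def N_def)
      finally have "e h \<le> \<eta> * norm h" .
      moreover have "f y - f x - (y - x) \<bullet> q = e h" by (simp add: e_def h_def inner_commute)
      ultimately show "norm (f y - f x - (y - x) \<bullet> q) \<le> \<eta> * norm (y - x)"
        using epos[of h] by (simp add: h_def)
    qed
  qed
  then show "\<exists>D. GDERIV f x :> D" ..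
qed

text \<open>Add the kink inequality at \<open>x\<close> for the step \<open>t\<close> to the one at
  \<open>y\<close> for the step \<open>- t\<close>: the slopes \<open>c\<close> cancel. The two
  shifted points miss \<open>y\<close> and \<open>x\<close> only by \<open>h\<close>, which costs
  \<open>L * norm h\<close> each. So a kink set is a Lipschitz graph in direction \<open>b\<close>
  with constant \<open>L / e\<close>.\<close>

lemma kink_cone_bound:
  fixes f :: "'a::euclidean_space \<Rightarrow> real"
  assumes lip: "\<And>x y. \<bar>f x - f y\<bar> \<le> L * norm (x - y)"
    and x: "x \<in> kink f b c e" and y: "y \<in> kink f b c e" and yx: "y - x = t *\<^sub>R b + h"
  shows "e * \<bar>t\<bar> \<le> L * norm h"
proof -
  have 1: "f (x + t *\<^sub>R b) \<ge> f x + c * t + e * \<bar>t\<bar>" using x by (auto simp: kink_def)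
  have 2: "f (y + (- t) *\<^sub>R b) \<ge> f y + c * (- t) + e * \<bar>t\<bar>"
    using y unfolding kink_def by (auto dest: spec[of _ "- t"])
  have yx': "y = x + t *\<^sub>R b + h" using yx by (simp add: algebra_simps)
  have "\<bar>f (x + t *\<^sub>R b) - f y\<bar> \<le> L * norm h"
    using lip[of "x + t *\<^sub>R b" y] by (simp add: yx')
  moreover have "\<bar>f (y + (- t) *\<^sub>R b) - f x\<bar> \<le> L * norm h"
    using lip[of "y + (- t) *\<^sub>R b" x] by (simp add: yx')
  ultimately show ?thesis using 1 2 by simp
qed

lemma closed_kink:
  fixes f :: "'a::euclidean_space \<Rightarrow> real"
  assumes "continuous_on UNIV f"
  shows "closed (kink f b c e)"
proof -
  have "kink f b c e = (\<Inter>t. {x. f x + c * t + e * \<bar>t\<bar> \<le> f (x + t *\<^sub>R b)})"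
    by (auto simp: kink_def)
  moreover have "closed {x. f x + c * t + e * \<bar>t\<bar> \<le> f (x + t *\<^sub>R b)}" for t
    by (intro closed_Collect_le continuous_intros assms continuous_on_compose2[OF assms]) auto
  ultimately show ?thesis by auto
qed

text \<open>Seen from a point far away in direction \<open>- b\<close>, the truncated kink set is
  hit at most once by every ray, because the rays are steeper than the cone bound allows; such
  starlike closed sets are negligible.\<close>

lemma negligible_kink:
  fixes f :: "'a::euclidean_space \<Rightarrow> real"
  assumes lip: "\<And>x y. \<bar>f x - f y\<bar> \<le> L * norm (x - y)"
    and b: "b \<in> Basis" and e: "e > 0"
  shows "negligible (kink f b c e)"
proof -
  have L: "L \<ge> 0" using lip[of 0 b] b by auto
  have cont: "continuous_on UNIV f"
    using lip by (intro lipschitz_on_continuous_on[of L] lipschitz_onI) (auto simp: dist_norm L)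
  have "negligible (kink f b c e \<inter> cball 0 \<rho>)" if \<rho>: "\<rho> > 0" for \<rho> :: real
  proof -
    \<comment> \<open>Chosen so that \<open>e * (M - \<rho>) > L * \<rho>\<close>: the component
      along \<open>b\<close> of a ray into the ball outweighs its orthogonal part.\<close>
    define M where "M = \<rho> + L * \<rho> / e + 1"
    show ?thesis
    proof (rule starlike_negligible[of _ "- M *\<^sub>R b"])
      show "closed (kink f b c e \<inter> cball 0 \<rho>)"
        by (intro closed_Int closed_kink cont closed_cball)
      fix k :: real and x :: 'a
      assume 1: "- M *\<^sub>R b + k *\<^sub>R x \<in> kink f b c e \<inter> cball 0 \<rho>" and k: "0 \<le> k"
        and 2: "- M *\<^sub>R b + x \<in> kink f b c e \<inter> cball 0 \<rho>"
      define h where "h = x - (x \<bullet> b) *\<^sub>R b"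
      define p where "p = - M *\<^sub>R b + x"
      have bb: "b \<bullet> b = 1" "norm b = 1" using b by auto
      have "\<bar>p \<bullet> b\<bar> \<le> norm p" using b by (rule Basis_le_norm)
      also have "\<dots> \<le> \<rho>" using 2 by (auto simp: p_def)
      finally have xb: "x \<bullet> b \<ge> M - \<rho>" by (simp add: p_def inner_diff_left inner_add_left bb abs_le_iff)
      have hp: "h = p - (p \<bullet> b) *\<^sub>R b" by (simp add: h_def p_def inner_left_distrib bb algebra_simps)
      then have "norm h \<le> norm p" using norm_orthogonal_part_le[OF bb(2), of p] by simp
      then have nh: "norm h \<le> \<rho>" using \<open>norm p \<le> \<rho>\<close> by simp
      have "e * \<bar>(k - 1) * (x \<bullet> b)\<bar> \<le> L * norm ((k - 1) *\<^sub>R h)"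
        by (rule kink_cone_bound[OF lip, of "- M *\<^sub>R b + x" b c e "- M *\<^sub>R b + k *\<^sub>R x"])
          (use 1 2 in \<open>auto simp: h_def algebra_simps\<close>)
      then have "\<bar>k - 1\<bar> * (e * \<bar>x \<bullet> b\<bar>) \<le> \<bar>k - 1\<bar> * (L * norm h)" by (simp add: abs_mult mult_ac)
      moreover have "L * norm h < e * \<bar>x \<bullet> b\<bar>"
      proof -
        have "L * norm h \<le> L * \<rho>" using nh L by (intro mult_left_mono) auto
        also have "\<dots> < e * (M - \<rho>)" using e by (simp add: M_def field_simps)
        also have "\<dots> \<le> e * \<bar>x \<bullet> b\<bar>" using e xb by (intro mult_left_mono) auto
        finally show ?thesis .
      qed
      ultimately have "\<not> \<bar>k - 1\<bar> > 0" by (meson mult_less_cancel_left_pos not_less)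
      then show "k = 1" by simp
    qed
  qed
  then have "negligible (\<Union>n. kink f b c e \<inter> cball 0 (real (Suc n)))"
    by (intro negligible_Union_nat) auto
  moreover have "kink f b c e \<subseteq> (\<Union>n. kink f b c e \<inter> cball 0 (real (Suc n)))"
  proof
    fix x assume x: "x \<in> kink f b c e"
    obtain n where "norm x \<le> real n" using real_arch_simple by blast
    then show "x \<in> (\<Union>n. kink f b c e \<inter> cball 0 (real (Suc n)))" using x by (auto intro!: exI[of _ n])
  qed
  ultimately show ?thesis by (rule negligible_subset)
qed

lemma convex_lipschitz_negligible_nondiff:
  fixes f :: "'a::euclidean_space \<Rightarrow> real"
  assumes f: "convex_on UNIV f" and lip: "\<And>x y. \<bar>f x - f y\<bar> \<le> L * norm (x - y)"
  shows "negligible {x. \<not> (\<exists>D. GDERIV f x :> D)}"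
proof (rule negligible_subset)
  show "{x. \<not> (\<exists>D. GDERIV f x :> D)} \<subseteq> \<Union>((\<lambda>(b, c, m::nat). kink f b c (1 / real (Suc m))) ` (Basis \<times> \<rat> \<times> UNIV))"
    using convex_gderiv_or_kink[OF f] by fastforce
  show "negligible (\<Union>((\<lambda>(b, c, m::nat). kink f b c (1 / real (Suc m))) ` (Basis \<times> \<rat> \<times> UNIV)))"
  proof (rule negligible_countable_Union)
    show "countable ((\<lambda>(b, c, m::nat). kink f b c (1 / real (Suc m))) ` ((Basis::'a set) \<times> \<rat> \<times> UNIV))"
      by (intro countable_image countable_SIGMA countable_rat) (auto simp: countable_finite)
    show "negligible S" if "S \<in> (\<lambda>(b, c, m::nat). kink f b c (1 / real (Suc m))) ` (Basis \<times> \<rat> \<times> UNIV)" for S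
      using that negligible_kink[OF lip] by auto
  qed
qed

section \<open>Hausdorff null sets\<close>

text \<open>Bounded upper Minkowski content in codimension 2. Multiplying by
  \<open>r ^ DIM('a)\<close> avoids the exponent \<open>DIM('a) - 2\<close>. In dimension 1 the
  condition forces \<open>A = {}\<close>, as is required for the counting measure to vanish.\<close>

definition minkowski_codim2 :: "'a::euclidean_space set \<Rightarrow> bool" where
  "minkowski_codim2 A \<longleftrightarrow> (\<exists>C. \<forall>r. 0 < r \<and> r \<le> 1 \<longrightarrow>
     (\<exists>X. finite X \<and> A \<subseteq> (\<Union>x\<in>X. cball x r) \<and> real (card X) * r ^ DIM('a) \<le> C * r\<^sup>2))"

lemma minkowski_codim2_translation:
  fixes A :: "'a::euclidean_space set"
  assumes "minkowski_codim2 A"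
  shows "minkowski_codim2 ((+) a ` A)"
proof -
  obtain C where C: "\<And>r. 0 < r \<Longrightarrow> r \<le> 1 \<Longrightarrow>
     (\<exists>X. finite X \<and> A \<subseteq> (\<Union>x\<in>X. cball x r) \<and> real (card X) * r ^ DIM('a) \<le> C * r\<^sup>2)"
    using assms unfolding minkowski_codim2_def by blast
  show ?thesis unfolding minkowski_codim2_def
  proof (intro exI[of _ C] allI impI)
    fix r :: real assume "0 < r \<and> r \<le> 1"
    then obtain X where X: "finite X" "A \<subseteq> (\<Union>x\<in>X. cball x r)" "real (card X) * r ^ DIM('a) \<le> C * r\<^sup>2"
      using C[of r] by blast
    show "\<exists>X. finite X \<and> (+) a ` A \<subseteq> (\<Union>x\<in>X. cball x r) \<and> real (card X) * r ^ DIM('a) \<le> C * r\<^sup>2"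
    proof (intro exI[of _ "(+) a ` X"] conjI)
      show "(+) a ` A \<subseteq> (\<Union>x\<in>(+) a ` X. cball x r)" using X(2) by (fastforce simp: dist_norm)
    qed (use X in \<open>auto simp: card_image\<close>)
  qed
qed

text \<open>One dimension is to spare: a cover by balls of radius \<open>r\<close> has cost of order
  \<open>r\<close> in dimension \<open>DIM('a) - 1\<close>, so the radius for the set
  \<open>A j\<close> can be chosen to meet any budget.\<close>

lemma hausdorff_measure_eq_0:
  fixes A :: "nat \<Rightarrow> 'a::euclidean_space set"
  assumes A: "\<And>j. minkowski_codim2 (A j)" and E: "E \<subseteq> (\<Union>j. A j)"
  shows "hausdorff_measure (DIM('a) - 1) E = 0"
proof -
  let ?k = "DIM('a) - 1"
  define V where "V = unit_ball_vol (real ?k)"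
  have V: "V > 0" by (simp add: V_def)
  have content: "hausdorff_content ?k \<delta> E \<le> ennreal \<eta>" if \<delta>: "\<delta> > 0" and \<eta>: "\<eta> > 0" for \<delta> \<eta>
  proof -
    have "\<forall>j. \<exists>X r. 0 < r \<and> 2 * r \<le> \<delta> \<and> finite X \<and> A j \<subseteq> (\<Union>x\<in>X. cball x r) \<and>
      real (card X) * (V * r ^ ?k) \<le> \<eta> * (1/2) ^ Suc j"
    proof
      fix j
      obtain C where C: "\<And>r. 0 < r \<Longrightarrow> r \<le> 1 \<Longrightarrow>
         (\<exists>X. finite X \<and> A j \<subseteq> (\<Union>x\<in>X. cball x r) \<and> real (card X) * r ^ DIM('a) \<le> C * r\<^sup>2)"
        using A[of j] unfolding minkowski_codim2_def by blast
      \<comment> \<open>The last entry keeps the cost of the cover of \<open>A j\<close> below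
        \<open>\<eta> * (1/2) ^ Suc j\<close>, and these budgets sum to
        \<open>\<eta>\<close>.\<close>
      define r where "r = min (min 1 (\<delta> / 2)) (\<eta> * (1/2) ^ Suc j / (V * (\<bar>C\<bar> + 1)))"
      have r: "0 < r" "r \<le> 1" "2 * r \<le> \<delta>" and rle: "r \<le> \<eta> * (1/2) ^ Suc j / (V * (\<bar>C\<bar> + 1))"
        using \<delta> \<eta> V by (auto simp: r_def)
      obtain X where X: "finite X" "A j \<subseteq> (\<Union>x\<in>X. cball x r)" "real (card X) * r ^ DIM('a) \<le> C * r\<^sup>2"
        using C[OF r(1,2)] by blast
      have "r ^ DIM('a) = r * r ^ ?k" by (metis DIM_positive Suc_diff_1 power_Suc)
      then have "r * (real (card X) * r ^ ?k) \<le> r * (C * r)" using X(3) by (simp add: power2_eq_square mult_ac)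
      then have "real (card X) * r ^ ?k \<le> C * r" using r by simp
      also have "\<dots> \<le> (\<bar>C\<bar> + 1) * r" using r by (intro mult_right_mono) auto
      finally have "V * (real (card X) * r ^ ?k) \<le> V * ((\<bar>C\<bar> + 1) * r)" using V by (intro mult_left_mono) auto
      also have "\<dots> \<le> \<eta> * (1/2) ^ Suc j"
      proof -
        have "V * (\<bar>C\<bar> + 1) > 0" using V by (intro mult_pos_pos) auto
        then show ?thesis using rle by (simp only: pos_le_divide_eq mult_ac)
      qed
      finally show "\<exists>X r. 0 < r \<and> 2 * r \<le> \<delta> \<and> finite X \<and> A j \<subseteq> (\<Union>x\<in>X. cball x r) \<and>
        real (card X) * (V * r ^ ?k) \<le> \<eta> * (1/2) ^ Suc j"
        using r X by (intro exI[of _ X] exI[of _ r]) (auto simp: mult_ac)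
    qed
    then obtain X r where r: "\<And>j. 0 < r j" "\<And>j. 2 * r j \<le> \<delta>" and X: "\<And>j. finite (X j)"
      "\<And>j. A j \<subseteq> (\<Union>x\<in>X j. cball x (r j))" "\<And>j. real (card (X j)) * (V * r j ^ ?k) \<le> \<eta> * (1/2) ^ Suc j"
      by metis
    have "\<forall>j. \<exists>h. bij_betw h {0..<card (X j)} (X j)" using ex_bij_betw_nat_finite X(1) by blast
    then obtain h where h: "\<And>j. bij_betw (h j) {0..<card (X j)} (X j)" by metis
    \<comment> \<open>The finite covers are padded with empty sets, which cost nothing, and the
      double sequence is then read through \<open>prod_decode\<close>.\<close>
    define D where "D = (\<lambda>(j, i). if i < card (X j) then cball (h j i) (r j) else {})"
    define cost :: "'a set \<Rightarrow> ennreal" where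
      "cost S = (if S = {} then 0 else ennreal (V * (diameter S / 2) ^ ?k))" for S
    have cov: "E \<subseteq> (\<Union>i. D (prod_decode i))"
    proof
      fix x assume "x \<in> E"
      then obtain j where "x \<in> A j" using E by auto
      then obtain y where y: "y \<in> X j" "x \<in> cball y (r j)" using X(2) by blast
      then obtain i where i: "i < card (X j)" "h j i = y" using h[of j] unfolding bij_betw_def by force
      have "x \<in> D (prod_decode (prod_encode (j, i)))" using y i by (simp add: D_def)
      then show "x \<in> (\<Union>i. D (prod_decode i))" by blast
    qed
    have bdd: "bounded (D p) \<and> diameter (D p) \<le> \<delta>" for p
      using r[of "fst p"] \<delta> by (auto simp: D_def split: prod.split)
    have "hausdorff_content ?k \<delta> E \<le> (\<Sum>i. cost (D (prod_decode i)))"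
      unfolding hausdorff_content_def cost_def V_def
      by (rule INF_lower) (use cov bdd in auto)
    also have "\<dots> = (\<Sum>j. \<Sum>i. cost (D (j, i)))"
      by (rule suminf_ennreal_2dimen[where f = "\<lambda>p. cost (D p)"]) simp
    also have "\<dots> \<le> (\<Sum>j. ennreal (\<eta> * (1/2) ^ Suc j))"
    proof (rule suminf_le)
      fix j
      have "(\<Sum>i. cost (D (j, i))) = (\<Sum>i<card (X j). cost (D (j, i)))"
        by (rule suminf_finite) (auto simp: D_def cost_def)
      also have "\<dots> \<le> (\<Sum>i<card (X j). ennreal (V * r j ^ ?k))"
        using r(1)[of j] by (intro sum_mono) (auto simp: D_def cost_def less_imp_le)
      also have "\<dots> = ennreal (real (card (X j)) * (V * r j ^ ?k))"
        using V r(1)[of j] by (simp add: ennreal_mult less_imp_le ennreal_of_nat_eq_real_of_nat)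
      also have "\<dots> \<le> ennreal (\<eta> * (1/2) ^ Suc j)" by (intro ennreal_leI X)
      finally show "(\<Sum>i. cost (D (j, i))) \<le> ennreal (\<eta> * (1/2) ^ Suc j)" .
    qed auto
    also have "\<dots> = ennreal \<eta>"
    proof (rule suminf_ennreal_eq)
      show "(\<lambda>j. \<eta> * (1/2) ^ Suc j) sums \<eta>" using sums_mult[OF power_half_series, of \<eta>] by simp
    qed (use \<eta> in auto)
    finally show ?thesis .
  qed
  have "hausdorff_content ?k \<delta> E = 0" if "\<delta> > 0" for \<delta>
  proof -
    have "hausdorff_content ?k \<delta> E \<le> 0"
    proof (rule ennreal_le_epsilon)
      fix e :: real assume "e > 0"
      then show "hausdorff_content ?k \<delta> E \<le> 0 + ennreal e" using content[OF that] by simp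
    qed
    then show ?thesis by simp
  qed
  then show ?thesis unfolding hausdorff_measure_def by (auto intro!: SUP_eq_const)
qed

section \<open>Packing estimates and the dimension of kink sets\<close>

lemma separated_card_bound:
  fixes Z :: "'a::euclidean_space set"
  assumes Z: "finite Z" "Z \<subseteq> cball 0 M" and \<rho>: "\<rho> > 0" and M: "M \<ge> 0"
    and sep: "\<And>x y. x \<in> Z \<Longrightarrow> y \<in> Z \<Longrightarrow> x \<noteq> y \<Longrightarrow> dist x y \<ge> 2 * \<rho>"
  shows "real (card Z) * \<rho> ^ DIM('a) \<le> (M + \<rho>) ^ DIM('a)"
proof -
  define V where "V = unit_ball_vol (real DIM('a))"
  have V: "V > 0" by (simp add: V_def)
  have disj: "disjoint_family_on (\<lambda>z. ball z \<rho>) Z"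
    unfolding disjoint_family_on_def
  proof (intro ballI impI)
    fix x y assume xy: "x \<in> Z" "y \<in> Z" "x \<noteq> y"
    have False if "w \<in> ball x \<rho>" "w \<in> ball y \<rho>" for w
      using sep[OF xy] that dist_triangle2[of x y w] by (simp add: dist_commute)
    then show "ball x \<rho> \<inter> ball y \<rho> = {}" by blast
  qed
  have "real (card Z) * (V * \<rho> ^ DIM('a)) = (\<Sum>z\<in>Z. measure lborel (ball z \<rho>))"
    using \<rho> by (simp add: content_ball V_def)
  also have "\<dots> = measure lborel (\<Union>z\<in>Z. ball z \<rho>)"
    using disj Z by (intro measure_finite_Union[symmetric]) (auto simp: less_imp_neq[OF emeasure_lborel_ball_finite[unfolded infinity_ennreal_def]])
  also have "\<dots> \<le> measure lborel (ball (0::'a) (M + \<rho>))"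
  proof (rule measure_mono_fmeasurable[where M = lborel])
    show "(\<Union>z\<in>Z. ball z \<rho>) \<subseteq> ball 0 (M + \<rho>)"
    proof
      fix w assume "w \<in> (\<Union>z\<in>Z. ball z \<rho>)"
      then obtain z where z: "z \<in> Z" "dist z w < \<rho>" by auto
      have "dist 0 w \<le> dist 0 z + dist z w" by (rule dist_triangle)
      moreover have "dist 0 z \<le> M" using z Z by auto
      ultimately show "w \<in> ball 0 (M + \<rho>)" using z by auto
    qed
    show "ball 0 (M + \<rho>) \<in> fmeasurable lborel" by (intro fmeasurableI) (auto simp: emeasure_lborel_ball_finite[unfolded infinity_ennreal_def])
  qed (auto intro!: borel_open)
  also have "\<dots> = V * (M + \<rho>) ^ DIM('a)" using M \<rho> by (simp add: content_ball V_def)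
  finally have "V * (real (card Z) * \<rho> ^ DIM('a)) \<le> V * (M + \<rho>) ^ DIM('a)" by (simp add: mult_ac)
  then show ?thesis using V by simp
qed

text \<open>A separated set of largest cardinality is a net, since an uncovered point could be added
  to it. The uniform bound \<open>B\<close> makes a largest one exist.\<close>

lemma maximal_separated_cover:
  fixes E :: "'a::metric_space set"
  assumes r: "r \<ge> 0" and bound: "\<And>X. finite X \<Longrightarrow> X \<subseteq> E \<Longrightarrow>
      (\<And>x y. x \<in> X \<Longrightarrow> y \<in> X \<Longrightarrow> x \<noteq> y \<Longrightarrow> dist x y \<ge> r) \<Longrightarrow> real (card X) \<le> B"
  obtains X where "finite X" "X \<subseteq> E" "E \<subseteq> (\<Union>x\<in>X. cball x r)"
    "\<And>x y. x \<in> X \<Longrightarrow> y \<in> X \<Longrightarrow> x \<noteq> y \<Longrightarrow> dist x y \<ge> r"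
proof -
  define P where "P X \<longleftrightarrow> finite X \<and> X \<subseteq> E \<and> (\<forall>x\<in>X. \<forall>y\<in>X. x \<noteq> y \<longrightarrow> dist x y \<ge> r)" for X
  have "P {}" by (simp add: P_def)
  moreover have "card X \<le> nat \<lceil>B\<rceil>" if "P X" for X
  proof -
    have "real (card X) \<le> B" using that by (intro bound) (auto simp: P_def)
    then show ?thesis by linarith
  qed
  ultimately have "\<exists>X. P X \<and> (\<forall>Y. P Y \<longrightarrow> card Y \<le> card X)"
    by (intro ex_has_greatest_nat[of P "{}" card "Suc (nat \<lceil>B\<rceil>)"]) (auto simp: less_Suc_eq_le)
  then obtain X where X: "P X" and max: "\<And>Y. P Y \<Longrightarrow> card Y \<le> card X" by auto
  have "E \<subseteq> (\<Union>x\<in>X. cball x r)"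
  proof (rule ccontr)
    assume "\<not> ?thesis"
    then obtain z where "z \<in> E" "z \<notin> (\<Union>x\<in>X. cball x r)" by blast
    then have z: "z \<in> E" "\<And>x. x \<in> X \<Longrightarrow> dist x z > r" by (auto simp: not_le)
    then have "z \<notin> X" using r by force
    have "P (insert z X)" unfolding P_def
      using X z by (auto simp: P_def dist_commute intro: less_imp_le)
    then have "card (insert z X) \<le> card X" by (rule max)
    then show False using X \<open>z \<notin> X\<close> by (simp add: P_def)
  qed
  then show thesis using X that by (auto simp: P_def)
qed

text \<open>Both the cone structure of the kink set and its being a Lipschitz graph in direction \<open>b\<close>
  cost one dimension: a separated subset of the level set is spread out along rays and along
  \<open>b\<close> before volumes are compared.\<close>

lemma minkowski_codim2_kink:
  fixes f g :: "'a::euclidean_space \<Rightarrow> real"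
  assumes lip: "\<And>x y. \<bar>f x - f y\<bar> \<le> L * norm (x - y)"
    and hom: "\<And>k x. k > 0 \<Longrightarrow> f (k *\<^sub>R x) = k * f x"
    and glip: "\<And>x y. \<bar>g x - g y\<bar> \<le> G * norm (x - y)"
    and ghom: "\<And>k x. k > 0 \<Longrightarrow> g (k *\<^sub>R x) = k * g x"
    and b: "b \<in> Basis" and e: "e > 0"
    and E: "E \<subseteq> kink f b c e" "E \<subseteq> {x. g x = 1}" "E \<subseteq> cball 0 D"
  shows "minkowski_codim2 E"
proof -
  have nb: "norm b = 1" using b by simp
  have L: "L \<ge> 0" using lip[of 0 b] nb by auto
  have G: "G \<ge> 0" using glip[of 0 b] nb by auto
  define D' where "D' = max D 0"
  have D': "D' \<ge> 0" "\<And>x. x \<in> E \<Longrightarrow> norm x \<le> D'" using E(3) by (auto simp: D'_def)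
  define K where "K = L / e"
  have K: "K \<ge> 0" using L e by (simp add: K_def)
  \<comment> \<open>The loss of separation: the factor \<open>1 + G\<close> comes from detecting
    different dilations through \<open>g\<close>, the factor \<open>1 + K\<close> from discarding
    the component along \<open>b\<close>.\<close>
  define \<kappa> where "\<kappa> = 1 / ((1 + G) * (1 + K))"
  have "1 * 1 \<le> (1 + G) * (1 + K)" using G K by (intro mult_mono) auto
  then have \<kappa>: "0 < \<kappa>" "\<kappa> \<le> 1" by (simp_all add: \<kappa>_def)
  have cone: "k *\<^sub>R x \<in> kink f b c e" if "x \<in> kink f b c e" "k > 0" for k x
    unfolding kink_def
  proof (intro CollectI allI)
    fix t
    have "f (x + (t / k) *\<^sub>R b) \<ge> f x + c * (t / k) + e * \<bar>t / k\<bar>" using that(1) unfolding kink_def by blast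
    then have "k * f (x + (t / k) *\<^sub>R b) \<ge> k * (f x + c * (t / k) + e * \<bar>t / k\<bar>)"
      using that by (intro mult_left_mono) auto
    moreover have "k * f (x + (t / k) *\<^sub>R b) = f (k *\<^sub>R x + t *\<^sub>R b)"
      using hom[OF that(2), of "x + (t / k) *\<^sub>R b"] that by (simp add: scaleR_add_right)
    ultimately show "f (k *\<^sub>R x + t *\<^sub>R b) \<ge> f (k *\<^sub>R x) + c * t + e * \<bar>t\<bar>"
      using that hom[OF that(2), of x] by (simp add: distrib_left abs_divide)
  qed
  define n where "n = DIM('a)"
  \<comment> \<open>The 4 compensates \<open>real m * r \<ge> 1/2\<close>, which enters squared; the
    power is the volume ratio of the packing.\<close>
  define C where "C = 4 * (2 * (2 * D' + 2) / \<kappa>) ^ n"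
  have bound: "real (card X) * r ^ n \<le> C * r\<^sup>2" if r: "0 < r" "r \<le> 1" and X: "finite X" "X \<subseteq> E"
    and sep: "\<And>x y. x \<in> X \<Longrightarrow> y \<in> X \<Longrightarrow> x \<noteq> y \<Longrightarrow> dist x y \<ge> r" for r X
  proof -
    \<comment> \<open>About \<open>1 / r\<close> dilation factors between 1 and 2, and as many
      shifts of length at most 1, fit at spacing \<open>r\<close>.\<close>
    define m where "m = nat \<lfloor>1 / r\<rfloor>"
    have m: "real m * r \<le> 1" "1 \<le> 2 * (real m * r)"
    proof -
      have "1 / r \<ge> 1" using r by simp
      moreover from this have "real m = of_int \<lfloor>1 / r\<rfloor>" using r by (simp add: m_def of_nat_nat)
      moreover have "1 \<le> \<lfloor>1 / r\<rfloor>" using \<open>1 / r \<ge> 1\<close> by simp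
      ultimately have "real m \<le> 1 / r" "1 / r \<le> 2 * real m" by linarith+
      then show "real m * r \<le> 1" "1 \<le> 2 * (real m * r)" using r by (auto simp: field_simps)
    qed
    define z where "z = (\<lambda>(x, k, j). (1 + real k * r) *\<^sub>R x + (real j * r) *\<^sub>R b)"
    define I where "I = X \<times> {..<m} \<times> {..<m}"
    \<comment> \<open>Different dilations are told apart by \<open>g\<close>, which takes the value
      \<open>1 + real k * r\<close> there. For equal dilations, different base points stay
      \<open>r\<close> apart because the factor is at least 1. In both cases the difference keeps a
      definite component orthogonal to \<open>b\<close> by the cone bound, and no shift along
      \<open>b\<close> can cancel that. If only the shifts differ, the distance is a nonzero
      multiple of \<open>r\<close>.\<close>
    have far: "dist (z p) (z p') \<ge> \<kappa> * r" if p: "p \<in> I" "p' \<in> I" "p \<noteq> p'" for p p'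
    proof -
      obtain x k j where pe: "p = (x, k, j)" by (cases p)
      obtain x' k' j' where pe': "p' = (x', k', j')" by (cases p')
      have xE: "x \<in> X" "x' \<in> X" using p by (auto simp: I_def pe pe')
      define \<xi> where "\<xi> = (1 + real k * r) *\<^sub>R x"
      define \<xi>' where "\<xi>' = (1 + real k' * r) *\<^sub>R x'"
      have pos: "1 + real k * r > 0" "1 + real k' * r > 0" using r by (auto intro: add_pos_nonneg)
      have in_kink: "\<xi> \<in> kink f b c e" "\<xi>' \<in> kink f b c e"
        using pos xE X E(1) by (auto simp: \<xi>_def \<xi>'_def intro!: cone)
      define d where "d = \<xi> - \<xi>'"
      define t where "t = d \<bullet> b"
      define h where "h = d - t *\<^sub>R b"
      define s where "s = t + (real j - real j') * r"
      have zz: "z p - z p' = h + s *\<^sub>R b"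
        by (simp add: z_def pe pe' h_def s_def d_def \<xi>_def \<xi>'_def algebra_simps)
      have hb: "h \<bullet> b = 0" using b by (simp add: h_def t_def inner_diff_left)
      have "(norm (z p - z p'))\<^sup>2 = (norm h)\<^sup>2 + s\<^sup>2"
        unfolding zz power2_norm_eq_inner using hb b
        by (simp add: inner_add_left inner_add_right inner_commute power2_eq_square)
      then have "(norm h)\<^sup>2 \<le> (norm (z p - z p'))\<^sup>2" by simp
      then have nh: "norm h \<le> norm (z p - z p')" by (rule power2_le_imp_le) simp
      have "e * \<bar>t\<bar> \<le> L * norm h"
        by (rule kink_cone_bound[OF lip in_kink(2,1)]) (simp add: h_def d_def)
      then have "\<bar>t\<bar> \<le> K * norm h" using e by (simp add: K_def field_simps)
      moreover have "norm d \<le> \<bar>t\<bar> + norm h"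
      proof -
        have "d = t *\<^sub>R b + h" by (simp add: h_def)
        then show ?thesis using norm_triangle_ineq[of "t *\<^sub>R b" h] nb by simp
      qed
      ultimately have dh: "norm d \<le> (1 + K) * norm h" by (simp add: algebra_simps)
      have main: ?thesis if "r \<le> (1 + G) * norm d"
      proof -
        have "r \<le> (1 + G) * ((1 + K) * norm h)" using that dh G by (meson add_nonneg_nonneg mult_left_mono order_trans zero_le_one)
        then have "r \<le> norm h * ((1 + G) * (1 + K))" by (simp add: mult_ac)
        moreover have "(1 + G) * (1 + K) > 0" using G K by (intro mult_pos_pos) auto
        ultimately have "\<kappa> * r \<le> norm h" by (simp add: \<kappa>_def pos_divide_le_eq)
        then show ?thesis using nh by (simp add: dist_norm)
      qed
      show ?thesis
      proof (cases "k = k'")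
        case False
        have g1: "g \<xi> = 1 + real k * r" "g \<xi>' = 1 + real k' * r"
          using ghom[OF pos(1), of x] ghom[OF pos(2), of x'] xE X E(2) by (auto simp: \<xi>_def \<xi>'_def)
        have "\<bar>real k - real k'\<bar> * r \<le> G * norm d"
          using glip[of \<xi> \<xi>'] r by (simp add: g1 d_def left_diff_distrib[symmetric] abs_mult)
        moreover have "\<bar>real k - real k'\<bar> \<ge> 1" using False by linarith
        then have "1 * r \<le> \<bar>real k - real k'\<bar> * r" using r by (intro mult_right_mono) auto
        ultimately have "r \<le> (1 + G) * norm d" by (simp add: distrib_right add_increasing)
        then show ?thesis by (rule main)
      next
        case kk: True
        show ?thesis
        proof (cases "x = x'")
          case False
          have "r \<le> norm (x - x')" using sep[OF xE False] by (simp add: dist_norm)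
          also have "\<dots> \<le> (1 + real k * r) * norm (x - x')" using r by (simp add: mult_le_cancel_right1)
          also have "\<dots> = norm d" using pos kk by (simp add: d_def \<xi>_def \<xi>'_def scaleR_diff_right[symmetric])
          also have "\<dots> \<le> (1 + G) * norm d" using G by (simp add: mult_le_cancel_right1)
          finally show ?thesis by (rule main)
        next
          case True
          then have "j \<noteq> j'" using p kk by (auto simp: pe pe')
          have "z p - z p' = ((real j - real j') * r) *\<^sub>R b" using True kk by (simp add: z_def pe pe' algebra_simps)
          then have "norm (z p - z p') = \<bar>real j - real j'\<bar> * r" using nb r by (simp add: abs_mult)
          moreover have "\<bar>real j - real j'\<bar> \<ge> 1" using \<open>j \<noteq> j'\<close> by linarith
          then have "1 * r \<le> \<bar>real j - real j'\<bar> * r" using r by (intro mult_right_mono) auto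
          moreover have "\<kappa> * r \<le> 1 * r" using \<kappa> r by (intro mult_right_mono) auto
          ultimately show ?thesis by (simp add: dist_norm)
        qed
      qed
    qed
    have inj: "inj_on z I"
    proof (rule inj_onI, rule ccontr)
      fix p p' assume "p \<in> I" "p' \<in> I" "z p = z p'" "p \<noteq> p'"
      with far[of p p'] \<kappa> r show False by (simp add: mult_le_0_iff)
    qed
    have finI: "finite I" using X by (simp add: I_def)
    have "real (card (z ` I)) * (\<kappa> * r / 2) ^ n \<le> ((2 * D' + 1) + \<kappa> * r / 2) ^ n"
      unfolding n_def
    proof (rule separated_card_bound)
      show "z ` I \<subseteq> cball 0 (2 * D' + 1)"
      proof
        fix w assume "w \<in> z ` I"
        then obtain x k j where w: "w = z (x, k, j)" "x \<in> X" "k < m" "j < m" by (auto simp: I_def)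
        have le1: "real i * r \<le> 1" if "i < m" for i
        proof -
          have "real i * r \<le> real m * r" using that r by (intro mult_right_mono) auto
          then show ?thesis using m by simp
        qed
        have "norm w \<le> \<bar>1 + real k * r\<bar> * norm x + \<bar>real j * r\<bar>"
          unfolding w z_def using norm_triangle_ineq[of "(1 + real k * r) *\<^sub>R x" "(real j * r) *\<^sub>R b"] nb by simp
        also have "\<dots> = (1 + real k * r) * norm x + real j * r" using r by simp
        also have "\<dots> \<le> 2 * D' + 1" using le1[OF w(3)] le1[OF w(4)] D' w(2) X r
          by (intro add_mono mult_mono) auto
        finally show "w \<in> cball 0 (2 * D' + 1)" by simp
      qed
      show "2 * (\<kappa> * r / 2) \<le> dist x y" if "x \<in> z ` I" "y \<in> z ` I" "x \<noteq> y" for x y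
      proof -
        obtain p p' where "p \<in> I" "p' \<in> I" "x = z p" "y = z p'" using \<open>x \<in> z ` I\<close> \<open>y \<in> z ` I\<close> by blast
        then show ?thesis using far[of p p'] \<open>x \<noteq> y\<close> by auto
      qed
      show "finite (z ` I)" using finI by (rule finite_imageI)
      show "\<kappa> * r / 2 > 0" using \<kappa>(1) r(1) by simp
      show "2 * D' + 1 \<ge> 0" using D'(1) by simp
    qed
    also have "card (z ` I) = card X * m\<^sup>2"
      using card_image[OF inj] by (simp add: I_def card_cartesian_product power2_eq_square)
    also have "((2 * D' + 1) + \<kappa> * r / 2) ^ n \<le> (2 * D' + 2) ^ n"
    proof (rule power_mono)
      have "\<kappa> * r \<le> 1 * 1" using \<kappa> r by (intro mult_mono) auto
      then show "2 * D' + 1 + \<kappa> * r / 2 \<le> 2 * D' + 2" by simp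
      show "0 \<le> 2 * D' + 1 + \<kappa> * r / 2" using D'(1) \<kappa>(1) r(1) by simp
    qed
    finally have A: "real (card X) * (real m)\<^sup>2 * (\<kappa> * r / 2) ^ n \<le> (2 * D' + 2) ^ n" by simp
    have "real (card X) * (real m)\<^sup>2 * r ^ n \<le> (2 * (2 * D' + 2) / \<kappa>) ^ n"
    proof -
      have "(\<kappa> * r / 2) ^ n = (\<kappa> / 2) ^ n * r ^ n" by (simp add: power_mult_distrib[symmetric])
      then have "(\<kappa> / 2) ^ n * (real (card X) * (real m)\<^sup>2 * r ^ n) \<le> (2 * D' + 2) ^ n" using A by (simp add: mult_ac)
      then have "real (card X) * (real m)\<^sup>2 * r ^ n \<le> (2 * D' + 2) ^ n / (\<kappa> / 2) ^ n"
        using \<kappa> by (simp add: pos_le_divide_eq mult.commute)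
      then show ?thesis by (simp add: power_divide[symmetric] mult.commute)
    qed
    then have B: "4 * (real (card X) * (real m)\<^sup>2 * r ^ n) \<le> C" by (simp add: C_def)
    \<comment> \<open>Here the \<open>m\<^sup>2\<close> points obtained from each point of
      \<open>X\<close> become the factor \<open>r\<^sup>2\<close> of codimension 2.\<close>
    have "1 \<le> (2 * (real m * r))\<^sup>2" by (intro one_le_power m(2))
    then have "1 * (real (card X) * r ^ n) \<le> (4 * (real m)\<^sup>2 * r\<^sup>2) * (real (card X) * r ^ n)"
      using r by (intro mult_right_mono) (simp_all add: power_mult_distrib)
    also have "\<dots> = (4 * (real (card X) * (real m)\<^sup>2 * r ^ n)) * r\<^sup>2" by (simp add: mult_ac)
    also have "\<dots> \<le> C * r\<^sup>2" using B by (intro mult_right_mono) auto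
    finally show ?thesis by simp
  qed
  show ?thesis unfolding minkowski_codim2_def
  proof (intro exI[of _ C] allI impI)
    fix r :: real assume r: "0 < r \<and> r \<le> 1"
    obtain X where X: "finite X" "X \<subseteq> E" "E \<subseteq> (\<Union>x\<in>X. cball x r)"
      "\<And>x y. x \<in> X \<Longrightarrow> y \<in> X \<Longrightarrow> x \<noteq> y \<Longrightarrow> dist x y \<ge> r"
    proof (rule maximal_separated_cover[of r E "C * r\<^sup>2 / r ^ n"])
      show "real (card X) \<le> C * r\<^sup>2 / r ^ n" if "finite X" "X \<subseteq> E"
        "\<And>x y. x \<in> X \<Longrightarrow> y \<in> X \<Longrightarrow> x \<noteq> y \<Longrightarrow> dist x y \<ge> r" for X
        using bound[of r X] that r by (simp add: pos_le_divide_eq)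
      show "0 \<le> r" using r by simp
    qed (rule that)
    have "real (card X) * r ^ n \<le> C * r\<^sup>2" using r X(1,2,4) by (intro bound) auto
    then show "\<exists>X. finite X \<and> E \<subseteq> (\<Union>x\<in>X. cball x r) \<and> real (card X) * r ^ DIM('a) \<le> C * r\<^sup>2"
      using X(1,3) unfolding n_def by blast
  qed
qed

section \<open>Outer normals and subdifferentials at the boundary\<close>

text \<open>Since \<open>f\<close> is differentiable at the base point, membership of
  \<open>x + s *\<^sub>R h\<close> for small \<open>s > 0\<close> is decided by the sign of
  \<open>h \<bullet> (e - g)\<close>. This gives inward directions at once. A point of
  \<open>U\<close> beyond the tangent hyperplane would by convexity bring points
  \<open>x + s *\<^sub>R h\<close> with the wrong sign into \<open>U\<close>.\<close>

lemma
  assumes n: "outer_unit_normal U x n" and op: "open U" and conv: "convex U"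
  shows norm_outer_unit_normal: "norm n = 1"
    and outer_unit_normal_le: "z \<in> U \<Longrightarrow> (z - x) \<bullet> n \<le> 0"
    and outer_unit_normal_inward: "h \<bullet> n < 0 \<Longrightarrow> \<exists>\<sigma>>0. \<forall>s. 0 < s \<and> s < \<sigma> \<longrightarrow> x + s *\<^sub>R h \<in> U"
proof -
  obtain e f g r where e: "norm e = 1" and r: "0 < r"
    and chart: "\<And>z. z \<in> ball x r \<Longrightarrow> z \<in> U \<longleftrightarrow> z \<bullet> e < f (z - (z \<bullet> e) *\<^sub>R e)"
    and ge: "g \<bullet> e = 0"
    and der: "(f has_derivative (\<lambda>h. g \<bullet> h)) (at (x - (x \<bullet> e) *\<^sub>R e) within {p. p \<bullet> e = 0})"
    and neq: "n = (e - g) /\<^sub>R norm (e - g)" and xf: "x \<in> frontier U"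
    using n unfolding outer_unit_normal_def by blast
  have ee: "e \<bullet> e = 1" using e by (simp add: dot_square_norm)
  define pr where "pr z = z - (z \<bullet> e) *\<^sub>R e" for z
  define p0 where "p0 = pr x"
  have pr_e: "pr z \<bullet> e = 0" for z by (simp add: pr_def inner_diff_left ee)
  have pr_lin: "pr (x + s *\<^sub>R h) = p0 + s *\<^sub>R pr h" for s h by (simp add: pr_def p0_def algebra_simps)
  have pr_le: "norm (pr h) \<le> norm h" for h unfolding pr_def by (rule norm_orthogonal_part_le[OF e])
  have derE: "\<exists>d>0. \<forall>k. k \<bullet> e = 0 \<and> norm k < d \<longrightarrow> \<bar>f (p0 + k) - f p0 - g \<bullet> k\<bar> \<le> \<eta> * norm k" if \<eta>: "\<eta> > 0" for \<eta>
  proof -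
    obtain d where d: "d > 0" "\<And>y. y \<in> {p. p \<bullet> e = 0} \<Longrightarrow> norm (y - p0) < d \<Longrightarrow>
        norm (f y - f p0 - g \<bullet> (y - p0)) \<le> \<eta> * norm (y - p0)"
      using der \<eta> unfolding has_derivative_within_alt p0_def pr_def by blast
    show ?thesis
    proof (intro exI[of _ d] conjI allI impI d(1))
      fix k assume "k \<bullet> e = 0 \<and> norm k < d"
      then show "\<bar>f (p0 + k) - f p0 - g \<bullet> k\<bar> \<le> \<eta> * norm k"
        using d(2)[of "p0 + k"] pr_e[of x] by (auto simp: p0_def inner_add_left)
    qed
  qed
  have xnot: "x \<notin> U" and xcl: "x \<in> closure U" using xf op by (auto simp: frontier_def interior_open)
  \<comment> \<open>The boundary point lies on the graph. \<open>f\<close> is controlled only near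
    \<open>p0\<close>, through its derivative there. If \<open>x\<close> were strictly above the
    graph, points of \<open>U\<close> close to \<open>x\<close> would be above it too; the radius
    \<open>\<rho>\<close> absorbs the change of height and of \<open>f\<close>, at most
    \<open>(2 + norm g) * norm h\<close> together.\<close>
  have fp0: "f p0 = x \<bullet> e"
  proof (rule antisym)
    show "f p0 \<le> x \<bullet> e" using chart[of x] r xnot by (auto simp: p0_def pr_def)
    show "x \<bullet> e \<le> f p0"
    proof (rule ccontr)
      assume neg: "\<not> ?thesis"
      define \<delta> where "\<delta> = x \<bullet> e - f p0"
      have \<delta>: "\<delta> > 0" using neg by (simp add: \<delta>_def)
      obtain d where d: "d > 0" "\<And>k. k \<bullet> e = 0 \<Longrightarrow> norm k < d \<Longrightarrow> \<bar>f (p0 + k) - f p0 - g \<bullet> k\<bar> \<le> 1 * norm k"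
        using derE[of 1] by auto
      define \<rho> where "\<rho> = min (min r d) (\<delta> / (2 + norm g))"
      have g2: "2 + norm g > 0" by (simp add: add_pos_nonneg)
      then have \<rho>: "\<rho> > 0" "\<rho> \<le> r" "\<rho> \<le> d" using \<delta> d r by (auto simp: \<rho>_def)
      have "\<rho> \<le> \<delta> / (2 + norm g)" by (simp add: \<rho>_def)
      then have \<rho>4: "\<rho> * (2 + norm g) \<le> \<delta>" using g2 by (simp add: pos_le_divide_eq)
      obtain z where z: "z \<in> U" "dist z x < \<rho>" using xcl \<rho>(1) unfolding closure_approachable by blast
      define h where "h = z - x"
      have nh: "norm h < \<rho>" using z by (simp add: h_def dist_norm)
      have zh: "z = x + 1 *\<^sub>R h" by (simp add: h_def)
      have "z \<bullet> e < f (pr z)" using chart[of z] z \<rho> by (auto simp: pr_def dist_commute)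
      then have 1: "x \<bullet> e + h \<bullet> e < f (p0 + pr h)" using pr_lin[of 1 h] by (simp add: zh inner_add_left)
      have 2: "\<bar>f (p0 + pr h) - f p0 - g \<bullet> pr h\<bar> \<le> 1 * norm (pr h)"
        using nh \<rho> pr_le[of h] by (intro d(2) pr_e) auto
      have 3: "\<bar>h \<bullet> e\<bar> \<le> norm h" using Cauchy_Schwarz_ineq2[of h e] e by simp
      have 4: "\<bar>g \<bullet> pr h\<bar> \<le> norm g * norm h"
        using Cauchy_Schwarz_ineq2[of g "pr h"] pr_le[of h] by (meson mult_left_mono norm_ge_zero order_trans)
      have "\<delta> < norm h * (2 + norm g)" using 1 2 3 4 pr_le[of h] by (simp add: \<delta>_def algebra_simps)
      also have "\<dots> \<le> \<rho> * (2 + norm g)" using nh by (intro mult_right_mono) (auto intro: add_nonneg_nonneg)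
      finally show False using \<rho>4 by simp
    qed
  qed
  define v where "v = e - g"
  have ve: "v \<bullet> e = 1" by (simp add: v_def inner_diff_left ee ge)
  then have v0: "v \<noteq> 0" by auto
  then show "norm n = 1" by (simp add: neq v_def[symmetric])
  have hn: "h \<bullet> n = (h \<bullet> v) / norm v" for h by (simp add: neq v_def[symmetric] divide_inverse mult.commute)
  have gk: "g \<bullet> pr h = g \<bullet> h" for h by (simp add: pr_def inner_diff_right ge)
  have local: "\<exists>\<sigma>>0. \<forall>s. 0 < s \<and> s < \<sigma> \<longrightarrow>
      (x + s *\<^sub>R h \<in> U \<longleftrightarrow> (x + s *\<^sub>R h) \<bullet> e < f (p0 + s *\<^sub>R pr h)) \<and>
      \<bar>f (p0 + s *\<^sub>R pr h) - x \<bullet> e - s * (g \<bullet> h)\<bar> \<le> s * \<eta>" if \<eta>: "\<eta> > 0" for h \<eta>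
  proof -
    define \<eta>' where "\<eta>' = \<eta> / (norm h + 1)"
    have \<eta>': "\<eta>' > 0" "\<eta>' * norm h \<le> \<eta>" using \<eta> by (auto simp: \<eta>'_def field_simps add_pos_nonneg)
    obtain d where d: "d > 0" "\<And>k. k \<bullet> e = 0 \<Longrightarrow> norm k < d \<Longrightarrow> \<bar>f (p0 + k) - f p0 - g \<bullet> k\<bar> \<le> \<eta>' * norm k"
      using derE[OF \<eta>'(1)] by auto
    define \<sigma> where "\<sigma> = min r d / (norm h + 1)"
    have \<sigma>: "\<sigma> > 0" using r d by (simp add: \<sigma>_def add_pos_nonneg add_nonneg_pos)
    show ?thesis
    proof (intro exI[of _ \<sigma>] conjI allI impI \<sigma>)
      fix s assume s: "0 < s \<and> s < \<sigma>"
      have "s * norm h \<le> s * (norm h + 1)" using s by simp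
      also have "\<dots> < min r d" using s by (simp add: \<sigma>_def pos_less_divide_eq add_nonneg_pos)
      finally have sh: "s * norm h < r" "s * norm h < d" by auto
      show "(x + s *\<^sub>R h \<in> U \<longleftrightarrow> (x + s *\<^sub>R h) \<bullet> e < f (p0 + s *\<^sub>R pr h))"
        using chart[of "x + s *\<^sub>R h"] sh s pr_lin[of s h] by (simp add: pr_def dist_norm)
      have "s * norm (pr h) \<le> s * norm h" using pr_le[of h] s by (intro mult_left_mono) auto
      then have "\<bar>f (p0 + s *\<^sub>R pr h) - f p0 - g \<bullet> (s *\<^sub>R pr h)\<bar> \<le> \<eta>' * norm (s *\<^sub>R pr h)"
        using le_less_trans[OF \<open>s * norm (pr h) \<le> _\<close> sh(2)] s pr_e[of h] by (intro d(2)) simp_all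
      also have "\<dots> \<le> \<eta>' * (s * norm h)" using \<open>s * norm (pr h) \<le> _\<close> s \<eta>' by (intro mult_left_mono) auto
      also have "\<dots> = s * (\<eta>' * norm h)" by simp
      also have "\<dots> \<le> s * \<eta>" using s \<eta>' by (intro mult_left_mono) auto
      finally show "\<bar>f (p0 + s *\<^sub>R pr h) - x \<bullet> e - s * (g \<bullet> h)\<bar> \<le> s * \<eta>" by (simp add: fp0 gk)
    qed
  qed
  show "\<exists>\<sigma>>0. \<forall>s. 0 < s \<and> s < \<sigma> \<longrightarrow> x + s *\<^sub>R h \<in> U" if "h \<bullet> n < 0" for h
  proof -
    have hv: "h \<bullet> v < 0" using that v0 by (simp add: hn divide_less_0_iff)
    then have "- (h \<bullet> v) / 2 > 0" by simp
    from local[OF this, of h] obtain \<sigma> where \<sigma>: "\<sigma> > 0" "\<And>s. 0 < s \<Longrightarrow> s < \<sigma> \<Longrightarrow>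
      (x + s *\<^sub>R h \<in> U \<longleftrightarrow> (x + s *\<^sub>R h) \<bullet> e < f (p0 + s *\<^sub>R pr h)) \<and>
      \<bar>f (p0 + s *\<^sub>R pr h) - x \<bullet> e - s * (g \<bullet> h)\<bar> \<le> s * (- (h \<bullet> v) / 2)"
      by metis
    have "x + s *\<^sub>R h \<in> U" if s: "0 < s" "s < \<sigma>" for s
    proof -
      have "s * (h \<bullet> v) = s * (h \<bullet> e) - s * (g \<bullet> h)" by (simp add: v_def inner_diff_right right_diff_distrib inner_commute)
      moreover have "s * (h \<bullet> v) < 0" using s hv by (simp add: mult_less_0_iff)
      moreover have "s * (- (h \<bullet> v) / 2) = - (s * (h \<bullet> v)) / 2" by simp
      ultimately have "x \<bullet> e + s * (h \<bullet> e) < f (p0 + s *\<^sub>R pr h)"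
        using conjunct2[OF \<sigma>(2)[OF s]] by linarith
      then show ?thesis using \<sigma>(2)[OF s] by (simp add: inner_add_left)
    qed
    then show ?thesis using \<sigma>(1) by blast
  qed
  show "(z - x) \<bullet> n \<le> 0" if z: "z \<in> U" for z
  proof (rule ccontr)
    assume pos: "\<not> ?thesis"
    define h where "h = z - x"
    have hv: "h \<bullet> v > 0" using pos v0 by (simp add: hn h_def zero_less_divide_iff not_le)
    then have "(h \<bullet> v) / 2 > 0" by simp
    from local[OF this, of h] obtain \<sigma> where \<sigma>: "\<sigma> > 0" "\<And>s. 0 < s \<Longrightarrow> s < \<sigma> \<Longrightarrow>
      (x + s *\<^sub>R h \<in> U \<longleftrightarrow> (x + s *\<^sub>R h) \<bullet> e < f (p0 + s *\<^sub>R pr h)) \<and>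
      \<bar>f (p0 + s *\<^sub>R pr h) - x \<bullet> e - s * (g \<bullet> h)\<bar> \<le> s * ((h \<bullet> v) / 2)"
      by metis
    define s where "s = min 1 (\<sigma> / 2)"
    have s: "0 < s" "s < \<sigma>" "s \<le> 1" using \<sigma>(1) by (auto simp: s_def)
    have "x - s *\<^sub>R (x - z) \<in> interior U"
      using z op s xcl by (intro mem_interior_closure_convex_shrink[OF conv]) (auto simp: interior_open)
    then have "x + s *\<^sub>R h \<in> U" using op by (simp add: h_def interior_open algebra_simps)
    then have "(x + s *\<^sub>R h) \<bullet> e < f (p0 + s *\<^sub>R pr h)" using \<sigma>(2)[OF s(1,2)] by simp
    moreover have "s * (h \<bullet> v) = s * (h \<bullet> e) - s * (g \<bullet> h)" by (simp add: v_def inner_diff_right right_diff_distrib inner_commute)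
    moreover have "s * (h \<bullet> v) > 0" using s hv by simp
    moreover have "s * (h \<bullet> v / 2) = s * (h \<bullet> v) / 2" by simp
    moreover have "(x + s *\<^sub>R h) \<bullet> e = x \<bullet> e + s * (h \<bullet> e)" by (simp add: inner_add_left)
    ultimately show False using conjunct2[OF \<sigma>(2)[OF s(1,2)]] by linarith
  qed
qed

text \<open>For two different unit normals the direction \<open>n' - n\<close> points strictly
  inward with respect to \<open>n\<close> and strictly outward with respect to
  \<open>n'\<close>.\<close>

lemma outer_unit_normal_unique:
  assumes n: "outer_unit_normal U x n" and n': "outer_unit_normal U x n'" and op: "open U" and conv: "convex U"
  shows "n' = n"
proof (rule ccontr)
  assume ne: "n' \<noteq> n"
  have nn: "n \<bullet> n = 1" "n' \<bullet> n' = 1"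
    using norm_outer_unit_normal[OF n op conv] norm_outer_unit_normal[OF n' op conv] by (simp_all add: dot_square_norm)
  have "0 < (n' - n) \<bullet> (n' - n)" using ne by simp
  then have lt: "n \<bullet> n' < 1" using nn by (simp add: inner_diff_left inner_diff_right inner_commute)
  have "(n' - n) \<bullet> n < 0" using lt nn by (simp add: inner_diff_left inner_commute[of n' n])
  then obtain \<sigma> where \<sigma>: "\<sigma> > 0" "\<And>s. 0 < s \<Longrightarrow> s < \<sigma> \<Longrightarrow> x + s *\<^sub>R (n' - n) \<in> U"
    using outer_unit_normal_inward[OF n op conv] by blast
  have "(x + (\<sigma> / 2) *\<^sub>R (n' - n) - x) \<bullet> n' \<le> 0"
    using \<sigma> by (intro outer_unit_normal_le[OF n' op conv]) auto
  then have "(n' - n) \<bullet> n' \<le> 0" using \<sigma>(1) by (simp add: mult_le_0_iff)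
  then show False using lt nn by (simp add: inner_diff_left)
qed

text \<open>Tilting the tangent vector \<open>h\<close> inward by \<open>\<eta>\<close> leads into
  \<open>U\<close>, and tilting it outward leads out of \<open>U\<close>, so the short segment
  between the two points meets the frontier.\<close>

lemma frontier_tangent_approx:
  assumes n: "outer_unit_normal U x n" and op: "open U" and conv: "convex U"
    and h: "h \<bullet> n = 0" and \<eta>: "\<eta> > 0"
  shows "\<exists>\<sigma>>0. \<forall>s. 0 < s \<and> s < \<sigma> \<longrightarrow> (\<exists>z\<in>frontier U. norm (z - x - s *\<^sub>R h) \<le> s * \<eta>)"
proof -
  have nn: "norm n = 1" "n \<bullet> n = 1" using norm_outer_unit_normal[OF n op conv] by (simp_all add: dot_square_norm)
  have "(h - \<eta> *\<^sub>R n) \<bullet> n < 0" using h nn \<eta> by (simp add: inner_diff_left)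
  then obtain \<sigma> where \<sigma>: "\<sigma> > 0" "\<And>s. 0 < s \<Longrightarrow> s < \<sigma> \<Longrightarrow> x + s *\<^sub>R (h - \<eta> *\<^sub>R n) \<in> U"
    using outer_unit_normal_inward[OF n op conv] by blast
  have "\<exists>z\<in>frontier U. norm (z - x - s *\<^sub>R h) \<le> s * \<eta>" if s: "0 < s" "s < \<sigma>" for s
  proof -
    let ?a = "x + s *\<^sub>R (h - \<eta> *\<^sub>R n)" and ?b = "x + s *\<^sub>R (h + \<eta> *\<^sub>R n)"
    have "?b \<notin> U"
    proof
      assume "?b \<in> U"
      from outer_unit_normal_le[OF n op conv this] have "s * \<eta> \<le> 0" using h nn by (simp add: inner_add_left)
      then show False using s \<eta> by (simp add: mult_le_0_iff)
    qed
    then have "closed_segment ?a ?b \<inter> frontier U \<noteq> {}"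
      using \<sigma>(2)[OF s] by (intro connected_Int_frontier connected_segment) auto
    then obtain z where z: "z \<in> closed_segment ?a ?b" "z \<in> frontier U" by blast
    have "z \<in> cball (x + s *\<^sub>R h) (s * \<eta>)"
    proof -
      have "?a \<in> cball (x + s *\<^sub>R h) (s * \<eta>)" "?b \<in> cball (x + s *\<^sub>R h) (s * \<eta>)"
        using s \<eta> nn by (auto simp: dist_norm algebra_simps)
      then show ?thesis using z(1) closed_segment_subset[OF _ _ convex_cball] by blast
    qed
    then show ?thesis using z(2) by (intro bexI[of _ z]) (auto simp: dist_norm norm_minus_commute algebra_simps)
  qed
  then show ?thesis using \<sigma>(1) by blast
qed

text \<open>The derivative along the frontier fixes the tangential part of every subgradient: at
  frontier points close to \<open>x + s *\<^sub>R h\<close> the subgradient inequality gives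
  \<open>q \<bullet> h \<le> D h\<close>, and replacing \<open>h\<close> by \<open>- h\<close> gives
  equality.\<close>

lemma subdiff_diff_parallel_normal:
  fixes w :: "'a::euclidean_space \<Rightarrow> real"
  assumes n: "outer_unit_normal U x n" and op: "open U" and conv: "convex U"
    and diff: "w differentiable (at x within frontier U)"
    and q1: "q1 \<in> subdiff w x" and q2: "q2 \<in> subdiff w x"
  shows "q1 = q2 + ((q1 - q2) \<bullet> n) *\<^sub>R n"
proof -
  have nn: "n \<bullet> n = 1" using norm_outer_unit_normal[OF n op conv] by (simp_all add: dot_square_norm)
  obtain D where D: "(w has_derivative D) (at x within frontier U)" using diff by (auto simp: differentiable_def)
  then have bl: "bounded_linear D" by (rule has_derivative_bounded_linear)
  then obtain B where B: "B > 0" "\<And>h. norm (D h) \<le> norm h * B" using bounded_linear.pos_bounded by blast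
  have Dlin: "linear D" using bl by (rule bounded_linear.linear)
  have le: "q \<bullet> h \<le> D h" if q: "q \<in> subdiff w x" and h: "h \<bullet> n = 0" for q h
  proof (rule field_le_epsilon)
    fix \<epsilon> :: real assume \<epsilon>: "\<epsilon> > 0"
    \<comment> \<open>Collects the errors of size \<open>s * \<eta>\<close>: \<open>norm q\<close>
      and \<open>B\<close> from the offset \<open>k\<close> of the frontier point,
      \<open>norm h + 1\<close> from the remainder of the derivative.\<close>
    define Q where "Q = norm q + B + norm h + 1"
    have Q: "Q > 0" using B by (simp add: Q_def add_nonneg_pos add_pos_nonneg)
    define \<eta> where "\<eta> = min 1 (\<epsilon> / Q)"
    have "\<eta> \<le> \<epsilon> / Q" by (simp add: \<eta>_def)
    then have \<eta>3: "\<eta> * Q \<le> \<epsilon>" using Q by (simp add: pos_le_divide_eq)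
    have \<eta>: "\<eta> > 0" "\<eta> \<le> 1" using \<epsilon> Q by (simp_all add: \<eta>_def)
    obtain \<sigma> where \<sigma>: "\<sigma> > 0" "\<And>s. 0 < s \<Longrightarrow> s < \<sigma> \<Longrightarrow> \<exists>z\<in>frontier U. norm (z - x - s *\<^sub>R h) \<le> s * \<eta>"
      using frontier_tangent_approx[OF n op conv h \<eta>(1)] by blast
    obtain d where d: "d > 0" "\<And>y. y \<in> frontier U \<Longrightarrow> norm (y - x) < d \<Longrightarrow> norm (w y - w x - D (y - x)) \<le> \<eta> * norm (y - x)"
      using D \<eta>(1) unfolding has_derivative_within_alt by blast
    define s where "s = min (\<sigma> / 2) (d / (2 * (norm h + 1)))"
    have h1: "norm h + 1 > 0" by (simp add: add_nonneg_pos)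
    have s: "0 < s" "s < \<sigma>" using \<sigma>(1) d(1) h1 by (auto simp: s_def)
    have "s * (norm h + 1) \<le> d / (2 * (norm h + 1)) * (norm h + 1)" using h1 by (intro mult_right_mono) (auto simp: s_def)
    also have "\<dots> = d / 2" using h1 by (simp add: divide_simps)
    finally have sd: "s * (norm h + 1) < d" using d(1) by simp
    obtain z where z: "z \<in> frontier U" "norm (z - x - s *\<^sub>R h) \<le> s * \<eta>" using \<sigma>(2)[OF s] by blast
    define k where "k = z - x - s *\<^sub>R h"
    have zx: "z - x = s *\<^sub>R h + k" by (simp add: k_def)
    have "norm (z - x) \<le> s * norm h + norm k" unfolding zx using norm_triangle_ineq[of "s *\<^sub>R h" k] s by simp
    also have "norm k \<le> s * 1" using order_trans[OF z(2) mult_left_mono[OF \<eta>(2) less_imp_le[OF s(1)]]] by (simp add: k_def)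
    finally have nz: "norm (z - x) \<le> s * (norm h + 1)" by (simp add: distrib_left)
    have 1: "w z \<ge> w x + q \<bullet> (z - x)" using q by (auto simp: subdiff_def)
    have 2: "\<bar>w z - w x - D (z - x)\<bar> \<le> \<eta> * norm (z - x)" using d(2)[OF z(1)] nz sd by auto
    have 3: "\<eta> * norm (z - x) \<le> \<eta> * (s * (norm h + 1))" using nz \<eta> by (intro mult_left_mono) auto
    have 4: "q \<bullet> (z - x) \<ge> s * (q \<bullet> h) - norm q * (s * \<eta>)"
    proof -
      have "\<bar>q \<bullet> k\<bar> \<le> norm q * norm k" by (rule Cauchy_Schwarz_ineq2)
      also have "\<dots> \<le> norm q * (s * \<eta>)" using z(2) by (intro mult_left_mono) (auto simp: k_def)
      finally show ?thesis unfolding zx by (simp add: inner_add_right)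
    qed
    have 5: "D (z - x) \<le> s * D h + s * \<eta> * B"
    proof -
      have "norm (D k) \<le> norm k * B" by (rule B)
      also have "\<dots> \<le> s * \<eta> * B" using z(2) B(1) by (intro mult_right_mono) (auto simp: k_def)
      finally show ?thesis unfolding zx by (simp add: linear_add[OF Dlin] linear_scale[OF Dlin])
    qed
    have "s * (q \<bullet> h) \<le> s * D h + s * \<eta> * B + \<eta> * (s * (norm h + 1)) + norm q * (s * \<eta>)"
      using 1 2 3 4 5 by linarith
    also have "\<dots> = s * (D h + \<eta> * Q)" by (simp add: Q_def algebra_simps)
    finally have "q \<bullet> h \<le> D h + \<eta> * Q" using s by simp
    then show "q \<bullet> h \<le> D h + \<epsilon>" using \<eta>3 by simp
  qed
  have eq: "q \<bullet> h = D h" if q: "q \<in> subdiff w x" and h: "h \<bullet> n = 0" for q h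
    using le[OF q h] le[OF q, of "- h"] h by (simp add: linear_neg[OF Dlin])
  define d where "d = (q1 - q2) - ((q1 - q2) \<bullet> n) *\<^sub>R n"
  have dn: "d \<bullet> n = 0" by (simp add: d_def inner_diff_left nn)
  have "(q1 - q2) \<bullet> d = 0" using eq[OF q1 dn] eq[OF q2 dn] by (simp add: inner_diff_left)
  moreover have "d \<bullet> d = (q1 - q2) \<bullet> d - ((q1 - q2) \<bullet> n) * (n \<bullet> d)"
    by (subst (1) d_def) (simp only: inner_diff_left inner_scaleR_left)
  ultimately have "d \<bullet> d = 0" using dn by (simp add: inner_commute)
  then have "d = 0" by simp
  then show ?thesis by (simp add: d_def)
qed

lemma
  fixes w :: "'a::euclidean_space \<Rightarrow> real"
  assumes w: "convex_on UNIV w"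
  shows subdiff_nonempty: "subdiff w x \<noteq> {}"
    and convex_subdiff: "convex (subdiff w x)"
    and compact_subdiff: "compact (subdiff w x)"
proof -
  show "subdiff w x \<noteq> {}" using convex_on_subgradient[OF w, of x] by (auto simp: subdiff_def)
  have eq: "subdiff w x = (\<Inter>z. {y. (z - x) \<bullet> y \<le> w z - w x})"
    by (auto simp: subdiff_def inner_commute algebra_simps)
  show "convex (subdiff w x)" unfolding eq by (intro convex_INT convex_halfspace_le)
  have "closed (subdiff w x)" unfolding eq by (intro closed_INT ballI closed_halfspace_le)
  moreover have "bounded (subdiff w x)"
  proof -
    obtain M where M: "\<And>z. z \<in> cball x 1 \<Longrightarrow> \<bar>w z\<bar> \<le> M"
      using convex_on_bounded_on_cball[OF w open_UNIV subset_UNIV] by blast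
    have "norm y \<le> 2 * M" if y: "y \<in> subdiff w x" for y
    proof (cases "y = 0")
      case True then show ?thesis using M[of x] by auto
    next
      case False
      have "w (x + y /\<^sub>R norm y) \<ge> w x + y \<bullet> (x + y /\<^sub>R norm y - x)" using y unfolding subdiff_def by blast
      moreover have "y \<bullet> (x + y /\<^sub>R norm y - x) = norm y" using False by (simp add: dot_square_norm power2_eq_square)
      moreover have "\<bar>w (x + y /\<^sub>R norm y)\<bar> \<le> M" using False by (intro M) (auto simp: dist_norm)
      moreover have "\<bar>w x\<bar> \<le> M" by (intro M) auto
      ultimately show ?thesis by simp
    qed
    then show ?thesis unfolding bounded_iff by blast
  qed
  ultimately show "compact (subdiff w x)" by (simp add: compact_eq_bounded_closed)
qed

text \<open>Gives the boundary inequality all it has to know about \<open>D_plus\<close>. At points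
  of \<open>dom_D_frontier\<close> the subdifferential is a segment parallel to \<open>n\<close>,
  and \<open>D_plus\<close> is its maximizer of \<open>q \<bullet> n\<close>; at the other points it
  is a singleton and \<open>\<mu> = 0\<close>.\<close>

lemma D_plus_extremal:
  fixes w :: "'a::euclidean_space \<Rightarrow> real"
  assumes w: "convex_on UNIV w" and n: "outer_unit_normal U x n" and op: "open U" and conv: "convex U"
    and x: "x \<in> dom_D_minus U w"
  shows "D_plus U w x \<in> subdiff w x"
    and "q \<in> subdiff w x \<Longrightarrow> \<exists>\<mu>\<ge>0. q = D_plus U w x - \<mu> *\<^sub>R n"
proof -
  have "D_plus U w x \<in> subdiff w x \<and> (\<forall>q\<in>subdiff w x. \<exists>\<mu>\<ge>0. q = D_plus U w x - \<mu> *\<^sub>R n)"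
  proof (cases "x \<in> dom_D_frontier U w")
    case False
    then have "is_singleton (subdiff w x)" using x by (auto simp: dom_D_minus_def dom_D_def)
    then obtain p where p: "subdiff w x = {p}" by (auto simp: is_singleton_def)
    then have "D_plus U w x = p" using False by (simp add: D_plus_def)
    then show ?thesis using p by (auto intro!: exI[of _ 0])
  next
    case True
    then have diff: "w differentiable (at x within frontier U)" by (simp add: dom_D_frontier_def)
    have nn: "n \<bullet> n = 1" using norm_outer_unit_normal[OF n op conv] by (simp_all add: dot_square_norm)
    have cont: "continuous_on (subdiff w x) (\<lambda>q. q \<bullet> n)" by (intro continuous_intros)
    obtain p where p: "p \<in> subdiff w x" "\<And>q. q \<in> subdiff w x \<Longrightarrow> q \<bullet> n \<le> p \<bullet> n"
      using continuous_attains_sup[OF compact_subdiff[OF w] subdiff_nonempty[OF w] cont] by blast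
    obtain y where y: "y \<in> subdiff w x" "\<And>q. q \<in> subdiff w x \<Longrightarrow> y \<bullet> n \<le> q \<bullet> n"
      using continuous_attains_inf[OF compact_subdiff[OF w] subdiff_nonempty[OF w] cont] by blast
    note par = subdiff_diff_parallel_normal[OF n op conv diff]
    define l where "l = (p - y) \<bullet> n"
    have l: "l \<ge> 0" using p(2)[OF y(1)] by (simp add: l_def inner_diff_left)
    have py: "p = y + l *\<^sub>R n" using par[OF p(1) y(1)] by (simp add: l_def)
    have seg: "subdiff w x = closed_segment y (y + l *\<^sub>R n)"
    proof
      show "closed_segment y (y + l *\<^sub>R n) \<subseteq> subdiff w x"
        using p(1) y(1) by (intro closed_segment_subset convex_subdiff[OF w]) (auto simp: py)
      show "subdiff w x \<subseteq> closed_segment y (y + l *\<^sub>R n)"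
      proof
        fix q assume q: "q \<in> subdiff w x"
        define t where "t = (q - y) \<bullet> n"
        have qt: "q = y + t *\<^sub>R n" using par[OF q y(1)] by (simp add: t_def)
        have t: "0 \<le> t" "t \<le> l" using p(2)[OF q] y(2)[OF q] by (auto simp: t_def l_def inner_diff_left)
        show "q \<in> closed_segment y (y + l *\<^sub>R n)"
        proof (cases "l = 0")
          case True then show ?thesis using t qt by auto
        next
          case False
          then show ?thesis unfolding in_segment using t qt l
            by (intro exI[of _ "t / l"]) (auto simp: algebra_simps)
        qed
      qed
    qed
    have "D_plus U w x = p" unfolding D_plus_def if_P[OF True]
    proof (rule the_equality)
      show "\<exists>y n l. outer_unit_normal U x n \<and> 0 \<le> l \<and> subdiff w x = closed_segment y (y + l *\<^sub>R n) \<and> p = y + l *\<^sub>R n"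
        using n l seg py by blast
      \<comment> \<open>Uniqueness of the described endpoint: the normal is unique, \<open>p\<close>
        lies on the segment that ends at \<open>p'\<close>, and \<open>p'\<close> cannot exceed the
        maximum of \<open>q \<bullet> n\<close> attained at \<open>p\<close>.\<close>
      fix p' assume "\<exists>y n l. outer_unit_normal U x n \<and> 0 \<le> l \<and> subdiff w x = closed_segment y (y + l *\<^sub>R n) \<and> p' = y + l *\<^sub>R n"
      then obtain y' n' l' where *: "outer_unit_normal U x n'" "0 \<le> l'" "subdiff w x = closed_segment y' (y' + l' *\<^sub>R n')" "p' = y' + l' *\<^sub>R n'"
        by blast
      have n': "n' = n" by (rule outer_unit_normal_unique[OF n *(1) op conv])
      have p': "p' \<in> subdiff w x" using * by auto
      have "p \<in> closed_segment y' (y' + l' *\<^sub>R n)" using p(1) * n' by simp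
      then obtain u where u: "0 \<le> u" "u \<le> 1" "p = (1 - u) *\<^sub>R y' + u *\<^sub>R (y' + l' *\<^sub>R n)" by (auto simp: in_segment)
      have pe: "p = y' + (u * l') *\<^sub>R n" using u(3) by (simp add: algebra_simps)
      have "u * l' \<le> 1 * l'" using u *(2) by (intro mult_right_mono) auto
      moreover have "l' \<le> u * l'" using p(2)[OF p'] by (simp add: pe *(4) n' inner_add_left nn)
      ultimately show "p' = p" using pe *(4) n' by simp
    qed
    moreover have "\<exists>\<mu>\<ge>0. q = p - \<mu> *\<^sub>R n" if q: "q \<in> subdiff w x" for q
      using par[OF q p(1)] p(2)[OF q] by (intro exI[of _ "(p - q) \<bullet> n"]) (auto simp: inner_diff_left algebra_simps)
    ultimately show ?thesis using p(1) by simp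
  qed
  then show "D_plus U w x \<in> subdiff w x" "q \<in> subdiff w x \<Longrightarrow> \<exists>\<mu>\<ge>0. q = D_plus U w x - \<mu> *\<^sub>R n" by auto
qed

section \<open>The gauge of a convex set\<close>

lemma sublinear_convex_on:
  fixes f :: "'a::real_vector \<Rightarrow> real"
  assumes add: "\<And>x y. f (x + y) \<le> f x + f y" and hom: "\<And>k x. k > 0 \<Longrightarrow> f (k *\<^sub>R x) = k * f x"
  shows "convex_on UNIV f"
proof (rule convex_onI)
  fix t :: real and x y :: 'a assume t: "0 < t" "t < 1"
  have "f ((1 - t) *\<^sub>R x + t *\<^sub>R y) \<le> f ((1 - t) *\<^sub>R x) + f (t *\<^sub>R y)" by (rule add)
  then show "f ((1 - t) *\<^sub>R x + t *\<^sub>R y) \<le> (1 - t) * f x + t * f y" using t by (simp add: hom)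
qed simp

lemma sublinear_lipschitz:
  fixes f :: "'a::euclidean_space \<Rightarrow> real"
  assumes add: "\<And>x y. f (x + y) \<le> f x + f y" and hom: "\<And>k x. k > 0 \<Longrightarrow> f (k *\<^sub>R x) = k * f x"
  obtains L where "\<And>x y. \<bar>f x - f y\<bar> \<le> L * norm (x - y)"
proof -
  obtain M where M: "\<And>z. z \<in> cball 0 1 \<Longrightarrow> \<bar>f z\<bar> \<le> M"
    using convex_on_bounded_on_cball[OF sublinear_convex_on[OF add hom] open_UNIV subset_UNIV] by blast
  have f0: "f 0 = 0" using hom[of 2 0] by simp
  have le: "f x \<le> M * norm x" for x
  proof (cases "x = 0")
    case False
    have "f x = norm x * f (x /\<^sub>R norm x)" using hom[of "norm x" "x /\<^sub>R norm x"] False by simp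
    also have "\<dots> \<le> norm x * M"
    proof (rule mult_left_mono)
      have "x /\<^sub>R norm x \<in> cball 0 1" using False by simp
      from M[OF this] show "f (x /\<^sub>R norm x) \<le> M" by simp
    qed simp
    finally show ?thesis by (simp add: mult.commute)
  qed (simp add: f0)
  have diff: "f x - f y \<le> M * norm (x - y)" for x y
    using add[of "x - y" y] le[of "x - y"] by simp
  show thesis
  proof (rule that[of M])
    fix x y show "\<bar>f x - f y\<bar> \<le> M * norm (x - y)"
      using diff[of x y] diff[of y x] by (simp add: norm_minus_commute)
  qed
qed

definition convex_gauge :: "'a::real_vector set \<Rightarrow> 'a \<Rightarrow> real" where
  "convex_gauge S h = Inf {t. 0 < t \<and> h /\<^sub>R t \<in> S}"

context
  fixes S :: "'a::euclidean_space set"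
  assumes op: "open S" and conv: "convex S" and bdd: "bounded S" and zero: "0 \<in> S"
begin

lemma minkowski_set_nonempty: "\<exists>t>0. h /\<^sub>R t \<in> S"
proof -
  obtain r where r: "r > 0" "ball 0 r \<subseteq> S" using op zero open_contains_ball by blast
  have "norm (h /\<^sub>R ((norm h + 1) / r)) = norm h * r / (norm h + 1)" using r by (simp add: abs_div_pos add_nonneg_pos divide_inverse)
  also have "\<dots> < r" using r by (simp add: divide_less_eq add_nonneg_pos)
  finally have "h /\<^sub>R ((norm h + 1) / r) \<in> S" using r by (intro subsetD[OF r(2)]) (simp add: dist_norm)
  then show ?thesis using r by (intro exI[of _ "(norm h + 1) / r"]) (simp add: add_nonneg_pos)
qed

lemma convex_gauge_le: "0 < t \<Longrightarrow> h /\<^sub>R t \<in> S \<Longrightarrow> convex_gauge S h \<le> t"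
  unfolding convex_gauge_def by (intro cInf_lower bdd_belowI[of _ 0]) auto

text \<open>Openness of \<open>S\<close> leaves room to lower \<open>t\<close>, so the infimum is
  not attained. The resulting strict characterization is the working form of the gauge in what
  follows.\<close>

lemma convex_gauge_less:
  assumes "0 < t" "h /\<^sub>R t \<in> S" shows "convex_gauge S h < t"
proof -
  obtain r where r: "r > 0" "ball (h /\<^sub>R t) r \<subseteq> S" using op assms open_contains_ball by blast
  have "((\<lambda>s. h /\<^sub>R s) \<longlongrightarrow> h /\<^sub>R t) (at_left t)" using assms by (intro tendsto_intros) auto
  then have "eventually (\<lambda>s. h /\<^sub>R s \<in> S) (at_left t)" by (rule topological_tendstoD[OF _ op assms(2)])
  moreover have "eventually (\<lambda>s. s \<in> {0<..<t}) (at_left t)" using assms by (intro eventually_at_left_real)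
  ultimately have "eventually (\<lambda>s. h /\<^sub>R s \<in> S \<and> s \<in> {0<..<t}) (at_left t)" by eventually_elim simp
  then have "\<exists>s. h /\<^sub>R s \<in> S \<and> s \<in> {0<..<t}"
    by (rule eventually_happens'[OF trivial_limit_at_left_real])
  then obtain s where "h /\<^sub>R s \<in> S" "0 < s" "s < t" by auto
  then show ?thesis using convex_gauge_le[of s h] by simp
qed

lemma convex_gauge_lessD:
  assumes "convex_gauge S h < t" shows "0 < t \<and> h /\<^sub>R t \<in> S"
proof -
  have "{t. 0 < t \<and> h /\<^sub>R t \<in> S} \<noteq> {}" using minkowski_set_nonempty by blast
  then obtain s where s: "0 < s" "h /\<^sub>R s \<in> S" "s < t"
    using assms cInf_lessD[of "{t. 0 < t \<and> h /\<^sub>R t \<in> S}" t] unfolding convex_gauge_def by blast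
  have "(1 - s / t) *\<^sub>R 0 + (s / t) *\<^sub>R (h /\<^sub>R s) \<in> S" using s zero conv by (intro convexD) auto
  moreover have "(1 - s / t) *\<^sub>R 0 + (s / t) *\<^sub>R (h /\<^sub>R s) = h /\<^sub>R t" using s by (simp add: divide_inverse)
  ultimately show ?thesis using s by auto
qed

lemma convex_gauge_less_iff: "convex_gauge S h < t \<longleftrightarrow> 0 < t \<and> h /\<^sub>R t \<in> S"
  using convex_gauge_less convex_gauge_lessD by blast

lemma convex_gauge_scale:
  assumes "k > 0" shows "convex_gauge S (k *\<^sub>R h) = k * convex_gauge S h"
proof -
  have "convex_gauge S (k *\<^sub>R h) < t \<longleftrightarrow> k * convex_gauge S h < t" for t
  proof -
    have "k * convex_gauge S h < t \<longleftrightarrow> convex_gauge S h < t / k"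
      using assms by (simp add: field_simps)
    moreover have "(k *\<^sub>R h) /\<^sub>R t = h /\<^sub>R (t / k)" by (simp add: divide_inverse mult.commute)
    moreover have "0 < t \<longleftrightarrow> 0 < t / k" using assms by (simp add: zero_less_divide_iff)
    ultimately show ?thesis by (simp only: convex_gauge_less_iff)
  qed
  then show ?thesis by (metis less_irrefl linorder_neqE)
qed

lemma convex_gauge_triangle:
  "convex_gauge S (x + y) \<le> convex_gauge S x + convex_gauge S y"
proof (rule field_le_epsilon)
  fix e :: real assume e: "e > 0"
  define s where "s = convex_gauge S x + e / 2"
  define t where "t = convex_gauge S y + e / 2"
  have s: "0 < s" "x /\<^sub>R s \<in> S" using convex_gauge_lessD[of x s] e by (auto simp: s_def)
  have t: "0 < t" "y /\<^sub>R t \<in> S" using convex_gauge_lessD[of y t] e by (auto simp: t_def)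
  have "(s / (s + t)) *\<^sub>R (x /\<^sub>R s) + (t / (s + t)) *\<^sub>R (y /\<^sub>R t) \<in> S"
    using s t conv by (intro convexD) (auto simp: add_divide_distrib[symmetric])
  moreover have "(s / (s + t)) *\<^sub>R (x /\<^sub>R s) + (t / (s + t)) *\<^sub>R (y /\<^sub>R t) = (x + y) /\<^sub>R (s + t)"
  proof -
    have "s / (s + t) * inverse s = inverse (s + t)" "t / (s + t) * inverse t = inverse (s + t)"
      using s t by (simp_all add: field_simps)
    then show ?thesis by (simp only: scaleR_scaleR scaleR_add_right)
  qed
  ultimately have "convex_gauge S (x + y) \<le> s + t" using s t by (intro convex_gauge_le) auto
  then show "convex_gauge S (x + y) \<le> convex_gauge S x + convex_gauge S y + e"
    by (simp add: s_def t_def)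
qed

lemma convex_gauge_less_1_iff: "convex_gauge S h < 1 \<longleftrightarrow> h \<in> S"
  by (simp add: convex_gauge_less_iff)

lemma convex_gauge_zero: "convex_gauge S 0 = 0"
  using convex_gauge_scale[of 2 0] by simp

lemma convex_gauge_pos:
  assumes "h \<noteq> 0" shows "convex_gauge S h > 0"
proof (rule ccontr)
  assume le0: "\<not> ?thesis"
  obtain B where B: "\<And>x. x \<in> S \<Longrightarrow> norm x \<le> B" using bdd unfolding bounded_iff by blast
  have B0: "B \<ge> 0" using B[OF zero] by simp
  have "h /\<^sub>R (norm h / (B + 1)) \<in> S"
  proof -
    have "0 < norm h / (B + 1)" using assms B0 by simp
    then have "convex_gauge S h < norm h / (B + 1)" using le0 by linarith
    then show ?thesis using convex_gauge_lessD by blast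
  qed
  then have "norm (h /\<^sub>R (norm h / (B + 1))) \<le> B" by (rule B)
  moreover have "norm (h /\<^sub>R (norm h / (B + 1))) = B + 1" using assms B0 by (simp add: divide_inverse)
  ultimately show False by simp
qed

lemma convex_gauge_eq_1_iff: "convex_gauge S h = 1 \<longleftrightarrow> h \<in> frontier S"
proof
  assume h: "h \<in> frontier S"
  then have "h \<notin> S" "h \<in> closure S" using op by (auto simp: frontier_def interior_open)
  have "convex_gauge S h \<le> 1"
  proof (rule ccontr)
    assume gt: "\<not> ?thesis"
    define t where "t = convex_gauge S h"
    have t: "t > 1" using gt by (simp add: t_def)
    have "h - (1 - 1 / t) *\<^sub>R (h - 0) \<in> interior S"
      using \<open>h \<in> closure S\<close> zero op t by (intro mem_interior_closure_convex_shrink[OF conv]) (auto simp: interior_open)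
    moreover have "h - (1 - 1 / t) *\<^sub>R (h - 0) = h /\<^sub>R t" by (simp add: algebra_simps divide_inverse)
    ultimately have "h /\<^sub>R t \<in> S" using op by (simp add: interior_open)
    then show False using convex_gauge_less[of t h] t by (simp add: t_def)
  qed
  then show "convex_gauge S h = 1" using convex_gauge_less_1_iff[of h] \<open>h \<notin> S\<close> by auto
next
  assume h: "convex_gauge S h = 1"
  then have "h \<notin> S" using convex_gauge_less_1_iff[of h] by auto
  moreover have "h \<in> closure S" unfolding closure_approachable
  proof (intro allI impI)
    fix e :: real assume e: "e > 0"
    define s where "s = 1 - min (1/2) (e / (2 * (norm h + 1)))"
    have p: "norm h + 1 > 0" by (simp add: add_nonneg_pos)
    have s: "0 < s" "s < 1" using e p by (auto simp: s_def min_def)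
    have "s *\<^sub>R h \<in> S" using convex_gauge_scale[OF s(1), of h] h s convex_gauge_less_1_iff[of "s *\<^sub>R h"] by simp
    moreover have "dist (s *\<^sub>R h) h < e"
    proof -
      have "s *\<^sub>R h - h = - ((1 - s) *\<^sub>R h)" by (simp add: algebra_simps)
      then have "dist (s *\<^sub>R h) h = (1 - s) * norm h" using s by (simp add: dist_norm)
      also have "\<dots> \<le> e / (2 * (norm h + 1)) * (norm h + 1)" using s p e by (intro mult_mono) (auto simp: s_def)
      also have "\<dots> = e / 2" using p by (simp add: divide_simps)
      finally show ?thesis using e by simp
    qed
    ultimately show "\<exists>y\<in>S. dist y h < e" by blast
  qed
  ultimately show "h \<in> frontier S" using op by (simp add: frontier_def interior_open)
qed

end

text \<open>An implicit function argument by hand. The radial direction \<open>e\<close> from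
  \<open>a\<close> to \<open>x\<close> is transversal to the level set of \<open>\<gamma>\<close>,
  so near \<open>x\<close> the frontier is the graph over the hyperplane orthogonal to
  \<open>e\<close> of the largest height that stays in \<open>U\<close>; the linearization of
  \<open>\<gamma>\<close> determines its gradient.\<close>

lemma boundary_differentiable_gauge:
  fixes U :: "'a::euclidean_space set"
  assumes op: "open U" and conv: "convex U" and bdd: "bounded U" and a: "a \<in> U" and x: "x \<in> frontier U"
    and mem: "\<And>z. z \<in> U \<longleftrightarrow> \<gamma> (z - a) < 1" and hom: "\<And>k h. k > 0 \<Longrightarrow> \<gamma> (k *\<^sub>R h) = k * \<gamma> h"
    and \<gamma>x: "\<gamma> (x - a) = 1" and q: "GDERIV \<gamma> (x - a) :> q"
  shows "boundary_differentiable U x"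
proof -
  define h0 where "h0 = x - a"
  have xnot: "x \<notin> U" and xcl: "x \<in> closure U" using x op by (auto simp: frontier_def interior_open)
  then have h0: "h0 \<noteq> 0" using a by (auto simp: h0_def)
  have der: "\<exists>d>0. \<forall>v. norm v < d \<longrightarrow> \<bar>\<gamma> (h0 + v) - 1 - q \<bullet> v\<bar> \<le> \<eta> * norm v" if "\<eta> > 0" for \<eta>
  proof -
    obtain d where d: "d > 0" "\<And>y. norm (y - h0) < d \<Longrightarrow> norm (\<gamma> y - \<gamma> h0 - (y - h0) \<bullet> q) \<le> \<eta> * norm (y - h0)"
    proof -
      have "\<forall>\<eta>>0. \<exists>d>0. \<forall>y. norm (y - h0) < d \<longrightarrow> norm (\<gamma> y - \<gamma> h0 - (y - h0) \<bullet> q) \<le> \<eta> * norm (y - h0)"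
        using q unfolding gderiv_def has_derivative_at_alt h0_def by (rule conjunct2)
      then show thesis using \<open>\<eta> > 0\<close> that by blast
    qed
    have "\<bar>\<gamma> (h0 + v) - 1 - q \<bullet> v\<bar> \<le> \<eta> * norm v" if "norm v < d" for v
      using d(2)[of "h0 + v"] that \<gamma>x by (simp add: h0_def inner_commute)
    then show ?thesis using d(1) by blast
  qed
  \<comment> \<open>Euler's relation, obtained by comparing the derivative with the exact value of
    \<open>\<gamma>\<close> along the ray through \<open>h0\<close>.\<close>
  have qh: "q \<bullet> h0 = 1"
  proof (rule ccontr)
    assume ne: "q \<bullet> h0 \<noteq> 1"
    define \<eta> where "\<eta> = \<bar>1 - q \<bullet> h0\<bar> / (2 * norm h0)"
    have \<eta>: "\<eta> > 0" using ne h0 by (simp add: \<eta>_def)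
    obtain d where d: "d > 0" "\<And>v. norm v < d \<Longrightarrow> \<bar>\<gamma> (h0 + v) - 1 - q \<bullet> v\<bar> \<le> \<eta> * norm v" using der[OF \<eta>] by blast
    define s where "s = d / (2 * norm h0)"
    have s: "s > 0" "norm (s *\<^sub>R h0) < d" using d h0 by (auto simp: s_def)
    have "\<gamma> (h0 + s *\<^sub>R h0) = 1 + s" using hom[of "1 + s" h0] s \<gamma>x by (simp add: h0_def scaleR_add_left)
    then have "\<bar>s * (1 - q \<bullet> h0)\<bar> \<le> \<eta> * (s * norm h0)" using d(2)[OF s(2)] s(1) by (simp add: right_diff_distrib)
    also have "\<dots> = s * (\<bar>1 - q \<bullet> h0\<bar> / 2)" using h0 by (simp add: \<eta>_def)
    finally have "s * \<bar>1 - q \<bullet> h0\<bar> \<le> s * (\<bar>1 - q \<bullet> h0\<bar> / 2)" using s by (simp add: abs_mult)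
    then have "\<bar>1 - q \<bullet> h0\<bar> \<le> \<bar>1 - q \<bullet> h0\<bar> / 2" by (rule mult_left_le_imp_le[OF _ s(1)])
    then show False using ne by simp
  qed
  define e where "e = h0 /\<^sub>R norm h0"
  have e: "norm e = 1" using h0 by (simp add: e_def)
  have ee: "e \<bullet> e = 1" using e by (simp add: dot_square_norm)
  have h0e: "h0 = norm h0 *\<^sub>R e" using h0 by (simp add: e_def)
  define c where "c = q \<bullet> e"
  have c: "c > 0" using qh h0 by (simp add: c_def e_def)
  \<comment> \<open>Solves \<open>q \<bullet> (d + (g \<bullet> d) *\<^sub>R e) = 0\<close> for
    \<open>d\<close> orthogonal to \<open>e\<close>, so that \<open>\<gamma>\<close> is constant to
    first order along the candidate tangent plane; \<open>e - g\<close> is then a multiple of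
    \<open>q\<close>.\<close>
  define g where "g = e - q /\<^sub>R c"
  have ge: "g \<bullet> e = 0" using c by (simp add: g_def inner_diff_left ee c_def)
  define T where "T p = {t. p + t *\<^sub>R e \<in> U}" for p
  define f where "f p = Sup (T p)" for p
  define pr where "pr z = z - (z \<bullet> e) *\<^sub>R e" for z
  define p0 where "p0 = pr x"
  have pr_e: "pr z \<bullet> e = 0" for z by (simp add: pr_def inner_diff_left ee)
  have pr_diff: "pr y - pr z = pr (y - z)" for y z by (simp add: pr_def algebra_simps inner_diff_left)
  have pr_le: "norm (pr h) \<le> norm h" for h unfolding pr_def by (rule norm_orthogonal_part_le[OF e])
  define t0 where "t0 = x \<bullet> e - norm h0"
  have a_eq: "a = p0 + t0 *\<^sub>R e"
  proof -
    have "p0 + t0 *\<^sub>R e = x - norm h0 *\<^sub>R e" by (simp add: p0_def pr_def t0_def scaleR_diff_left)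
    also have "\<dots> = x - h0" using h0e by simp
    finally show ?thesis by (simp add: h0_def)
  qed
  have x_eq: "x = p0 + (x \<bullet> e) *\<^sub>R e" by (simp add: p0_def pr_def)
  obtain r0 where r0: "r0 > 0" "ball a r0 \<subseteq> U" using op a open_contains_ball by blast
  \<comment> \<open>The centre \<open>a\<close> lies below \<open>x\<close> at height
    \<open>t0\<close>. The bound by \<open>r0\<close> keeps \<open>p + t0 *\<^sub>R e\<close> in
    \<open>U\<close> for all base points near \<open>p0\<close>, and the bound by
    \<open>norm h0\<close> keeps the heights occurring in \<open>ball x r\<close> above
    \<open>t0\<close>; between \<open>t0\<close> and \<open>f p\<close> convexity decides
    membership.\<close>
  define r where "r = min r0 (norm h0)"
  have r: "r > 0" "r \<le> norm h0" "ball a r \<subseteq> U" using r0 h0 by (auto simp: r_def)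
  have t0T: "t0 \<in> T p" if "norm (p - p0) < r" for p
    using that r(3) by (auto simp: T_def a_eq dist_norm norm_minus_commute subset_iff)
  have bddT: "bdd_above (T p)" for p
  proof -
    obtain B where B: "\<And>z. z \<in> U \<Longrightarrow> norm z \<le> B" using bdd unfolding bounded_iff by blast
    have "t \<le> B + norm p" if "t \<in> T p" for t
    proof -
      have "\<bar>t\<bar> = norm ((p + t *\<^sub>R e) - p)" using e by simp
      also have "\<dots> \<le> norm (p + t *\<^sub>R e) + norm p" by (rule norm_triangle_ineq4)
      also have "\<dots> \<le> B + norm p" using B that by (simp add: T_def)
      finally show ?thesis by simp
    qed
    then show ?thesis by (rule bdd_aboveI)
  qed
  have T_less: "t < f p" if "t \<in> T p" for t p
  proof -
    obtain \<epsilon> where \<epsilon>: "\<epsilon> > 0" "ball (p + t *\<^sub>R e) \<epsilon> \<subseteq> U" using op \<open>t \<in> T p\<close> open_contains_ball unfolding T_def by blast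
    have "p + (t + \<epsilon> / 2) *\<^sub>R e \<in> U" using \<epsilon> e by (intro subsetD[OF \<epsilon>(2)]) (simp add: dist_norm scaleR_add_left)
    then have "t + \<epsilon> / 2 \<le> f p" unfolding f_def by (intro cSup_upper bddT) (simp add: T_def)
    then show ?thesis using \<epsilon> by simp
  qed
  have less_T: "t \<in> T p" if p: "norm (p - p0) < r" and t: "t0 \<le> t" "t < f p" for t p
  proof -
    obtain t1 where t1: "t1 \<in> T p" "t < t1"
      using t(2) t0T[OF p] less_cSup_iff[OF _ bddT, of p t] unfolding f_def by blast
    define u where "u = (t - t0) / (t1 - t0)"
    have u: "0 \<le> u" "u \<le> 1" using t t1 by (auto simp: u_def)
    have ut: "t = (1 - u) * t0 + u * t1"
    proof -
      have "u * (t1 - t0) = t - t0" using t t1 by (simp add: u_def)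
      then show ?thesis by (simp add: algebra_simps)
    qed
    have "(1 - u) *\<^sub>R (p + t0 *\<^sub>R e) + u *\<^sub>R (p + t1 *\<^sub>R e) \<in> U"
      using u t1 t0T[OF p] conv by (intro convexD) (auto simp: T_def)
    moreover have "(1 - u) *\<^sub>R (p + t0 *\<^sub>R e) + u *\<^sub>R (p + t1 *\<^sub>R e) = p + t *\<^sub>R e"
      by (simp add: ut algebra_simps)
    ultimately show ?thesis by (simp add: T_def)
  qed
  have fp0: "f p0 = x \<bullet> e"
  proof (rule antisym)
    show "f p0 \<le> x \<bullet> e"
    proof (rule ccontr)
      assume "\<not> ?thesis"
      then have "x \<bullet> e \<in> T p0" using r(1) by (intro less_T) (auto simp: t0_def)
      then show False using xnot x_eq by (simp add: T_def)
    qed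
    show "x \<bullet> e \<le> f p0"
    proof (rule dense_le_bounded)
      show "t0 < x \<bullet> e" using h0 by (simp add: t0_def)
      fix t assume t: "t0 < t" "t < x \<bullet> e"
      define s where "s = (x \<bullet> e - t) / norm h0"
      have s: "0 < s" "s \<le> 1" using t h0 by (auto simp: s_def t0_def divide_le_eq)
      have "x - s *\<^sub>R (x - a) \<in> interior U"
        using xcl a op s by (intro mem_interior_closure_convex_shrink[OF conv]) (auto simp: interior_open)
      moreover have "x - s *\<^sub>R (x - a) = p0 + t *\<^sub>R e"
      proof -
        have "s *\<^sub>R h0 = (x \<bullet> e - t) *\<^sub>R e" using h0 by (subst h0e) (simp add: s_def)
        then have "x - s *\<^sub>R (x - a) = x - (x \<bullet> e - t) *\<^sub>R e" by (simp add: h0_def)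
        also have "\<dots> = p0 + t *\<^sub>R e" by (subst x_eq) (simp add: scaleR_diff_left)
        finally show ?thesis .
      qed
      ultimately have "t \<in> T p0" using op by (simp add: T_def interior_open)
      then show "t \<le> f p0" using T_less by (simp add: less_imp_le)
    qed
  qed
  have "\<forall>z\<in>ball x r. z \<in> U \<longleftrightarrow> z \<bullet> e < f (z - (z \<bullet> e) *\<^sub>R e)"
  proof
    fix z assume z: "z \<in> ball x r"
    have "norm (pr z - p0) \<le> norm (z - x)" using pr_le[of "z - x"] by (simp add: p0_def pr_diff)
    also have "\<dots> < r" using z by (simp add: dist_norm norm_minus_commute)
    finally have p: "norm (pr z - p0) < r" .
    have "\<bar>(z - x) \<bullet> e\<bar> \<le> norm (z - x)" using Cauchy_Schwarz_ineq2[of "z - x" e] e by simp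
    also have "\<dots> < r" using z by (simp add: dist_norm norm_minus_commute)
    finally have "t0 \<le> z \<bullet> e" using r(2) by (simp add: t0_def inner_diff_left)
    then have "z \<bullet> e < f (pr z) \<longleftrightarrow> z \<bullet> e \<in> T (pr z)" using less_T[OF p] T_less by blast
    also have "\<dots> \<longleftrightarrow> z \<in> U" by (simp add: T_def pr_def)
    finally show "z \<in> U \<longleftrightarrow> z \<bullet> e < f (z - (z \<bullet> e) *\<^sub>R e)" by (simp add: pr_def)
  qed
  moreover have "(f has_derivative (\<lambda>h. g \<bullet> h)) (at (x - (x \<bullet> e) *\<^sub>R e) within {p. p \<bullet> e = 0})"
    unfolding has_derivative_within_alt
  proof (intro conjI allI impI)
    show "bounded_linear (\<lambda>h. g \<bullet> h)" by (rule bounded_linear_inner_right)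
    fix \<eta> :: real assume \<eta>: "\<eta> > 0"
    define K where "K = 1 + norm g + \<eta>"
    have K: "K > 0" using \<eta> by (simp add: K_def add_pos_nonneg add_nonneg_pos)
    \<comment> \<open>Moving the height by \<open>\<eta> * norm d\<close> changes
      \<open>\<gamma>\<close> by \<open>\<eta> * norm d * c\<close> to first order. The factor
      \<open>1 / (2 * K)\<close> keeps the remainder below half of that, so the sign of
      \<open>\<gamma> - 1\<close> is decided.\<close>
    define \<eta>' where "\<eta>' = \<eta> * c / (2 * K)"
    have \<eta>': "\<eta>' > 0" "\<eta>' * K = \<eta> * c / 2" using \<eta> c K by (auto simp: \<eta>'_def)
    obtain \<delta> where \<delta>: "\<delta> > 0" "\<And>v. norm v < \<delta> \<Longrightarrow> \<bar>\<gamma> (h0 + v) - 1 - q \<bullet> v\<bar> \<le> \<eta>' * norm v" using der[OF \<eta>'(1)] by blast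
    define \<rho> where "\<rho> = min r (min (\<delta> / K) (norm h0 / K))"
    have \<rho>: "\<rho> > 0" "\<rho> \<le> r" "\<rho> \<le> \<delta> / K" "\<rho> \<le> norm h0 / K" using r \<delta>(1) K h0 by (auto simp: \<rho>_def)
    show "\<exists>d>0. \<forall>y\<in>{p. p \<bullet> e = 0}. norm (y - (x - (x \<bullet> e) *\<^sub>R e)) < d \<longrightarrow>
        norm (f y - f (x - (x \<bullet> e) *\<^sub>R e) - g \<bullet> (y - (x - (x \<bullet> e) *\<^sub>R e))) \<le> \<eta> * norm (y - (x - (x \<bullet> e) *\<^sub>R e))"
    proof (intro exI[of _ \<rho>] conjI ballI impI \<rho>(1))
      fix p assume p: "p \<in> {p. p \<bullet> e = 0}" and close: "norm (p - (x - (x \<bullet> e) *\<^sub>R e)) < \<rho>"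
      define d where "d = p - p0"
      have p0': "x - (x \<bullet> e) *\<^sub>R e = p0" by (simp add: p0_def pr_def)
      have nd: "norm d < \<rho>" using close by (simp add: d_def p0')
      have de: "d \<bullet> e = 0" using p pr_e[of x] by (simp add: d_def p0_def inner_diff_left)
      have gd: "c * (g \<bullet> d) = - (q \<bullet> d)" using c de by (simp add: g_def inner_diff_left inner_commute[of e])
      have "\<rho> * K \<le> \<delta>" "\<rho> * K \<le> norm h0" using \<rho>(3,4) K by (simp_all add: pos_le_divide_eq)
      moreover have "norm d * K < \<rho> * K" using nd K by simp
      ultimately have dK: "norm d * K < \<delta>" "norm d * K < norm h0" by linarith+
      have gdle: "\<bar>g \<bullet> d\<bar> \<le> norm g * norm d" by (rule Cauchy_Schwarz_ineq2)
      have est: "\<bar>\<gamma> (p + (f p0 + g \<bullet> d + s * (\<eta> * norm d)) *\<^sub>R e - a) - 1 - s * (\<eta> * norm d) * c\<bar> \<le> \<eta> * norm d * c / 2"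
        if s: "s = 1 \<or> s = - 1" for s
      proof -
        define v where "v = d + (g \<bullet> d + s * (\<eta> * norm d)) *\<^sub>R e"
        have eq: "p + (f p0 + g \<bullet> d + s * (\<eta> * norm d)) *\<^sub>R e - a = h0 + v"
        proof -
          have "h0 + v = p0 + (x \<bullet> e) *\<^sub>R e - a + v" by (simp add: h0_def x_eq[symmetric])
          then show ?thesis by (simp add: v_def d_def fp0 algebra_simps)
        qed
        have qv: "q \<bullet> v = s * (\<eta> * norm d) * c"
          using gd by (simp add: v_def inner_add_right c_def[symmetric] distrib_left distrib_right mult.commute)
        have "norm v \<le> norm d + \<bar>g \<bullet> d + s * (\<eta> * norm d)\<bar>"
          unfolding v_def using norm_triangle_ineq[of d "(g \<bullet> d + s * (\<eta> * norm d)) *\<^sub>R e"] e by simp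
        also have "\<dots> \<le> norm d + (norm g * norm d + \<eta> * norm d)"
        proof -
          have "\<bar>s * (\<eta> * norm d)\<bar> = \<eta> * norm d" using s \<eta> by (auto simp: abs_mult)
          then show ?thesis using gdle abs_triangle_ineq[of "g \<bullet> d" "s * (\<eta> * norm d)"] by simp
        qed
        also have "\<dots> = norm d * K" by (simp add: K_def algebra_simps)
        finally have nv: "norm v \<le> norm d * K" .
        have "\<bar>\<gamma> (h0 + v) - 1 - q \<bullet> v\<bar> \<le> \<eta>' * norm v" using nv dK by (intro \<delta>(2)) simp
        also have "\<dots> \<le> \<eta>' * (norm d * K)" using nv \<eta>' by (intro mult_left_mono) auto
        also have "\<dots> = (\<eta>' * K) * norm d" by simp
        also have "\<dots> = \<eta> * norm d * c / 2" unfolding \<eta>'(2) by simp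
        finally show ?thesis unfolding eq qv .
      qed
      have pr0: "norm (p - p0) < r" using nd \<rho>(2) by (simp add: d_def)
      have "\<bar>f p - f p0 - g \<bullet> d\<bar> \<le> \<eta> * norm d"
      proof (cases "d = 0")
        case True then show ?thesis by (simp add: d_def)
      next
        case False
        then have pos: "\<eta> * norm d * c > 0" using \<eta> c by simp
        have minus: "- 1 * (\<eta> * norm d) * c = - (\<eta> * norm d * c)" "1 * (\<eta> * norm d) * c = \<eta> * norm d * c" by simp_all
        have "f p0 + g \<bullet> d - \<eta> * norm d < f p"
        proof (rule T_less)
          have "\<gamma> (p + (f p0 + g \<bullet> d + (- 1) * (\<eta> * norm d)) *\<^sub>R e - a) < 1" using est[OF disjI2[OF refl]] pos minus unfolding abs_le_iff by linarith
          then show "f p0 + g \<bullet> d - \<eta> * norm d \<in> T p" by (simp add: T_def mem)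
        qed
        moreover have "f p \<le> f p0 + g \<bullet> d + \<eta> * norm d"
        proof (rule ccontr)
          assume *: "\<not> ?thesis"
          have "t0 \<le> f p0 + g \<bullet> d + \<eta> * norm d"
          proof -
            have "norm d * K = norm d + (norm g * norm d + \<eta> * norm d)" by (simp add: K_def algebra_simps)
            moreover have "\<eta> * norm d \<ge> 0" using \<eta> by simp
            ultimately have "\<bar>g \<bullet> d\<bar> \<le> norm h0" using dK(2) gdle norm_ge_zero[of d] by linarith
            then show ?thesis using \<open>\<eta> * norm d \<ge> 0\<close> by (simp add: fp0 t0_def)
          qed
          then have "f p0 + g \<bullet> d + \<eta> * norm d \<in> T p" using * by (intro less_T[OF pr0]) auto
          then have "\<gamma> (p + (f p0 + g \<bullet> d + 1 * (\<eta> * norm d)) *\<^sub>R e - a) < 1" by (simp add: T_def mem)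
          then show False using est[OF disjI1[OF refl]] pos minus unfolding abs_le_iff by linarith
        qed
        ultimately show ?thesis by (simp add: abs_le_iff)
      qed
      then show "norm (f p - f (x - (x \<bullet> e) *\<^sub>R e) - g \<bullet> (p - (x - (x \<bullet> e) *\<^sub>R e))) \<le> \<eta> * norm (p - (x - (x \<bullet> e) *\<^sub>R e))"
        unfolding p0' d_def by simp
    qed
  qed
  ultimately have "outer_unit_normal U x ((e - g) /\<^sub>R norm (e - g))"
    unfolding outer_unit_normal_def using x e r(1) ge by blast
  then show ?thesis unfolding boundary_differentiable_def by blast
qed

text \<open>The function \<open>H\<close> below is the 1-homogeneous extension, with respect to the center \<open>a\<close>, of
  \<open>w + C\<close> on the frontier; for \<open>C\<close> as below the perspective of \<open>w + C\<close> increases in the gauge,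
  so \<open>H\<close> is sublinear.\<close>

lemma homogeneous_extension_subadditive:
  fixes U :: "'a::euclidean_space set" and w :: "'a \<Rightarrow> real"
  assumes op: "open U" and conv: "convex U" and bdd: "bounded U" and a: "a \<in> U"
    and w: "convex_on UNIV w" and lip: "\<And>x y. \<bar>w x - w y\<bar> \<le> L * norm (x - y)"
    and nonneg: "\<And>x. x \<in> U \<Longrightarrow> 0 \<le> w x" and D: "\<And>x. x \<in> U \<Longrightarrow> norm (x - a) \<le> D"
  defines "\<gamma> \<equiv> convex_gauge ((+) (- a) ` U)"
  defines "H \<equiv> (\<lambda>h. \<gamma> h * (w (a + h /\<^sub>R \<gamma> h) + L * D))"
  shows "H (h1 + h2) \<le> H h1 + H h2"
proof -
  let ?S = "(+) (- a) ` U"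
  have S: "open ?S" "convex ?S" "bounded ?S" "0 \<in> ?S"
    using open_translation[OF op, of "- a"] convex_translation[OF conv, of "- a"] bounded_translation[OF bdd, of "- a"] a
    by (simp_all add: image_iff)
  have L: "L \<ge> 0"
  proof -
    obtain b :: 'a where "b \<in> Basis" using nonempty_Basis by blast
    then show ?thesis using order_trans[OF abs_ge_zero lip[of b 0]] by simp
  qed
  have D0: "D \<ge> 0" using D[OF a] by simp
  have pos: "\<gamma> h > 0" if "h \<noteq> 0" for h unfolding \<gamma>_def by (rule convex_gauge_pos[OF S that])
  have \<gamma>0: "\<gamma> 0 = 0" unfolding \<gamma>_def by (rule convex_gauge_zero[OF S])
  have tri: "\<gamma> (h1 + h2) \<le> \<gamma> h1 + \<gamma> h2" unfolding \<gamma>_def by (rule convex_gauge_triangle[OF S])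
  have clw: "w z \<ge> 0" if "z \<in> closure U" for z
  proof (rule field_le_epsilon)
    fix e :: real assume e: "e > 0"
    then have "e / (L + 1) > 0" using L by simp
    then obtain y where y: "y \<in> U" "dist y z < e / (L + 1)" using \<open>z \<in> closure U\<close> unfolding closure_approachable by blast
    have "L * norm (y - z) \<le> (L + 1) * norm (y - z)" by (intro mult_right_mono) auto
    also have "\<dots> \<le> e" using y(2) L by (simp add: dist_norm field_simps)
    finally show "0 \<le> w z + e" using lip[of y z] nonneg[OF y(1)] by linarith
  qed
  have fr: "a + h /\<^sub>R s \<in> closure U" if "h \<noteq> 0" "s \<ge> \<gamma> h" for h s
  proof -
    have "\<gamma> (h /\<^sub>R \<gamma> h) = 1" using convex_gauge_scale[OF S, of "inverse (\<gamma> h)" h] pos[OF that(1)] by (simp add: \<gamma>_def)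
    then have "h /\<^sub>R \<gamma> h \<in> frontier ?S" using convex_gauge_eq_1_iff[OF S] by (simp add: \<gamma>_def)
    then have "h /\<^sub>R \<gamma> h \<in> (+) (- a) ` closure U" unfolding frontier_translation by (auto simp: frontier_def)
    then have 1: "a + h /\<^sub>R \<gamma> h \<in> closure U" by auto
    have "(1 - \<gamma> h / s) *\<^sub>R a + (\<gamma> h / s) *\<^sub>R (a + h /\<^sub>R \<gamma> h) \<in> closure U"
      using that pos[OF that(1)] 1 a closure_subset[of U]
      by (intro convexD[OF convex_closure[OF conv]]) auto
    moreover have "(1 - \<gamma> h / s) *\<^sub>R a + (\<gamma> h / s) *\<^sub>R (a + h /\<^sub>R \<gamma> h) = a + h /\<^sub>R s"
    proof -
      have "(\<gamma> h / s) *\<^sub>R (h /\<^sub>R \<gamma> h) = h /\<^sub>R s" using pos[OF that(1)] by (simp add: divide_inverse)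
      then show ?thesis by (simp add: scaleR_add_right scaleR_diff_left)
    qed
    ultimately show ?thesis by simp
  qed
  have Hpos: "H h \<ge> 0" for h
  proof (cases "h = 0")
    case False
    have "w (a + h /\<^sub>R \<gamma> h) \<ge> 0" by (intro clw fr False) simp
    then show ?thesis unfolding H_def using pos[OF False] L D0 by (intro mult_nonneg_nonneg add_nonneg_nonneg) auto
  qed (simp add: H_def \<gamma>0)
  \<comment> \<open>At 0 the gauge vanishes, so \<open>H 0 = 0\<close> whatever the quotient means;
    opposite arguments are settled by \<open>H \<ge> 0\<close>.\<close>
  consider "h1 = 0" | "h2 = 0" | "h1 + h2 = 0" | "h1 \<noteq> 0" "h2 \<noteq> 0" "h1 + h2 \<noteq> 0" by blast
  then show ?thesis
  proof cases
    case 3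
    then show ?thesis using Hpos[of h1] Hpos[of h2] by (simp add: H_def \<gamma>0)
  next
    case 4
    define g where "g = \<gamma> (h1 + h2)"
    define g1 where "g1 = \<gamma> h1"
    define g2 where "g2 = \<gamma> h2"
    define t where "t = g1 + g2"
    have g: "g > 0" "g1 > 0" "g2 > 0" "g \<le> t" using pos 4 tri by (simp_all add: g_def g1_def g2_def t_def)
    have t: "t > 0" using g by simp
    define z where "z = a + (h1 + h2) /\<^sub>R g"
    define z' where "z' = a + (h1 + h2) /\<^sub>R t"
    have w'0: "w z' \<ge> 0" unfolding z'_def using g 4 by (intro clw fr) (auto simp: g_def)
    \<comment> \<open>Replacing the scale \<open>g\<close> by the larger \<open>t\<close> moves the
      point towards \<open>a\<close> and may lower \<open>w\<close> by
      \<open>(1 - g / t) * (L * D)\<close>. The added constant \<open>L * D\<close>, multiplied by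
      the larger scale, makes up for it.\<close>
    have mono: "g * (w z + L * D) \<le> t * (w z' + L * D)"
    proof -
      have nz: "norm (z - a) \<le> D"
      proof -
        have "closure U \<subseteq> cball a D" using D by (intro closure_minimal) (auto simp: dist_norm norm_minus_commute)
        moreover have "z \<in> closure U" unfolding z_def using 4 by (intro fr) (auto simp: g_def)
        ultimately show ?thesis by (auto simp: dist_norm norm_minus_commute)
      qed
      have "z - z' = (1 - g / t) *\<^sub>R (z - a)"
      proof -
        have "g / t * inverse g = inverse t" using g t by (simp add: divide_inverse)
        then have "(g / t) *\<^sub>R ((h1 + h2) /\<^sub>R g) = (h1 + h2) /\<^sub>R t" by (simp only: scaleR_scaleR)
        moreover have "z - a = (h1 + h2) /\<^sub>R g" by (simp add: z_def)
        ultimately have "z' = a + (g / t) *\<^sub>R (z - a)" by (simp only: z'_def)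
        then show ?thesis by (simp add: scaleR_diff_left)
      qed
      moreover have "1 - g / t \<ge> 0" using g t by simp
      ultimately have "norm (z - z') \<le> (1 - g / t) * D" using nz by (simp add: mult_left_mono)
      then have "L * norm (z - z') \<le> L * ((1 - g / t) * D)" using L by (intro mult_left_mono)
      then have "w z \<le> w z' + (1 - g / t) * (L * D)" using lip[of z z'] by (simp add: mult_ac)
      then have "g * (w z + L * D) \<le> g * (w z' + (1 - g / t) * (L * D) + L * D)" using g by (intro mult_left_mono) auto
      also have "\<dots> = g * w z' + (g * (1 - g / t) + g) * (L * D)" by (simp add: algebra_simps)
      also have "\<dots> \<le> t * w z' + t * (L * D)"
      proof (rule add_mono)
        show "g * w z' \<le> t * w z'" using g w'0 by (intro mult_right_mono)
        have "g * (1 - g / t) \<le> t * (1 - g / t)" using g \<open>1 - g / t \<ge> 0\<close> by (intro mult_right_mono)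
        also have "\<dots> = t - g" using t by (simp add: right_diff_distrib)
        finally have "g * (1 - g / t) + g \<le> t" by simp
        then show "(g * (1 - g / t) + g) * (L * D) \<le> t * (L * D)" using L D0 by (intro mult_right_mono) auto
      qed
      finally show ?thesis by (simp add: distrib_left)
    qed
    \<comment> \<open>At the common scale \<open>t = g1 + g2\<close> the point is a convex
      combination of the two radial projections, with weights proportional to their gauges:
      convexity of the perspective.\<close>
    have "w z' \<le> g1 / t * w (a + h1 /\<^sub>R g1) + g2 / t * w (a + h2 /\<^sub>R g2)"
    proof -
      have "z' = (g1 / t) *\<^sub>R (a + h1 /\<^sub>R g1) + (g2 / t) *\<^sub>R (a + h2 /\<^sub>R g2)"
      proof -
        have "(g1 / t) *\<^sub>R (h1 /\<^sub>R g1) = h1 /\<^sub>R t" "(g2 / t) *\<^sub>R (h2 /\<^sub>R g2) = h2 /\<^sub>R t"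
          using g by (simp_all add: divide_inverse)
        moreover have "(g1 / t) *\<^sub>R a + (g2 / t) *\<^sub>R a = a"
          using t by (simp add: scaleR_add_left[symmetric] add_divide_distrib[symmetric] t_def)
        moreover have "(g1 / t) *\<^sub>R (a + h1 /\<^sub>R g1) + (g2 / t) *\<^sub>R (a + h2 /\<^sub>R g2) =
            ((g1 / t) *\<^sub>R a + (g2 / t) *\<^sub>R a) + ((g1 / t) *\<^sub>R (h1 /\<^sub>R g1) + (g2 / t) *\<^sub>R (h2 /\<^sub>R g2))"
          by (simp only: scaleR_add_right add_ac)
        ultimately have "(g1 / t) *\<^sub>R (a + h1 /\<^sub>R g1) + (g2 / t) *\<^sub>R (a + h2 /\<^sub>R g2) = a + (h1 /\<^sub>R t + h2 /\<^sub>R t)"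
          by (simp only:)
        then show ?thesis by (simp only: z'_def scaleR_add_right)
      qed
      moreover have "g1 / t + g2 / t = 1" using t by (simp add: add_divide_distrib[symmetric] t_def)
      moreover have "0 \<le> g1 / t" "0 \<le> g2 / t" using g t by auto
      ultimately show ?thesis using w unfolding convex_on_def by blast
    qed
    then have "t * w z' \<le> t * (g1 / t * w (a + h1 /\<^sub>R g1) + g2 / t * w (a + h2 /\<^sub>R g2))"
      using t by (intro mult_left_mono) auto
    also have "\<dots> = g1 * w (a + h1 /\<^sub>R g1) + g2 * w (a + h2 /\<^sub>R g2)" using t by (simp add: distrib_left)
    finally have "t * (w z' + L * D) \<le> g1 * (w (a + h1 /\<^sub>R g1) + L * D) + g2 * (w (a + h2 /\<^sub>R g2) + L * D)"
      by (simp add: t_def algebra_simps)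
    then show ?thesis using mono unfolding H_def z_def g_def g1_def g2_def by linarith
  qed (simp_all add: H_def \<gamma>0)
qed

text \<open>If the gauge and \<open>H\<close> are both differentiable at \<open>x - a\<close>, the
  first makes the frontier differentiable at \<open>x\<close> and the second the boundary values.
  All other frontier points lie in countably many kink sets, where the cone estimate
  applies.\<close>

lemma hausdorff_frontier_null:
  fixes U :: "'a::euclidean_space set" and w :: "'a \<Rightarrow> real"
  assumes op: "open U" and conv: "convex U" and bdd: "bounded U" and ne: "U \<noteq> {}"
    and w: "convex_on UNIV w" and lip: "\<And>x y. \<bar>w x - w y\<bar> \<le> L * norm (x - y)"
    and nonneg: "\<And>x. x \<in> U \<Longrightarrow> 0 \<le> w x"
  shows "hausdorff_measure (DIM('a) - 1) (frontier U - dom_D_minus U w) = 0"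
proof -
  obtain a where a: "a \<in> U" using ne by blast
  define S where "S = (+) (- a) ` U"
  have S: "open S" "convex S" "bounded S" "0 \<in> S"
    using open_translation[OF op, of "- a"] convex_translation[OF conv, of "- a"] bounded_translation[OF bdd, of "- a"] a
    by (simp_all add: S_def image_iff)
  obtain D where D: "\<And>x. x \<in> S \<Longrightarrow> norm x \<le> D" using S(3) unfolding bounded_iff by blast
  have D': "norm (x - a) \<le> D" if "x \<in> U" for x using D[of "x - a"] that by (auto simp: S_def image_iff)
  define \<gamma> where "\<gamma> = convex_gauge S"
  define H where "H = (\<lambda>h. \<gamma> h * (w (a + h /\<^sub>R \<gamma> h) + L * D))"
  have \<gamma>hom: "\<gamma> (k *\<^sub>R h) = k * \<gamma> h" if "k > 0" for k h unfolding \<gamma>_def by (rule convex_gauge_scale[OF S that])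
  have \<gamma>add: "\<gamma> (h + h') \<le> \<gamma> h + \<gamma> h'" for h h' unfolding \<gamma>_def by (rule convex_gauge_triangle[OF S])
  have Hhom: "H (k *\<^sub>R h) = k * H h" if "k > 0" for k h
  proof -
    have "inverse (k * \<gamma> h) * k = inverse (\<gamma> h)" using that by (cases "\<gamma> h = 0") (simp_all add: field_simps)
    then have "(k *\<^sub>R h) /\<^sub>R (k * \<gamma> h) = h /\<^sub>R \<gamma> h" by (simp only: scaleR_scaleR)
    then show ?thesis unfolding H_def \<gamma>hom[OF that] by (simp only: mult.assoc)
  qed
  have Hadd: "H (h + h') \<le> H h + H h'" for h h'
    unfolding H_def \<gamma>_def S_def
    by (rule homogeneous_extension_subadditive[OF op conv bdd a w lip nonneg D'])
  obtain G where G: "\<And>x y. \<bar>\<gamma> x - \<gamma> y\<bar> \<le> G * norm (x - y)" using sublinear_lipschitz[OF \<gamma>add \<gamma>hom] by blast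
  obtain M where M: "\<And>x y. \<bar>H x - H y\<bar> \<le> M * norm (x - y)" using sublinear_lipschitz[OF Hadd Hhom] by blast
  have \<gamma>1: "\<gamma> h = 1 \<longleftrightarrow> h \<in> frontier S" for h unfolding \<gamma>_def by (rule convex_gauge_eq_1_iff[OF S])
  have frD: "frontier S \<subseteq> cball 0 D"
  proof -
    have "closure S \<subseteq> cball 0 D" using D by (intro closure_minimal) auto
    then show ?thesis by (auto simp: frontier_def)
  qed
  define I where "I = {\<gamma>, H} \<times> (Basis :: 'a set) \<times> (\<rat> :: real set) \<times> (UNIV :: nat set)"
  define A where "A = (\<lambda>(f, b, c, m). (+) a ` (frontier S \<inter> kink f b c (1 / real (Suc m))))"
  have cI: "countable I" unfolding I_def by (intro countable_SIGMA countable_rat) (auto simp: countable_finite)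
  have neI: "I \<noteq> {}" unfolding I_def by (auto intro: Rats_0 nonempty_Basis)
  have small: "minkowski_codim2 (A i)" if i: "i \<in> I" for i
  proof -
    obtain f b c m where ie: "i = (f, b, c, m)" by (cases i)
    have f: "f = \<gamma> \<or> f = H" and b: "b \<in> Basis" using i by (auto simp: I_def ie)
    have "minkowski_codim2 (frontier S \<inter> kink f b c (1 / real (Suc m)))"
    proof -
      have E: "frontier S \<inter> kink f b c (1 / real (Suc m)) \<subseteq> {x. \<gamma> x = 1}"
        "frontier S \<inter> kink f b c (1 / real (Suc m)) \<subseteq> cball 0 D" using \<gamma>1 frD by auto
      show ?thesis
        using f
      proof
        assume f: "f = \<gamma>"
        show ?thesis unfolding f by (rule minkowski_codim2_kink[OF G \<gamma>hom G \<gamma>hom b _ _ E[unfolded f]]) auto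
      next
        assume f: "f = H"
        show ?thesis unfolding f by (rule minkowski_codim2_kink[OF M Hhom G \<gamma>hom b _ _ E[unfolded f]]) auto
      qed
    qed
    then show ?thesis unfolding A_def ie by (auto intro: minkowski_codim2_translation)
  qed
  show ?thesis
  proof (rule hausdorff_measure_eq_0[where A = "\<lambda>j. A (from_nat_into I j)"])
    show "minkowski_codim2 (A (from_nat_into I j))" for j by (intro small from_nat_into neI)
    show "frontier U - dom_D_minus U w \<subseteq> (\<Union>j. A (from_nat_into I j))"
    proof
      fix x assume x: "x \<in> frontier U - dom_D_minus U w"
      have xS: "x - a \<in> frontier S" using x unfolding S_def frontier_translation by (auto simp: image_iff)
      have "\<exists>f\<in>{\<gamma>, H}. \<not> (\<exists>q. GDERIV f (x - a) :> q)"
      proof (rule ccontr)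
        assume "\<not> ?thesis"
        then obtain q p where q: "GDERIV \<gamma> (x - a) :> q" and p: "GDERIV H (x - a) :> p" by auto
        have "boundary_differentiable U x"
        proof (rule boundary_differentiable_gauge[OF op conv bdd a _ _ \<gamma>hom _ q])
          show "z \<in> U \<longleftrightarrow> \<gamma> (z - a) < 1" for z
            unfolding \<gamma>_def convex_gauge_less_1_iff[OF S] by (auto simp: S_def image_iff)
        qed (use x xS \<gamma>1 in auto)
        moreover have "w differentiable (at x within frontier U)"
        proof -
          \<comment> \<open>On the frontier the gauge equals 1, so there
            \<open>H (z - a) - L * D\<close> is \<open>w z\<close>; its derivative in the whole
            space restricts to one within the frontier.\<close>
          have "((\<lambda>z. H (z - a) - L * D) has_derivative (\<lambda>h. h \<bullet> p)) (at x within frontier U)"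
          proof -
            have "((\<lambda>z. z - a) has_derivative (\<lambda>h. h)) (at x within frontier U)" by (auto intro!: derivative_eq_intros)
            from has_derivative_compose[OF this p[unfolded gderiv_def]]
            show ?thesis by (auto intro!: derivative_eq_intros)
          qed
          then have "(w has_derivative (\<lambda>h. h \<bullet> p)) (at x within frontier U)"
          proof (rule has_derivative_transform_within[OF _ zero_less_one])
            show "x \<in> frontier U" using x by simp
            fix z assume "z \<in> frontier U"
            then have "z - a \<in> frontier S" unfolding S_def frontier_translation by (auto simp: image_iff)
            then have "\<gamma> (z - a) = 1" using \<gamma>1 by simp
            then show "H (z - a) - L * D = w z" by (simp add: H_def)
          qed
          then show ?thesis by (auto simp: differentiable_def)
        qed
        ultimately have "x \<in> dom_D_minus U w" using x by (auto simp: dom_D_minus_def dom_D_frontier_def)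
        then show False using x by simp
      qed
      then obtain f where f: "f \<in> {\<gamma>, H}" "\<not> (\<exists>q. GDERIV f (x - a) :> q)" by blast
      have "convex_on UNIV f" using f(1) sublinear_convex_on[OF \<gamma>add \<gamma>hom] sublinear_convex_on[OF Hadd Hhom] by auto
      from convex_gderiv_or_kink[OF this, of "x - a"] f(2)
      obtain b c m where bcm: "b \<in> Basis" "c \<in> \<rat>" "x - a \<in> kink f b c (1 / real (Suc m))" by blast
      have "(f, b, c, m) \<in> I" using f(1) bcm by (simp add: I_def)
      moreover have "x \<in> A (f, b, c, m)" using bcm(3) xS unfolding A_def prod.case by (intro image_eqI[of _ _ "x - a"]) simp_all
      moreover obtain j where "from_nat_into I j = (f, b, c, m)"
        using from_nat_into_surj[OF cI \<open>(f, b, c, m) \<in> I\<close>] by blast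
      ultimately show "x \<in> (\<Union>j. A (from_nat_into I j))" by (metis UNIV_I UN_I)
    qed
  qed
qed

section \<open>Gradients almost everywhere\<close>

text \<open>\<open>g - f\<close> has a local minimum at \<open>x\<close>. This is how gradients of
  envelopes, maxima and support planes are identified at touching points.\<close>

lemma GDERIV_touching_unique:
  fixes f g :: "'a::real_inner \<Rightarrow> real"
  assumes f: "GDERIV f x :> D" and g: "GDERIV g x :> E" and eq: "f x = g x"
    and le: "open S" "x \<in> S" "\<And>z. z \<in> S \<Longrightarrow> f z \<le> g z"
  shows "D = E"
proof -
  have "GDERIV (\<lambda>z. g z - f z) x :> E - D" by (rule GDERIV_diff[OF g f])
  then have der: "((\<lambda>z. g z - f z) has_derivative (\<lambda>h. h \<bullet> (E - D))) (at x)" by (simp add: gderiv_def)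
  have "\<forall>z\<in>S. g x - f x \<le> g z - f z" using le eq by auto
  then have "(\<lambda>h. h \<bullet> (E - D)) = (\<lambda>h. 0)"
    by (intro differential_zero_maxmin[OF le(2,1) der] disjI2)
  then have "(E - D) \<bullet> (E - D) = 0" by metis
  then show ?thesis by simp
qed

lemma GDERIV_unique:
  fixes f :: "'a::real_inner \<Rightarrow> real"
  shows "GDERIV f x :> D \<Longrightarrow> GDERIV f x :> E \<Longrightarrow> D = E"
  by (rule GDERIV_touching_unique[of f x D f E UNIV]) auto

lemma grad_eq: "GDERIV f x :> D \<Longrightarrow> grad f x = D"
  unfolding grad_def using GDERIV_unique by (intro the_equality)

lemma GDERIV_cong_open:
  fixes f g :: "'a::real_inner \<Rightarrow> real"
  assumes "open S" "x \<in> S" "\<And>z. z \<in> S \<Longrightarrow> f z = g z"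
  shows "GDERIV f x :> D \<longleftrightarrow> GDERIV g x :> D"
  unfolding gderiv_def using assms by (auto intro: has_derivative_transform_within_open[of _ _ _ _ S])

lemma grad_cong_open:
  fixes f g :: "'a::real_inner \<Rightarrow> real"
  assumes "open S" "x \<in> S" "\<And>z. z \<in> S \<Longrightarrow> f z = g z"
  shows "grad f x = grad g x"
proof -
  have "gderiv f x = gderiv g x" using GDERIV_cong_open[of S x f g] assms by (intro ext) auto
  then show ?thesis by (simp add: grad_def)
qed

lemma GDERIV_affine: "GDERIV (\<lambda>z. y \<bullet> z - s) x :> y"
proof -
  have "((\<lambda>z. y \<bullet> z - s) has_derivative (\<lambda>h. y \<bullet> h)) (at x)"
    by (auto intro!: derivative_eq_intros)
  then show ?thesis by (simp add: gderiv_def inner_commute)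
qed

lemma convex_on_GDERIV_subgradient:
  fixes f :: "'a::euclidean_space \<Rightarrow> real"
  assumes f: "convex_on S f" and S: "open S" and x: "x \<in> S" and D: "GDERIV f x :> D" and z: "z \<in> S"
  shows "f z \<ge> f x + D \<bullet> (z - x)"
proof -
  obtain q where q: "\<And>z. z \<in> S \<Longrightarrow> f z \<ge> f x + q \<bullet> (z - x)" using convex_on_subgradient[OF f S x] by blast
  have "q = D"
  proof (rule GDERIV_touching_unique[OF GDERIV_affine[of q "q \<bullet> x - f x"] D _ S x])
    fix z assume "z \<in> S"
    then show "q \<bullet> z - (q \<bullet> x - f x) \<le> f z" using q[of z] by (simp add: inner_diff_right)
  qed simp
  then show ?thesis using q[OF z] by simp
qed

section \<open>Suprema of affine functions and contact planes\<close>

definition affine_sup :: "('a::real_inner \<times> real) set \<Rightarrow> 'a \<Rightarrow> real" where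
  "affine_sup P x = (SUP p\<in>P. fst p \<bullet> x - snd p)"

context
  fixes P :: "('a::euclidean_space \<times> real) set" and R B :: real and x0 :: 'a
  assumes ne: "P \<noteq> {}" and R: "\<And>p. p \<in> P \<Longrightarrow> norm (fst p) \<le> R"
    and B: "\<And>p. p \<in> P \<Longrightarrow> fst p \<bullet> x0 - snd p \<le> B"
begin

lemma affine_sup_bdd_above: "bdd_above ((\<lambda>p. fst p \<bullet> x - snd p) ` P)"
proof (rule bdd_aboveI2)
  fix p assume p: "p \<in> P"
  have "fst p \<bullet> (x - x0) \<le> norm (fst p) * norm (x - x0)" by (rule norm_cauchy_schwarz)
  also have "\<dots> \<le> R * norm (x - x0)" using R[OF p] by (intro mult_right_mono) auto
  finally show "fst p \<bullet> x - snd p \<le> B + R * norm (x - x0)" using B[OF p] by (simp add: inner_diff_right)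
qed

lemma affine_sup_upper: "p \<in> P \<Longrightarrow> fst p \<bullet> x - snd p \<le> affine_sup P x"
  unfolding affine_sup_def by (rule cSUP_upper[OF _ affine_sup_bdd_above])

lemma affine_sup_least: "(\<And>p. p \<in> P \<Longrightarrow> fst p \<bullet> x - snd p \<le> c) \<Longrightarrow> affine_sup P x \<le> c"
  unfolding affine_sup_def by (rule cSUP_least[OF ne])

lemma affine_sup_lipschitz: "\<bar>affine_sup P x - affine_sup P y\<bar> \<le> R * norm (x - y)"
proof -
  have *: "affine_sup P x \<le> affine_sup P y + R * norm (x - y)" for x y
  proof (rule affine_sup_least)
    fix p assume p: "p \<in> P"
    have "fst p \<bullet> (x - y) \<le> norm (fst p) * norm (x - y)" by (rule norm_cauchy_schwarz)
    also have "\<dots> \<le> R * norm (x - y)" using R[OF p] by (intro mult_right_mono) auto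
    finally show "fst p \<bullet> x - snd p \<le> affine_sup P y + R * norm (x - y)"
      using affine_sup_upper[OF p, of y] by (simp add: inner_diff_right)
  qed
  show ?thesis using *[of x y] *[of y x] by (simp add: norm_minus_commute abs_le_iff)
qed

lemma convex_on_affine_sup: "convex_on UNIV (affine_sup P)"
proof (rule convex_onI)
  fix t :: real and x y assume t: "0 < t" "t < 1"
  show "affine_sup P ((1 - t) *\<^sub>R x + t *\<^sub>R y) \<le> (1 - t) * affine_sup P x + t * affine_sup P y"
  proof (rule affine_sup_least)
    fix p assume p: "p \<in> P"
    have "fst p \<bullet> ((1 - t) *\<^sub>R x + t *\<^sub>R y) - snd p = (1 - t) * (fst p \<bullet> x - snd p) + t * (fst p \<bullet> y - snd p)"
      by (simp add: inner_add_right algebra_simps)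
    also have "\<dots> \<le> (1 - t) * affine_sup P x + t * affine_sup P y"
      using affine_sup_upper[OF p] t by (intro add_mono mult_left_mono) auto
    finally show "fst p \<bullet> ((1 - t) *\<^sub>R x + t *\<^sub>R y) - snd p \<le> \<dots>" .
  qed
qed simp

end

text \<open>When nonempty, the family has a supremum that is convex and \<open>R\<close>-Lipschitz
  on the whole space and agrees with \<open>u\<close> wherever \<open>u\<close> has a subgradient of
  norm at most \<open>R\<close>. It serves as a global substitute for \<open>u\<close> in
  differentiability questions and, for the minimizer, is the least convex extension.\<close>

definition contact_planes :: "'a::real_inner set \<Rightarrow> ('a \<Rightarrow> real) \<Rightarrow> real \<Rightarrow> ('a \<times> real) set" where
  "contact_planes S u R = {(y, y \<bullet> z - u z) | y z. z \<in> S \<and> norm y \<le> R \<and> (\<forall>x\<in>S. u z + y \<bullet> (x - z) \<le> u x)}"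

lemma contact_planes_norm: "p \<in> contact_planes S u R \<Longrightarrow> norm (fst p) \<le> R"
  by (auto simp: contact_planes_def)

lemma contact_planes_le: "p \<in> contact_planes S u R \<Longrightarrow> x \<in> S \<Longrightarrow> fst p \<bullet> x - snd p \<le> u x"
  by (auto simp: contact_planes_def inner_diff_right algebra_simps)

lemma contact_planes_sup_eq:
  fixes u :: "'a::euclidean_space \<Rightarrow> real"
  assumes z: "z \<in> S" and y: "norm y \<le> R" "\<And>x. x \<in> S \<Longrightarrow> u z + y \<bullet> (x - z) \<le> u x"
  shows "affine_sup (contact_planes S u R) z = u z"
proof -
  have p: "(y, y \<bullet> z - u z) \<in> contact_planes S u R" using assms by (auto simp: contact_planes_def)
  then have ne: "contact_planes S u R \<noteq> {}" by blast
  show ?thesis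
  proof (rule antisym)
    show "affine_sup (contact_planes S u R) z \<le> u z"
      by (rule affine_sup_least[OF ne contact_planes_norm contact_planes_le[OF _ z]]) (use z in \<open>auto intro: contact_planes_le\<close>)
    show "u z \<le> affine_sup (contact_planes S u R) z"
      using affine_sup_upper[OF ne contact_planes_norm contact_planes_le[OF _ z] p, where x = z] by simp
  qed
qed

lemma convex_on_locally_bounded_subgradients:
  fixes u :: "'a::euclidean_space \<Rightarrow> real"
  assumes u: "convex_on S u" and S: "open S" and x: "x \<in> S"
  obtains \<rho> K where "\<rho> > 0" "ball x \<rho> \<subseteq> S"
    "\<And>z y. z \<in> ball x \<rho> \<Longrightarrow> (\<And>z'. z' \<in> S \<Longrightarrow> u z + y \<bullet> (z' - z) \<le> u z') \<Longrightarrow> norm y \<le> K"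
proof -
  obtain r where r: "r > 0" "cball x r \<subseteq> S" using S x open_contains_cball by blast
  obtain M where M: "\<And>z. z \<in> cball x r \<Longrightarrow> \<bar>u z\<bar> \<le> M" using convex_on_bounded_on_cball[OF u S r(2)] by blast
  show thesis
  proof (rule that[of "r / 2" "4 * M / r"])
    \<comment> \<open>From a point of the half ball a step of length \<open>r / 2\<close> along
      \<open>y\<close> stays where \<open>u\<close> is bounded by \<open>M\<close>, and over it
      \<open>u\<close> rises by at least \<open>r / 2 * norm y\<close>; hence the bound
      \<open>4 * M / r\<close>.\<close>
    show "r / 2 > 0" using r by simp
    show "ball x (r / 2) \<subseteq> S" using r(2) r(1) by (intro order_trans[OF _ r(2)]) auto
    fix z y assume z: "z \<in> ball x (r / 2)" and y: "\<And>z'. z' \<in> S \<Longrightarrow> u z + y \<bullet> (z' - z) \<le> u z'"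
    have zr: "z \<in> cball x r" using z r by auto
    show "norm y \<le> 4 * M / r"
    proof (cases "y = 0")
      case True
      then show ?thesis using M[OF zr] r by simp
    next
      case False
      define z' where "z' = z + (r / 2 / norm y) *\<^sub>R y"
      have "dist z z' = r / 2" using False r by (simp add: z'_def dist_norm)
      then have z'r: "z' \<in> cball x r" using z dist_triangle[of x z' z] by simp
      have "y \<bullet> (z' - z) = r / 2 * norm y" using False by (simp add: z'_def dot_square_norm power2_eq_square)
      then have "u z + r / 2 * norm y \<le> u z'" using y[of z'] z'r r(2) by auto
      then have "r / 2 * norm y \<le> 2 * M" using M[OF zr] M[OF z'r] by simp
      then show ?thesis using r by (simp add: field_simps)
    qed
  qed
qed

text \<open>The slopes of \<open>u\<close> may blow up at the frontier of \<open>S\<close>, so no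
  single Lipschitz extension is available. Near each point, however, \<open>u\<close> agrees with
  the supremum of its contact planes of slope at most \<open>n\<close> for some \<open>n\<close>,
  and there are countably many of these.\<close>

lemma convex_on_AE_GDERIV:
  fixes u :: "'a::euclidean_space \<Rightarrow> real"
  assumes u: "convex_on S u" and S: "open S"
  shows "AE x in lborel. x \<in> S \<longrightarrow> (\<exists>D. GDERIV u x :> D)"
proof -
  define U where "U n = affine_sup (contact_planes S u (real n))" for n :: nat
  \<comment> \<open>Without contact planes the supremum is over an empty set and unspecified, so
    such \<open>n\<close> contribute no exceptional points.\<close>
  define N where "N n = (if contact_planes S u (real n) = {} then {} else {x. \<not> (\<exists>D. GDERIV (U n) x :> D)})" for n
  have "negligible (N n)" for n
  proof (cases "contact_planes S u (real n) = {}")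
    case False
    then obtain z0 where z0: "z0 \<in> S" by (auto simp: contact_planes_def)
    note * = False contact_planes_norm contact_planes_le[OF _ z0]
    show ?thesis using False convex_lipschitz_negligible_nondiff[OF convex_on_affine_sup[OF *] affine_sup_lipschitz[OF *]]
      by (simp add: N_def U_def)
  qed (simp add: N_def)
  then have "negligible (\<Union>n. N n)" by (rule negligible_Union_nat)
  then have "AE x in lebesgue. x \<notin> (\<Union>n. N n)" by (intro AE_not_in) (simp add: negligible_iff_null_sets)
  then have "AE x in lborel. x \<notin> (\<Union>n. N n)" by (simp only: AE_completion_iff)
  then show ?thesis
  proof eventually_elim
    case (elim x)
    show "x \<in> S \<longrightarrow> (\<exists>D. GDERIV u x :> D)"
    proof
      assume x: "x \<in> S"
      obtain \<rho> K where \<rho>: "\<rho> > 0" "ball x \<rho> \<subseteq> S"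
        and K: "\<And>z y. z \<in> ball x \<rho> \<Longrightarrow> (\<And>z'. z' \<in> S \<Longrightarrow> u z + y \<bullet> (z' - z) \<le> u z') \<Longrightarrow> norm y \<le> K"
        using convex_on_locally_bounded_subgradients[OF u S x] by blast
      obtain n where n: "K \<le> real n" using real_arch_simple by blast
      have eq: "U n z = u z" if z: "z \<in> ball x \<rho>" for z
      proof -
        have zS: "z \<in> S" using z \<rho> by blast
        obtain y where y: "\<And>z'. z' \<in> S \<Longrightarrow> u z + y \<bullet> (z' - z) \<le> u z'" using convex_on_subgradient[OF u S zS] by blast
        show ?thesis unfolding U_def using K[OF z y] n by (intro contact_planes_sup_eq[OF zS _ y]) auto
      qed
      have "contact_planes S u (real n) \<noteq> {}"
      proof -
        have xb: "x \<in> ball x \<rho>" using \<rho> by simp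
        obtain y where y: "\<And>z'. z' \<in> S \<Longrightarrow> u x + y \<bullet> (z' - x) \<le> u z'" using convex_on_subgradient[OF u S x] by blast
        have "(y, y \<bullet> x - u x) \<in> contact_planes S u (real n)" using y K[OF xb y] n x by (auto simp: contact_planes_def)
        then show ?thesis by blast
      qed
      then obtain D where "GDERIV (U n) x :> D" using elim by (auto simp: N_def)
      then have "GDERIV u x :> D" using GDERIV_cong_open[of "ball x \<rho>" x "U n" u D] eq \<rho> by auto
      then show "\<exists>D. GDERIV u x :> D" ..
    qed
  qed
qed

text \<open>\<open>grad\<close> is a definite description and arbitrary where no derivative exists,
  so measurability is obtained only for an almost everywhere equal function, the limit of difference
  quotients along the axes.\<close>

lemma grad_AE_borel_measurable:
  fixes u :: "'a::euclidean_space \<Rightarrow> real"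
  assumes S: "open S" and cont: "continuous_on S u" and ae: "AE x in lborel. x \<in> S \<longrightarrow> (\<exists>D. GDERIV u x :> D)"
  obtains G :: "'a \<Rightarrow> 'a" where "G \<in> borel_measurable borel" "AE x in lborel. x \<in> S \<longrightarrow> grad u x = G x"
proof -
  \<comment> \<open>The quotient is used only where both evaluation points lie in \<open>S\<close>.
    For each point of the open set \<open>S\<close> this holds for all large \<open>k\<close>, so
    the cutoff disappears in the limit.\<close>
  define T where "T b k = S \<inter> (\<lambda>x. x + (1 / real (Suc k)) *\<^sub>R b) -` S" for b :: 'a and k :: nat
  define Q where "Q b k x = real (Suc k) * (u (x + (1 / real (Suc k)) *\<^sub>R b) - u x)" for b k x
  define F where "F k x = (\<Sum>b\<in>Basis. (indicator (T b k) x *\<^sub>R Q b k x) *\<^sub>R b)" for k x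
  have opT: "open (T b k)" for b k
    unfolding T_def by (intro open_Int S open_vimage continuous_intros)
  have *: "(\<lambda>x. indicator (T b k) x *\<^sub>R Q b k x) \<in> borel_measurable borel" for b k
  proof -
    have "continuous_on (T b k) (Q b k)" unfolding Q_def
      by (intro continuous_intros continuous_on_compose2[OF cont] continuous_on_subset[OF cont]) (auto simp: T_def)
    then show ?thesis by (intro borel_measurable_continuous_on_indicator) (auto simp: opT)
  qed
  have "F k \<in> borel_measurable borel" for k
    unfolding F_def by (rule borel_measurable_sum) (rule borel_measurable_scaleR[OF * borel_measurable_const])
  then have meas: "(\<lambda>x. lim (\<lambda>k. F k x)) \<in> borel_measurable borel" by measurable
  have "AE x in lborel. x \<in> S \<longrightarrow> grad u x = lim (\<lambda>k. F k x)"
    using ae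
  proof eventually_elim
    case (elim x)
    show ?case
    proof
      assume x: "x \<in> S"
      then obtain D where D: "GDERIV u x :> D" using elim by blast
      have "(\<lambda>k. (indicator (T b k) x *\<^sub>R Q b k x) *\<^sub>R b) \<longlonglongrightarrow> (D \<bullet> b) *\<^sub>R b" for b
      proof -
        have tends: "(\<lambda>k. 1 / real (Suc k)) \<longlonglongrightarrow> 0" using LIMSEQ_inverse_real_of_nat by (simp add: inverse_eq_divide)
        have "((\<lambda>t. u (x + t *\<^sub>R b)) has_derivative (\<lambda>t. (t *\<^sub>R b) \<bullet> D)) (at 0)"
        proof -
          have "((\<lambda>t. x + t *\<^sub>R b) has_derivative (\<lambda>t. t *\<^sub>R b)) (at 0)" by (auto intro!: derivative_eq_intros)
          moreover have "(u has_derivative (\<lambda>h. h \<bullet> D)) (at (x + 0 *\<^sub>R b))" using D by (simp add: gderiv_def)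
          ultimately show ?thesis by (rule has_derivative_compose)
        qed
        then have "((\<lambda>t. u (x + t *\<^sub>R b)) has_real_derivative (D \<bullet> b)) (at 0)"
          unfolding has_field_derivative_def by (simp add: inner_commute mult.commute[of _ "b \<bullet> D"] mult_commute_abs)
        then have "(\<lambda>t. (u (x + t *\<^sub>R b) - u x) / t) \<midarrow>0\<rightarrow> D \<bullet> b" by (simp add: DERIV_def)
        moreover have "filterlim (\<lambda>k. 1 / real (Suc k)) (at 0) sequentially"
          using tends by (auto simp: filterlim_at)
        ultimately have "(\<lambda>k. (u (x + (1 / real (Suc k)) *\<^sub>R b) - u x) / (1 / real (Suc k))) \<longlonglongrightarrow> D \<bullet> b"
          by (rule filterlim_compose)
        then have Q: "(\<lambda>k. Q b k x) \<longlonglongrightarrow> D \<bullet> b" by (simp add: Q_def mult.commute)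
        have "(\<lambda>k. x + (1 / real (Suc k)) *\<^sub>R b) \<longlonglongrightarrow> x + 0 *\<^sub>R b" by (intro tendsto_intros tends)
        then have "eventually (\<lambda>k. x + (1 / real (Suc k)) *\<^sub>R b \<in> S) sequentially"
          using S x by (intro topological_tendstoD) auto
        then have "eventually (\<lambda>k. Q b k x = indicator (T b k) x *\<^sub>R Q b k x) sequentially"
          by eventually_elim (use x in \<open>simp add: T_def\<close>)
        then have "(\<lambda>k. indicator (T b k) x *\<^sub>R Q b k x) \<longlonglongrightarrow> D \<bullet> b" using Q by (rule Lim_transform_eventually[rotated])
        then show ?thesis by (intro tendsto_intros)
      qed
      then have "(\<lambda>k. F k x) \<longlonglongrightarrow> (\<Sum>b\<in>Basis. (D \<bullet> b) *\<^sub>R b)" unfolding F_def by (intro tendsto_sum)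
      then have "(\<lambda>k. F k x) \<longlonglongrightarrow> D" by (simp add: euclidean_representation)
      then show "grad u x = lim (\<lambda>k. F k x)" using grad_eq[OF D] by (simp add: limI)
    qed
  qed
  then show thesis using that meas by blast
qed

section \<open>Regularity of the minimizer\<close>

abbreviation energy_density :: "('a::euclidean_space \<Rightarrow> real) \<Rightarrow> 'a \<Rightarrow> real" where
  "energy_density v x \<equiv> 1/2 * (norm (grad v x - x))\<^sup>2 + v x"

text \<open>Adding integrals and comparing them strictly requires a measurable integrand, which the
  energy density is only up to a null set.\<close>

lemma energy_borel_density:
  fixes v :: "'a::euclidean_space \<Rightarrow> real"
  assumes U: "open U" and v: "convex_on U v"
  obtains F where "F \<in> borel_measurable borel" "AE x in lborel. x \<in> U \<longrightarrow> F x = energy_density v x"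
    "energy U v = (\<integral>\<^sup>+x. ennreal (F x) * indicator U x \<partial>lborel)"
proof -
  have cont: "continuous_on U v" by (rule convex_on_continuous[OF U v])
  obtain G where G: "G \<in> borel_measurable borel" "AE x in lborel. x \<in> U \<longrightarrow> grad v x = G x"
    using grad_AE_borel_measurable[OF U cont convex_on_AE_GDERIV[OF v U]] by blast
  define F where "F x = 1/2 * (norm (G x - x))\<^sup>2 + indicator U x *\<^sub>R v x" for x
  have "(\<lambda>x. indicator U x *\<^sub>R v x) \<in> borel_measurable borel"
    by (intro borel_measurable_continuous_on_indicator cont borel_open U)
  moreover note G(1)[measurable]
  ultimately have "F \<in> borel_measurable borel" unfolding F_def by measurable
  moreover have ae: "AE x in lborel. x \<in> U \<longrightarrow> F x = energy_density v x"
    using G(2) by eventually_elim (auto simp: F_def)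
  moreover have "energy U v = (\<integral>\<^sup>+x. ennreal (F x) * indicator U x \<partial>lborel)"
    unfolding energy_def
  proof (rule nn_integral_cong_AE)
    show "AE x in lborel. ennreal (energy_density v x) * indicator U x = ennreal (F x) * indicator U x"
      using ae by eventually_elim (auto simp: indicator_def)
  qed
  ultimately show thesis by (rule that)
qed

text \<open>With \<open>v1\<close> of least energy and \<open>v2\<close> a competitor of almost
  everywhere smaller or equal density, a strict drop on a set of positive measure would lower the
  finite integral.\<close>

lemma energy_density_AE_le:
  fixes v1 v2 :: "'a::euclidean_space \<Rightarrow> real"
  assumes U: "open U" and v: "convex_on U v1" "convex_on U v2" and nonneg: "\<And>x. x \<in> U \<Longrightarrow> 0 \<le> v2 x"
    and le: "energy U v1 \<le> energy U v2" and fin: "energy U v1 \<noteq> \<infinity>"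
    and ae: "AE x in lborel. x \<in> U \<longrightarrow> energy_density v2 x \<le> energy_density v1 x"
  shows "AE x in lborel. x \<in> U \<longrightarrow> energy_density v1 x \<le> energy_density v2 x"
proof -
  obtain F1 where F1: "F1 \<in> borel_measurable borel" "AE x in lborel. x \<in> U \<longrightarrow> F1 x = energy_density v1 x"
    "energy U v1 = (\<integral>\<^sup>+x. ennreal (F1 x) * indicator U x \<partial>lborel)"
    using energy_borel_density[OF U v(1)] by blast
  obtain F2 where F2: "F2 \<in> borel_measurable borel" "AE x in lborel. x \<in> U \<longrightarrow> F2 x = energy_density v2 x"
    "energy U v2 = (\<integral>\<^sup>+x. ennreal (F2 x) * indicator U x \<partial>lborel)"
    using energy_borel_density[OF U v(2)] by blast
  have [measurable]: "U \<in> sets borel" using U by simp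
  note [measurable] = F1(1) F2(1)
  have mono: "AE x in lborel. ennreal (F2 x) * indicator U x \<le> ennreal (F1 x) * indicator U x"
    using ae F1(2) F2(2) by eventually_elim (auto simp: indicator_def intro: ennreal_leI)
  have "AE x in lborel. ennreal (F1 x) * indicator U x \<le> ennreal (F2 x) * indicator U x"
  proof (rule ccontr)
    assume not: "\<not> ?thesis"
    have "energy U v2 \<le> energy U v1" unfolding F1(3) F2(3) by (rule nn_integral_mono_AE[OF mono])
    then have "energy U v2 \<noteq> \<infinity>" using fin by (auto simp: top_unique)
    then have "energy U v2 < energy U v1" unfolding F1(3) F2(3)
      by (intro nn_integral_less mono not) (simp_all add: measurable_lborel1)
    then show False using le by simp
  qed
  then show ?thesis using F1(2) F2(2)
  proof eventually_elim
    case (elim x)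
    show ?case
    proof
      assume x: "x \<in> U"
      then have "energy_density v2 x \<ge> 0" using nonneg by simp
      then show "energy_density v1 x \<le> energy_density v2 x" using elim x by (simp add: ennreal_le_iff)
    qed
  qed
qed

text \<open>Gain and loss stand as added terms on opposite sides, so that no subtraction of extended
  nonnegative numbers occurs.\<close>

lemma energy_perturbation_le:
  fixes v1 v2 :: "'a::euclidean_space \<Rightarrow> real"
  assumes U: "open U" and v: "convex_on U v1" "convex_on U v2" and nonneg: "\<And>x. x \<in> U \<Longrightarrow> 0 \<le> v1 x" "\<And>x. x \<in> U \<Longrightarrow> 0 \<le> v2 x"
    and AB: "A \<in> sets borel" "B \<in> sets borel" and "A \<subseteq> U" "B \<subseteq> U" and "0 \<le> \<epsilon>" "0 \<le> C"
    and ae: "AE x in lborel. x \<in> U \<longrightarrow> energy_density v2 x + \<epsilon> * indicator A x \<le> energy_density v1 x + C * indicator B x"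
  shows "energy U v2 + ennreal \<epsilon> * emeasure lborel A \<le> energy U v1 + ennreal C * emeasure lborel B"
proof -
  obtain F1 where F1: "F1 \<in> borel_measurable borel" "AE x in lborel. x \<in> U \<longrightarrow> F1 x = energy_density v1 x"
    "energy U v1 = (\<integral>\<^sup>+x. ennreal (F1 x) * indicator U x \<partial>lborel)"
    using energy_borel_density[OF U v(1)] by blast
  obtain F2 where F2: "F2 \<in> borel_measurable borel" "AE x in lborel. x \<in> U \<longrightarrow> F2 x = energy_density v2 x"
    "energy U v2 = (\<integral>\<^sup>+x. ennreal (F2 x) * indicator U x \<partial>lborel)"
    using energy_borel_density[OF U v(2)] by blast
  have [measurable]: "U \<in> sets borel" using U by simp
  note [measurable] = F1(1) F2(1) AB
  have "energy U v2 + ennreal \<epsilon> * emeasure lborel A = (\<integral>\<^sup>+x. ennreal (F2 x) * indicator U x + ennreal \<epsilon> * indicator A x \<partial>lborel)"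
    unfolding F2(3) using AB by (subst nn_integral_add) (simp_all add: nn_integral_cmult_indicator)
  also have "\<dots> \<le> (\<integral>\<^sup>+x. ennreal (F1 x) * indicator U x + ennreal C * indicator B x \<partial>lborel)"
  proof (rule nn_integral_mono_AE)
    show "AE x in lborel. ennreal (F2 x) * indicator U x + ennreal \<epsilon> * indicator A x
        \<le> ennreal (F1 x) * indicator U x + ennreal C * indicator B x"
      using ae F1(2) F2(2)
    proof eventually_elim
      case (elim x)
      show ?case
      proof (cases "x \<in> U")
        case True
        have pos: "F1 x \<ge> 0" "F2 x \<ge> 0" using elim True nonneg by simp_all
        have "ennreal (F2 x) + ennreal \<epsilon> * indicator A x = ennreal (F2 x + \<epsilon> * indicator A x)"
          using pos \<open>0 \<le> \<epsilon>\<close> by (simp add: indicator_def ennreal_plus)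
        also have "\<dots> \<le> ennreal (F1 x + C * indicator B x)" using elim True by (intro ennreal_leI) simp
        also have "\<dots> = ennreal (F1 x) + ennreal C * indicator B x"
          using pos \<open>0 \<le> C\<close> by (simp add: indicator_def ennreal_plus)
        finally show ?thesis using True by simp
      next
        case False
        then show ?thesis using \<open>A \<subseteq> U\<close> by (auto simp: indicator_def)
      qed
    qed
  qed
  also have "\<dots> = energy U v1 + ennreal C * emeasure lborel B"
    unfolding F1(3) using AB by (subst nn_integral_add) (simp_all add: nn_integral_cmult_indicator)
  finally show ?thesis .
qed

lemma energy_zero_finite:
  fixes U :: "'a::euclidean_space set"
  assumes "bounded U" "open U"
  shows "energy U (\<lambda>_. 0) \<noteq> \<infinity>"
proof -
  obtain D where D: "\<And>x. x \<in> U \<Longrightarrow> norm x \<le> D" using assms(1) unfolding bounded_iff by blast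
  have g: "grad (\<lambda>_. 0) x = 0" for x :: 'a by (rule grad_eq[OF GDERIV_const])
  have "energy U (\<lambda>_. 0) \<le> (\<integral>\<^sup>+x. ennreal (1/2 * D\<^sup>2) * indicator U x \<partial>lborel)"
    unfolding energy_def by (intro nn_integral_mono) (auto simp: g indicator_def D intro!: ennreal_leI power_mono)
  also have "\<dots> = ennreal (1/2 * D\<^sup>2) * emeasure lborel U"
    using assms by (intro nn_integral_cmult_indicator) simp
  also have "\<dots> < \<infinity>" using emeasure_bounded_finite[OF assms(1)] by (simp add: ennreal_mult_less_top)
  finally show ?thesis by simp
qed

lemma admissibleI_convex_UNIV:
  assumes w: "convex_on UNIV w" and "convex U" and "\<And>x. x \<in> closure U \<Longrightarrow> 0 \<le> w x"
  shows "w \<in> admissible U"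
proof -
  have "continuous_on UNIV w" by (rule convex_on_continuous[OF open_UNIV w])
  then have "(w \<longlongrightarrow> w x) (at x within closure U)" for x
    by (meson UNIV_I continuous_on_def subset_UNIV tendsto_within_subset)
  then have "lsc_on (closure U) w" unfolding lsc_on_def by (auto dest: order_tendstoD)
  then show ?thesis unfolding admissible_def
    using convex_on_subset[OF w subset_UNIV convex_closure[OF assms(2)]] assms(3) by simp
qed

section \<open>A priori bounds for the minimizer and its least convex extension\<close>

context
  fixes U :: "'a::euclidean_space set" and u :: "'a \<Rightarrow> real" and D :: real
  assumes bdd: "bounded U" and op: "open U" and conv: "convex U"
    and min: "is_arg_min (energy U) (\<lambda>v. v \<in> admissible U) u"
    and D: "\<And>x. x \<in> U \<Longrightarrow> norm x \<le> D" and D0: "D \<ge> 0"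
begin

lemma minimizer_convex_on: "convex_on U u"
  using min conv by (auto simp: is_arg_min_def admissible_def intro: convex_on_subset[OF _ closure_subset])

lemma minimizer_nonneg: "x \<in> U \<Longrightarrow> 0 \<le> u x"
  using min closure_subset[of U] by (auto simp: is_arg_min_def admissible_def)

lemma minimizer_energy_le: "v \<in> admissible U \<Longrightarrow> energy U u \<le> energy U v"
  using min by (auto simp: is_arg_min_def not_less)

lemma minimizer_energy_finite: "energy U u \<noteq> \<infinity>"
proof -
  have "convex_on UNIV (\<lambda>_::'a. 0::real)" by (rule convex_onI) auto
  then have "(\<lambda>_. 0) \<in> admissible U" by (intro admissibleI_convex_UNIV conv) auto
  then have "energy U u \<le> energy U (\<lambda>_. 0)" by (rule minimizer_energy_le)
  then show ?thesis using energy_zero_finite[OF bdd op] by (auto simp: top_unique)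
qed

lemma minimizer_density_le: "AE x in lborel. x \<in> U \<longrightarrow> energy_density u x \<le> 1/2 * (norm x)\<^sup>2"
proof -
  \<comment> \<open>The planes below \<open>u\<close> that are priced at cost or above. The cap
    \<open>2 * D\<^sup>2\<close> on the price makes the family compact and excludes no tangent plane
    of \<open>u\<close> meeting the cost condition: for such a plane
    \<open>s \<le> norm y * D\<close>, hence \<open>norm y \<le> 2 * D\<close>.\<close>
  define P where "P = {(y, s). 1/2 * (norm y)\<^sup>2 \<le> s \<and> s \<le> 2 * D\<^sup>2 \<and> (\<forall>z\<in>U. y \<bullet> z - s \<le> u z)}"
  have P0: "(0, 0) \<in> P" using minimizer_nonneg by (auto simp: P_def)
  then have ne: "P \<noteq> {}" by blast
  have normP: "norm (fst p) \<le> 2 * D" if "p \<in> P" for p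
  proof -
    have "(norm (fst p))\<^sup>2 \<le> (2 * D)\<^sup>2" using that by (auto simp: P_def power_mult_distrib)
    then show ?thesis by (rule power2_le_imp_le) (use D0 in simp)
  qed
  have sP: "0 \<le> snd p" "snd p \<le> 2 * D\<^sup>2" if "p \<in> P" for p
  proof -
    have "0 \<le> 1/2 * (norm (fst p))\<^sup>2" by simp
    also have "\<dots> \<le> snd p" using that by (auto simp: P_def)
    finally show "0 \<le> snd p" .
    show "snd p \<le> 2 * D\<^sup>2" using that by (auto simp: P_def)
  qed
  have bP: "fst p \<bullet> 0 - snd p \<le> 0" if "p \<in> P" for p using sP[OF that] by simp
  have "compact P"
  proof -
    have "P = {p. 1/2 * (norm (fst p))\<^sup>2 \<le> snd p} \<inter> {p. snd p \<le> 2 * D\<^sup>2} \<inter> (\<Inter>z\<in>U. {p. fst p \<bullet> z - snd p \<le> u z})"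
      by (auto simp: P_def)
    moreover have "closed \<dots>"
      by (intro closed_Int closed_INT ballI closed_Collect_le continuous_intros)
    ultimately have "closed P" by simp
    moreover have "bounded P"
    proof -
      have "P \<subseteq> cball 0 (2 * D) \<times> {0..2 * D\<^sup>2}" using normP sP by force
      then show ?thesis by (rule bounded_subset[OF bounded_Times[OF bounded_cball bounded_closed_interval]])
    qed
    ultimately show ?thesis by (simp add: compact_eq_bounded_closed)
  qed
  define v where "v = affine_sup P"
  note * = ne normP bP
  have conv_v: "convex_on UNIV v" unfolding v_def by (rule convex_on_affine_sup[OF *])
  have v0: "v x \<ge> 0" for x
    using affine_sup_upper[OF * P0, where x = x] by (simp add: v_def)
  have v_le: "v x \<le> u x" if "x \<in> U" for x
    unfolding v_def by (rule affine_sup_least[OF *]) (use that in \<open>auto simp: P_def\<close>)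
  \<comment> \<open>Compactness gives a maximizing plane, whose slope is the gradient of
    \<open>v\<close>; so the density of \<open>v\<close> inherits the cost condition of that
    plane.\<close>
  have attained: "\<exists>p\<in>P. v x = fst p \<bullet> x - snd p" for x
  proof -
    have "continuous_on P (\<lambda>p. fst p \<bullet> x - snd p)" by (intro continuous_intros)
    from continuous_attains_sup[OF \<open>compact P\<close> ne this] obtain p where p: "p \<in> P"
      "\<And>q. q \<in> P \<Longrightarrow> fst q \<bullet> x - snd q \<le> fst p \<bullet> x - snd p" by blast
    have "v x \<le> fst p \<bullet> x - snd p" unfolding v_def by (rule affine_sup_least[OF * p(2)])
    moreover have "fst p \<bullet> x - snd p \<le> v x" unfolding v_def by (rule affine_sup_upper[OF * p(1)])
    ultimately show ?thesis using p(1) by force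
  qed
  have dens: "1/2 * (norm (y - x))\<^sup>2 + (y \<bullet> x - s) = 1/2 * (norm x)\<^sup>2 + (1/2 * (norm y)\<^sup>2 - s)" for x y :: 'a and s
    by (simp add: power2_norm_eq_inner inner_diff_left inner_diff_right inner_commute field_simps)
  have conv_vU: "convex_on U v" by (rule convex_on_subset[OF conv_v subset_UNIV conv])
  have ae: "AE x in lborel. x \<in> U \<longrightarrow> energy_density v x \<le> energy_density u x \<and> energy_density v x \<le> 1/2 * (norm x)\<^sup>2"
    using convex_on_AE_GDERIV[OF minimizer_convex_on op] convex_on_AE_GDERIV[OF conv_vU op]
  proof eventually_elim
    case (elim x)
    show ?case
    proof
      assume x: "x \<in> U"
      obtain y where y: "GDERIV u x :> y" using elim x by blast
      obtain y' where y': "GDERIV v x :> y'" using elim x by blast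
      obtain q t where qt: "(q, t) \<in> P" "v x = q \<bullet> x - t" using attained[of x] by force
      have "q = y'"
      proof (rule GDERIV_touching_unique[OF GDERIV_affine y' _ open_UNIV])
        show "q \<bullet> x - t = v x" using qt by simp
        show "q \<bullet> z - t \<le> v z" for z using affine_sup_upper[OF * qt(1), where x = z] by (simp add: v_def)
      qed simp
      then have "energy_density v x = 1/2 * (norm x)\<^sup>2 + (1/2 * (norm q)\<^sup>2 - t)"
        using grad_eq[OF y'] qt(2) dens[of q x t] by simp
      then have vx: "energy_density v x \<le> 1/2 * (norm x)\<^sup>2" using qt(1) by (auto simp: P_def)
      define s where "s = y \<bullet> x - u x"
      have ux: "energy_density u x = 1/2 * (norm x)\<^sup>2 + (1/2 * (norm y)\<^sup>2 - s)"
        using grad_eq[OF y] dens[of y x s] by (simp add: s_def)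
      have "energy_density v x \<le> energy_density u x"
      \<comment> \<open>If the tangent plane of \<open>u\<close> is sold below cost, the density of
        \<open>u\<close> exceeds half the square of \<open>norm x\<close>, which bounds that of
        \<open>v\<close>. Otherwise the plane belongs to \<open>P\<close>, and \<open>v\<close>
        touches \<open>u\<close> at \<open>x\<close> with the same gradient.\<close>
      proof (cases "1/2 * (norm y)\<^sup>2 \<le> s")
        case False
        then show ?thesis using vx ux by linarith
      next
        case True
        have "y \<bullet> x \<le> norm y * norm x" by (rule norm_cauchy_schwarz)
        also have "\<dots> \<le> norm y * D" using D[OF x] by (intro mult_left_mono) auto
        finally have sD: "s \<le> norm y * D" using minimizer_nonneg[OF x] by (simp add: s_def)
        have "norm y \<le> 2 * D"
        proof (cases "y = 0")
          case False
          have "norm y * norm y \<le> norm y * (2 * D)" using True sD by (simp add: power2_eq_square)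
          then show ?thesis using False by simp
        qed (use D0 in simp)
        then have "norm y * D \<le> 2 * D * D" using D0 by (intro mult_right_mono) auto
        then have "s \<le> 2 * D\<^sup>2" using sD by (simp add: power2_eq_square)
        moreover have "y \<bullet> z - s \<le> u z" if "z \<in> U" for z
          using convex_on_GDERIV_subgradient[OF minimizer_convex_on op x y that] by (simp add: s_def inner_diff_right)
        ultimately have "(y, s) \<in> P" using True by (simp add: P_def)
        from affine_sup_upper[OF * this, where x = x] have "u x \<le> v x" by (simp add: v_def s_def)
        then have eq: "v x = u x" using v_le[OF x] by simp
        have "y' = y" by (rule GDERIV_touching_unique[OF y' y eq op x v_le])
        then show ?thesis using eq grad_eq[OF y] grad_eq[OF y'] by simp
      qed
      then show "energy_density v x \<le> energy_density u x \<and> energy_density v x \<le> 1/2 * (norm x)\<^sup>2" using vx by simp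
    qed
  qed
  have "energy U u \<le> energy U v"
    using v0 by (intro minimizer_energy_le admissibleI_convex_UNIV conv_v conv)
  moreover have "AE x in lborel. x \<in> U \<longrightarrow> energy_density v x \<le> energy_density u x"
    using ae by eventually_elim blast
  ultimately have "AE x in lborel. x \<in> U \<longrightarrow> energy_density u x \<le> energy_density v x"
    by (rule energy_density_AE_le[OF op minimizer_convex_on conv_vU v0 _ minimizer_energy_finite])
  then show ?thesis using ae by eventually_elim force
qed

text \<open>The density bound together with \<open>u \<ge> 0\<close> gives
  \<open>norm y \<le> 2 * D\<close> for almost every gradient \<open>y\<close>. Such points are
  dense, as nonempty open sets are not negligible, and bounded subgradients at nearby points
  accumulate at a subgradient at \<open>x\<close>.\<close>

lemma minimizer_bounded_subgradient:
  assumes x: "x \<in> U"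
  shows "\<exists>y. norm y \<le> 2 * D \<and> (\<forall>z\<in>U. u x + y \<bullet> (z - x) \<le> u z)"
proof -
  define good where "good x \<longleftrightarrow> (\<exists>y. norm y \<le> 2 * D \<and> (\<forall>z\<in>U. u x + y \<bullet> (z - x) \<le> u z))" for x
  have ae: "AE x in lborel. x \<in> U \<longrightarrow> good x"
    using minimizer_density_le convex_on_AE_GDERIV[OF minimizer_convex_on op]
  proof eventually_elim
    case (elim x)
    show ?case
    proof
      assume x: "x \<in> U"
      obtain y where y: "GDERIV u x :> y" using elim x by blast
      have "1/2 * (norm (y - x))\<^sup>2 + u x \<le> 1/2 * (norm x)\<^sup>2" using elim(1) x unfolding grad_eq[OF y] by blast
      then have "(norm (y - x))\<^sup>2 \<le> (norm x)\<^sup>2" using minimizer_nonneg[OF x] by linarith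
      then have "norm (y - x) \<le> norm x" by (rule power2_le_imp_le) simp
      then have "norm y \<le> 2 * D" using norm_triangle_ineq[of "y - x" x] D[OF x] by simp
      then show "good x" unfolding good_def
        using convex_on_GDERIV_subgradient[OF minimizer_convex_on op x y] by blast
    qed
  qed
  have "\<exists>z\<in>U. dist z x < e \<and> good z" if e: "e > 0" for e
  proof (rule ccontr)
    assume not: "\<not> ?thesis"
    have "AE z in lborel. z \<notin> U \<inter> ball x e" using ae by eventually_elim (use not in \<open>auto simp: dist_commute\<close>)
    then have "AE z in lebesgue. z \<notin> U \<inter> ball x e" by (simp only: AE_completion_iff)
    moreover have "U \<inter> ball x e \<in> sets lebesgue" using op by (intro sets_completionI_sets) (simp add: open_Int)
    ultimately have "negligible (U \<inter> ball x e)" unfolding negligible_iff_null_sets by (simp only: AE_iff_null_sets)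
    moreover have "open (U \<inter> ball x e)" "U \<inter> ball x e \<noteq> {}" using op x e by auto
    ultimately show False using open_not_negligible by blast
  qed
  then have "\<forall>n. \<exists>z\<in>U. dist z x < inverse (real (Suc n)) \<and> good z" by (metis inverse_positive_iff_positive of_nat_0_less_iff zero_less_Suc)
  then obtain X where X: "\<And>n. X n \<in> U" "\<And>n. dist (X n) x < inverse (real (Suc n))" "\<And>n. good (X n)" by metis
  obtain Y where Y: "\<And>n. norm (Y n) \<le> 2 * D" "\<And>n z. z \<in> U \<Longrightarrow> u (X n) + Y n \<bullet> (z - X n) \<le> u z"
    using X(3) unfolding good_def by metis
  have "(\<lambda>n. dist (X n) x) \<longlonglongrightarrow> 0"
  proof (rule tendsto_sandwich[OF always_eventually always_eventually tendsto_const LIMSEQ_inverse_real_of_nat])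
    show "\<forall>n. dist (X n) x \<le> inverse (real (Suc n))" by (intro allI less_imp_le X(2))
  qed simp
  then have Xlim: "X \<longlonglongrightarrow> x" by (subst tendsto_dist_iff)
  have "\<exists>l\<in>cball 0 (2 * D). \<exists>r. strict_mono r \<and> (Y \<circ> r) \<longlonglongrightarrow> l"
    by (rule compact_imp_seq_compact[OF compact_cball, unfolded seq_compact_def, THEN spec, THEN mp]) (use Y(1) in simp)
  then obtain y r where y: "y \<in> cball 0 (2 * D)" "strict_mono r" "(Y \<circ> r) \<longlonglongrightarrow> y" by blast
  have "isCont u x" using convex_on_continuous[OF op minimizer_convex_on] op x by (simp add: continuous_on_eq_continuous_at)
  have Xr: "(\<lambda>n. X (r n)) \<longlonglongrightarrow> x" using LIMSEQ_subseq_LIMSEQ[OF Xlim y(2)] by (simp add: o_def)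
  have "u x + y \<bullet> (z - x) \<le> u z" if z: "z \<in> U" for z
  proof (rule LIMSEQ_le_const2)
    show "(\<lambda>n. u (X (r n)) + Y (r n) \<bullet> (z - X (r n))) \<longlonglongrightarrow> u x + y \<bullet> (z - x)"
      using y(3) Xr isCont_tendsto_compose[OF \<open>isCont u x\<close> Xr] by (intro tendsto_intros) (auto simp: o_def)
    show "\<exists>N. \<forall>n\<ge>N. u (X (r n)) + Y (r n) \<bullet> (z - X (r n)) \<le> u z" using Y(2)[OF z] by blast
  qed
  then show ?thesis using y(1) by (intro exI[of _ y]) auto
qed

text \<open>The supremum of the contact planes is least because each plane touches \<open>u\<close>
  at a point of the open set \<open>U\<close>: any convex extension lies above the plane near that
  point, hence everywhere by convexity along segments.\<close>

lemma min_convex_ext_minimizer: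
  assumes ne: "U \<noteq> {}"
  shows "convex_on UNIV (min_convex_ext U u)"
    and "\<bar>min_convex_ext U u x - min_convex_ext U u y\<bar> \<le> 2 * D * norm (x - y)"
    and "z \<in> U \<Longrightarrow> min_convex_ext U u z = u z"
proof -
  define P where "P = contact_planes U u (2 * D)"
  obtain z0 where z0: "z0 \<in> U" using ne by blast
  obtain y0 where y0: "norm y0 \<le> 2 * D" "\<forall>z\<in>U. u z0 + y0 \<bullet> (z - z0) \<le> u z" using minimizer_bounded_subgradient[OF z0] by blast
  have "(y0, y0 \<bullet> z0 - u z0) \<in> P" using z0 y0 by (auto simp: P_def contact_planes_def)
  then have neP: "P \<noteq> {}" by blast
  have * : "P \<noteq> {}" "\<And>p. p \<in> P \<Longrightarrow> norm (fst p) \<le> 2 * D" "\<And>p. p \<in> P \<Longrightarrow> fst p \<bullet> z0 - snd p \<le> u z0"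
    using neP contact_planes_norm contact_planes_le[OF _ z0] unfolding P_def by blast+
  have c: "convex_on UNIV (affine_sup P)" by (rule convex_on_affine_sup[OF *])
  have e: "affine_sup P z = u z" if "z \<in> U" for z
    using minimizer_bounded_subgradient[OF that] contact_planes_sup_eq[OF that] unfolding P_def by blast
  have "min_convex_ext U u = affine_sup P"
    unfolding min_convex_ext_def
  proof (rule Least_equality)
    show "convex_on UNIV (affine_sup P) \<and> (\<forall>x\<in>U. affine_sup P x = u x)" using c e by blast
    fix v assume v: "convex_on UNIV v \<and> (\<forall>x\<in>U. v x = u x)"
    show "affine_sup P \<le> v"
    proof (rule le_funI, rule affine_sup_least[OF *])
      fix x p assume "p \<in> P"
      then obtain y z where p: "p = (y, y \<bullet> z - u z)" and z: "z \<in> U" and y: "\<forall>x\<in>U. u z + y \<bullet> (x - z) \<le> u x"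
        by (auto simp: P_def contact_planes_def)
      obtain r where r: "r > 0" "ball z r \<subseteq> U" using op z open_contains_ball by blast
      \<comment> \<open>Small enough for the point \<open>zt\<close> on the segment from
        \<open>z\<close> to \<open>x\<close> to remain in \<open>U\<close>.\<close>
      define t where "t = min 1 (r / (2 * (norm (x - z) + 1)))"
      have n1: "norm (x - z) + 1 > 0" by (simp add: add_nonneg_pos)
      have t: "0 < t" "t \<le> 1" using r n1 by (auto simp: t_def)
      have "t * norm (x - z) \<le> r / (2 * (norm (x - z) + 1)) * (norm (x - z) + 1)"
        using t n1 r by (intro mult_mono) (auto simp: t_def)
      also have "\<dots> = r / 2" using n1 by (simp add: divide_simps)
      finally have tn: "t * norm (x - z) < r" using r by simp
      define zt where "zt = (1 - t) *\<^sub>R z + t *\<^sub>R x"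
      have ztz: "zt - z = t *\<^sub>R (x - z)" by (simp add: zt_def algebra_simps)
      have "dist z zt = t * norm (x - z)" using t by (simp add: dist_norm norm_minus_commute[of z zt] ztz)
      then have "zt \<in> U" using r tn by auto
      then have "u z + t * (y \<bullet> (x - z)) \<le> v zt" using y v ztz by (metis inner_scaleR_right)
      also have "v zt \<le> (1 - t) * v z + t * v x" unfolding zt_def using v t by (intro convex_onD) auto
      finally have "t * (y \<bullet> (x - z)) \<le> t * (v x - u z)" using v z by (simp add: algebra_simps)
      then have "y \<bullet> (x - z) \<le> v x - u z" using t by simp
      then show "fst p \<bullet> x - snd p \<le> v x" by (simp add: p inner_diff_right)
    qed
  qed
  then show "convex_on UNIV (min_convex_ext U u)"
    "\<bar>min_convex_ext U u x - min_convex_ext U u y\<bar> \<le> 2 * D * norm (x - y)"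
    "z \<in> U \<Longrightarrow> min_convex_ext U u z = u z"
    using c e affine_sup_lipschitz[OF *] by simp_all
qed

end

section \<open>The boundary inequality\<close>

lemma convex_on_max:
  assumes f: "convex_on S f" and g: "convex_on S g"
  shows "convex_on S (\<lambda>x. max (f x) (g x))"
proof (rule convex_onI)
  fix t :: real and x y assume t: "0 < t" "t < 1" and xy: "x \<in> S" "y \<in> S"
  have "f ((1 - t) *\<^sub>R x + t *\<^sub>R y) \<le> (1 - t) * f x + t * f y" "g ((1 - t) *\<^sub>R x + t *\<^sub>R y) \<le> (1 - t) * g x + t * g y"
    using convex_onD[OF f] convex_onD[OF g] t xy by auto
  moreover have "(1 - t) * f x \<le> (1 - t) * max (f x) (g x)" "(1 - t) * g x \<le> (1 - t) * max (f x) (g x)"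
    "t * f y \<le> t * max (f y) (g y)" "t * g y \<le> t * max (f y) (g y)" using t by simp_all
  ultimately show "max (f ((1 - t) *\<^sub>R x + t *\<^sub>R y)) (g ((1 - t) *\<^sub>R x + t *\<^sub>R y))
      \<le> (1 - t) * max (f x) (g x) + t * max (f y) (g y)" by linarith
qed (use f in \<open>simp add: convex_on_def\<close>)

lemma subdiff_norm_le:
  fixes w :: "'a::euclidean_space \<Rightarrow> real"
  assumes lip: "\<And>x y. \<bar>w x - w y\<bar> \<le> L * norm (x - y)" and q: "q \<in> subdiff w x"
  shows "norm q \<le> L"
proof (cases "q = 0")
  case True
  obtain b :: 'a where "b \<in> Basis" using nonempty_Basis by blast
  then show ?thesis using order_trans[OF abs_ge_zero lip[of b 0]] True by simp
next
  case False
  have "w (x + q) \<ge> w x + q \<bullet> (x + q - x)" using q unfolding subdiff_def by blast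
  then have "norm q * norm q \<le> w (x + q) - w x" by (simp add: dot_square_norm power2_eq_square)
  also have "\<dots> \<le> L * norm q" using lip[of "x + q" x] by simp
  finally show ?thesis using False by simp
qed

text \<open>Along the segment from \<open>x0\<close> to a contact point \<open>x1\<close> of the plane \<open>p\<close>, every plane
  touching in the relative interior touches at \<open>x0\<close> as well.\<close>

lemma subdiff_segment_contact:
  fixes w :: "'a::euclidean_space \<Rightarrow> real"
  assumes w: "convex_on UNIV w" and p: "p \<in> subdiff w x0" and x1: "w x1 \<le> w x0 + p \<bullet> (x1 - x0)"
    and \<theta>: "0 < \<theta>" "\<theta> < 1" and q: "q \<in> subdiff w (x0 + \<theta> *\<^sub>R (x1 - x0))"
  shows "q \<in> subdiff w x0" and "w (x0 + \<theta> *\<^sub>R (x1 - x0)) = w x0 + \<theta> * (p \<bullet> (x1 - x0))"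
proof -
  define d where "d = x1 - x0"
  define y where "y = x0 + \<theta> *\<^sub>R d"
  have pz: "w z \<ge> w x0 + p \<bullet> (z - x0)" for z using p unfolding subdiff_def by blast
  have qz: "w z \<ge> w y + q \<bullet> (z - y)" for z using q unfolding subdiff_def y_def d_def by blast
  have w1: "w x1 = w x0 + p \<bullet> d" using pz[of x1] x1 by (simp add: d_def)
  have "y = (1 - \<theta>) *\<^sub>R x0 + \<theta> *\<^sub>R x1" by (simp add: y_def d_def algebra_simps)
  then have "w y \<le> (1 - \<theta>) * w x0 + \<theta> * w x1" using convex_onD[OF w, of \<theta> x0 x1] \<theta> by simp
  then have "w y \<le> w x0 + \<theta> * (p \<bullet> d)" by (simp add: w1 algebra_simps)
  moreover have "w y \<ge> w x0 + \<theta> * (p \<bullet> d)" using pz[of y] by (simp add: y_def)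
  ultimately have wy: "w y = w x0 + \<theta> * (p \<bullet> d)" by simp
  have "x0 - y = - (\<theta> *\<^sub>R d)" "x1 - y = (1 - \<theta>) *\<^sub>R d" by (simp_all add: y_def d_def algebra_simps)
  then have "\<theta> * (p \<bullet> d) \<le> \<theta> * (q \<bullet> d)" "(1 - \<theta>) * (q \<bullet> d) \<le> (1 - \<theta>) * (p \<bullet> d)"
    using qz[of x0] qz[of x1] by (simp_all add: wy w1 left_diff_distrib)
  then have qd: "q \<bullet> d = p \<bullet> d" using \<theta> by simp
  show "q \<in> subdiff w x0" unfolding subdiff_def
  proof (intro CollectI allI)
    fix z
    have "z - y = (z - x0) - \<theta> *\<^sub>R d" by (simp add: y_def)
    then have "q \<bullet> (z - y) = q \<bullet> (z - x0) - \<theta> * (p \<bullet> d)"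
      by (simp only: inner_diff_right[of q "z - x0"] inner_scaleR_right qd)
    then show "w z \<ge> w x0 + q \<bullet> (z - x0)" using qz[of z] wy by linarith
  qed
  show "w (x0 + \<theta> *\<^sub>R (x1 - x0)) = w x0 + \<theta> * (p \<bullet> (x1 - x0))" using wy by (simp add: y_def d_def)
qed

text \<open>Compactness as \<open>s\<close> tends to 0. Counterexamples would converge to a contact
  point \<open>x1\<close> of the plane \<open>p\<close> and to a subgradient \<open>q1\<close> at
  the contracted point. By the segment property \<open>q1\<close> is a subgradient at
  \<open>x0\<close>, so it is \<open>p\<close> shifted backwards along \<open>n\<close>, whereas
  \<open>p + c *\<^sub>R n\<close> is shifted forwards, and the quadratic term separates the
  two.\<close>

lemma cap_density_gain:
  fixes w :: "'a::euclidean_space \<Rightarrow> real"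
  assumes bdd: "bounded U" and w: "convex_on UNIV w" and lip: "\<And>x y. \<bar>w x - w y\<bar> \<le> L * norm (x - y)"
    and n: "norm n = 1" "\<And>z. z \<in> U \<Longrightarrow> (z - x0) \<bullet> n \<le> 0"
    and p: "p \<in> subdiff w x0" "\<And>q. q \<in> subdiff w x0 \<Longrightarrow> \<exists>\<mu>\<ge>0. q = p - \<mu> *\<^sub>R n"
    and c: "c > 0" "(p - x0) \<bullet> n = - 4 * c" and \<theta>: "0 < \<theta>" "\<theta> < 1"
  shows "\<exists>s0>0. \<forall>s x q. 0 < s \<and> s < s0 \<and> x \<in> U \<and> w x < w x0 + (p + c *\<^sub>R n) \<bullet> (x - x0) + s \<and>
     q \<in> subdiff w (x0 + \<theta> *\<^sub>R (x - x0)) \<longrightarrow>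
     1/2 * (norm (p + c *\<^sub>R n - (x0 + \<theta> *\<^sub>R (x - x0))))\<^sup>2 + (w x0 + (p + c *\<^sub>R n) \<bullet> (\<theta> *\<^sub>R (x - x0)) + s) + 2 * c\<^sup>2
     \<le> 1/2 * (norm (q - (x0 + \<theta> *\<^sub>R (x - x0))))\<^sup>2 + w (x0 + \<theta> *\<^sub>R (x - x0))"
proof (rule ccontr)
  define P where "P = p + c *\<^sub>R n"
  define y where "y x = x0 + \<theta> *\<^sub>R (x - x0)" for x
  define good where "good s x q \<longleftrightarrow> 1/2 * (norm (P - y x))\<^sup>2 + (w x0 + P \<bullet> (\<theta> *\<^sub>R (x - x0)) + s) + 2 * c\<^sup>2
     \<le> 1/2 * (norm (q - y x))\<^sup>2 + w (y x)" for s x q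
  assume "\<not> ?thesis"
  then have neg: "\<exists>s x q. 0 < s \<and> s < s0 \<and> x \<in> U \<and> w x < w x0 + P \<bullet> (x - x0) + s \<and> q \<in> subdiff w (y x) \<and> \<not> good s x q"
    if "s0 > 0" for s0 using that unfolding P_def y_def good_def by blast
  have "\<forall>k. \<exists>s x q. 0 < s \<and> s < inverse (real (Suc k)) \<and> x \<in> U \<and> w x < w x0 + P \<bullet> (x - x0) + s \<and> q \<in> subdiff w (y x) \<and> \<not> good s x q"
    by (intro allI neg) simp
  then obtain s x q where sk: "\<And>k. 0 < s k" "\<And>k. s k < inverse (real (Suc k))" and xk: "\<And>k. x k \<in> U"
    and cap: "\<And>k. w (x k) < w x0 + P \<bullet> (x k - x0) + s k" and qk: "\<And>k. q k \<in> subdiff w (y (x k))" and bad: "\<And>k. \<not> good (s k) (x k) (q k)"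
    unfolding choice_iff by blast
  have slim: "s \<longlonglongrightarrow> 0"
  proof (rule tendsto_sandwich[OF always_eventually always_eventually tendsto_const LIMSEQ_inverse_real_of_nat])
    show "\<forall>n. 0 \<le> s n" by (intro allI less_imp_le sk)
    show "\<forall>n. s n \<le> inverse (real (Suc n))" by (intro allI less_imp_le sk)
  qed
  obtain D where D: "\<And>z. z \<in> U \<Longrightarrow> norm z \<le> D" using bdd unfolding bounded_iff by blast
  have cpt: "compact (cball (0::'a) D \<times> cball (0::'a) L)" by (intro compact_Times compact_cball)
  have "\<exists>l\<in>cball 0 D \<times> cball 0 L. \<exists>r. strict_mono r \<and> ((\<lambda>k. (x k, q k)) \<circ> r) \<longlonglongrightarrow> l"
  proof (rule compact_imp_seq_compact[OF cpt, unfolded seq_compact_def, THEN spec, THEN mp], rule allI)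
    fix k show "(x k, q k) \<in> cball 0 D \<times> cball 0 L" using D[OF xk] subdiff_norm_le[OF lip qk] by simp
  qed
  then obtain l r where r: "strict_mono r" and l: "((\<lambda>k. (x k, q k)) \<circ> r) \<longlonglongrightarrow> l" by blast
  define x1 where "x1 = fst l"
  define q1 where "q1 = snd l"
  have xl: "(\<lambda>k. x (r k)) \<longlonglongrightarrow> x1" using tendsto_fst[OF l] by (simp add: x1_def o_def)
  have ql: "(\<lambda>k. q (r k)) \<longlonglongrightarrow> q1" using tendsto_snd[OF l] by (simp add: q1_def o_def)
  have sl: "(\<lambda>k. s (r k)) \<longlonglongrightarrow> 0" using LIMSEQ_subseq_LIMSEQ[OF slim r] by (simp add: o_def)
  have cont: "isCont w z" for z
    using convex_on_continuous[OF open_UNIV w] by (simp add: continuous_on_eq_continuous_at)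
  have yl: "(\<lambda>k. y (x (r k))) \<longlonglongrightarrow> y x1" unfolding y_def by (intro tendsto_intros xl)
  have wxl: "(\<lambda>k. w (x (r k))) \<longlonglongrightarrow> w x1" by (rule isCont_tendsto_compose[OF cont xl])
  have wyl: "(\<lambda>k. w (y (x (r k)))) \<longlonglongrightarrow> w (y x1)" by (rule isCont_tendsto_compose[OF cont yl])
  have nn: "n \<bullet> n = 1" using n(1) by (simp add: dot_square_norm)
  define d where "d = x1 - x0"
  have dn: "d \<bullet> n \<le> 0"
  proof (rule LIMSEQ_le_const2)
    show "(\<lambda>k. (x (r k) - x0) \<bullet> n) \<longlonglongrightarrow> d \<bullet> n" unfolding d_def by (intro tendsto_intros xl)
    show "\<exists>N. \<forall>k\<ge>N. (x (r k) - x0) \<bullet> n \<le> 0" using n(2)[OF xk] by blast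
  qed
  have wx1: "w x1 \<le> w x0 + P \<bullet> d + 0"
  proof (rule LIMSEQ_le)
    show "(\<lambda>k. w (x (r k))) \<longlonglongrightarrow> w x1" by (rule wxl)
    show "(\<lambda>k. w x0 + P \<bullet> (x (r k) - x0) + s (r k)) \<longlonglongrightarrow> w x0 + P \<bullet> d + 0" unfolding d_def by (intro tendsto_intros xl sl)
    show "\<exists>N. \<forall>k\<ge>N. w (x (r k)) \<le> w x0 + P \<bullet> (x (r k) - x0) + s (r k)" using cap less_imp_le by blast
  qed
  have "w x1 \<ge> w x0 + p \<bullet> d" using p(1) unfolding subdiff_def d_def by blast
  moreover have Pd': "P \<bullet> d = p \<bullet> d + c * (d \<bullet> n)"
    by (simp only: P_def inner_add_left inner_scaleR_left inner_commute[of n d])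
  ultimately have "0 \<le> c * (d \<bullet> n)" using wx1 by linarith
  \<comment> \<open>The tilt by \<open>c\<close> pushes the plane below the support plane strictly
    inside the half space, so the limit point lies in the hyperplane through \<open>x0\<close>
    orthogonal to \<open>n\<close>, where the tilt has no effect.\<close>
  then have dn0: "d \<bullet> n = 0" using dn c(1) by (simp add: zero_le_mult_iff)
  have Pd: "P \<bullet> d = p \<bullet> d" using Pd' dn0 by simp
  have q1sub: "q1 \<in> subdiff w (y x1)" unfolding subdiff_def
  proof (intro CollectI allI)
    fix z
    show "w (y x1) + q1 \<bullet> (z - y x1) \<le> w z"
    proof (rule LIMSEQ_le_const2)
      show "(\<lambda>k. w (y (x (r k))) + q (r k) \<bullet> (z - y (x (r k)))) \<longlonglongrightarrow> w (y x1) + q1 \<bullet> (z - y x1)"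
        by (intro tendsto_intros wyl ql yl)
      have "w (y (x (r k))) + q (r k) \<bullet> (z - y (x (r k))) \<le> w z" for k using qk[of "r k"] unfolding subdiff_def by blast
      then show "\<exists>N. \<forall>k\<ge>N. w (y (x (r k))) + q (r k) \<bullet> (z - y (x (r k))) \<le> w z" by blast
    qed
  qed
  have x1c: "w x1 \<le> w x0 + p \<bullet> (x1 - x0)" using wx1 Pd by (simp add: d_def)
  note contact = subdiff_segment_contact[OF w p(1) x1c \<theta> q1sub[unfolded y_def]]
  obtain \<mu> where \<mu>: "\<mu> \<ge> 0" "q1 = p - \<mu> *\<^sub>R n" using p(2)[OF contact(1)] by blast
  have wy1: "w (y x1) = w x0 + \<theta> * (p \<bullet> d)" using contact(2) by (simp add: y_def d_def)
  have "1/2 * (norm (q1 - y x1))\<^sup>2 + w (y x1) \<le> 1/2 * (norm (P - y x1))\<^sup>2 + (w x0 + P \<bullet> (\<theta> *\<^sub>R d) + 0) + 2 * c\<^sup>2"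
  proof (rule LIMSEQ_le)
    show "(\<lambda>k. 1/2 * (norm (q (r k) - y (x (r k))))\<^sup>2 + w (y (x (r k)))) \<longlonglongrightarrow> 1/2 * (norm (q1 - y x1))\<^sup>2 + w (y x1)"
      by (intro tendsto_intros ql yl wyl)
    show "(\<lambda>k. 1/2 * (norm (P - y (x (r k))))\<^sup>2 + (w x0 + P \<bullet> (\<theta> *\<^sub>R (x (r k) - x0)) + s (r k)) + 2 * c\<^sup>2)
        \<longlonglongrightarrow> 1/2 * (norm (P - y x1))\<^sup>2 + (w x0 + P \<bullet> (\<theta> *\<^sub>R d) + 0) + 2 * c\<^sup>2"
      unfolding d_def by (intro tendsto_intros xl yl sl)
    have "1/2 * (norm (q (r k) - y (x (r k))))\<^sup>2 + w (y (x (r k)))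
        \<le> 1/2 * (norm (P - y (x (r k))))\<^sup>2 + (w x0 + P \<bullet> (\<theta> *\<^sub>R (x (r k) - x0)) + s (r k)) + 2 * c\<^sup>2" for k
      using bad[of "r k"] unfolding good_def not_le by (rule less_imp_le)
    then show "\<exists>N. \<forall>k\<ge>N. 1/2 * (norm (q (r k) - y (x (r k))))\<^sup>2 + w (y (x (r k)))
        \<le> 1/2 * (norm (P - y (x (r k))))\<^sup>2 + (w x0 + P \<bullet> (\<theta> *\<^sub>R (x (r k) - x0)) + s (r k)) + 2 * c\<^sup>2" by blast
  qed
  then have main: "1/2 * (norm (q1 - y x1))\<^sup>2 \<le> 1/2 * (norm (P - y x1))\<^sup>2 + 2 * c\<^sup>2" using wy1 Pd by simp
  define a where "a = p - y x1"
  have an: "a \<bullet> n = - 4 * c"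
  proof -
    have "a = (p - x0) - \<theta> *\<^sub>R d" by (simp add: a_def y_def d_def)
    then show ?thesis using c(2) dn0 by (simp add: inner_diff_left)
  qed
  have sq: "(norm (a + t *\<^sub>R n))\<^sup>2 = (norm a)\<^sup>2 - 8 * c * t + t\<^sup>2" for t
  proof -
    have "(norm (a + t *\<^sub>R n))\<^sup>2 = a \<bullet> a + 2 * t * (a \<bullet> n) + t\<^sup>2 * (n \<bullet> n)"
      unfolding power2_norm_eq_inner
      by (simp add: inner_add_left inner_add_right inner_commute[of n a] power2_eq_square algebra_simps)
    then show ?thesis by (simp add: an nn power2_norm_eq_inner)
  qed
  have "P - y x1 = a + c *\<^sub>R n" "q1 - y x1 = a + (- \<mu>) *\<^sub>R n" by (simp_all add: P_def a_def \<mu>(2))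
  then have "1/2 * ((norm a)\<^sup>2 - 8 * c * (- \<mu>) + (- \<mu>)\<^sup>2) \<le> 1/2 * ((norm a)\<^sup>2 - 8 * c * c + c\<^sup>2) + 2 * c\<^sup>2"
    using main by (simp only: sq)
  \<comment> \<open>A shift by \<open>t\<close> changes half the square by
    \<open>- 4 * c * t + t\<^sup>2 / 2\<close>: a drop of \<open>7/2 * c\<^sup>2\<close> at
    \<open>t = c\<close>, and no drop at \<open>t = - \<mu>\<close>. The claimed gain
    \<open>2 * c\<^sup>2\<close> leaves the contradictory \<open>3/2 * c\<^sup>2\<close>.\<close>
  then have "4 * (c * \<mu>) + 1/2 * \<mu>\<^sup>2 + 3/2 * c\<^sup>2 \<le> 0" by (simp add: power2_eq_square algebra_simps)
  moreover have "c * \<mu> \<ge> 0" "\<mu>\<^sup>2 \<ge> 0" "c\<^sup>2 > 0" using c(1) \<mu>(1) by simp_all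
  ultimately show False by linarith
qed

lemma energy_minimizer_boundary_condition:
  fixes w :: "'a::euclidean_space \<Rightarrow> real"
  assumes bdd: "bounded U" and op: "open U" and conv: "convex U"
    and w: "convex_on UNIV w" and lip: "\<And>x y. \<bar>w x - w y\<bar> \<le> L * norm (x - y)"
    and nonneg: "\<And>x. x \<in> closure U \<Longrightarrow> 0 \<le> w x"
    and min: "\<And>v. v \<in> admissible U \<Longrightarrow> energy U w \<le> energy U v" and fin: "energy U w \<noteq> \<infinity>"
    and x0: "x0 \<in> closure U" and n: "norm n = 1" "\<And>z. z \<in> U \<Longrightarrow> (z - x0) \<bullet> n \<le> 0"
    and p: "p \<in> subdiff w x0" "\<And>q. q \<in> subdiff w x0 \<Longrightarrow> \<exists>\<mu>\<ge>0. q = p - \<mu> *\<^sub>R n"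
  shows "(p - x0) \<bullet> n \<ge> 0"
proof (rule ccontr)
  assume neg: "\<not> ?thesis"
  \<comment> \<open>A quarter of the assumed defect: the quadratic saving from the tilt then
    strictly exceeds \<open>\<epsilon> = 2 * c\<^sup>2\<close>, so the gain survives the limit
    argument.\<close>
  define c where "c = - ((p - x0) \<bullet> n) / 4"
  have c: "c > 0" "(p - x0) \<bullet> n = - 4 * c" using neg by (simp_all add: c_def)
  define P where "P = p + c *\<^sub>R n"
  obtain D where D: "\<And>z. z \<in> U \<Longrightarrow> norm z \<le> D" using bdd unfolding bounded_iff by blast
  define N where "N = DIM('a)"
  \<comment> \<open>Bounds the possible increase of the density on the cap outside \<open>A\<close>:
    the quadratic term is at most the first summand, and the plane exceeds \<open>w\<close> there by
    at most \<open>s \<le> 1\<close>.\<close>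
  define C where "C = 1/2 * (norm P + D)\<^sup>2 + 1"
  define \<epsilon> where "\<epsilon> = 2 * c\<^sup>2"
  have C: "C > 0" and \<epsilon>: "\<epsilon> > 0" using c by (simp_all add: C_def \<epsilon>_def add_nonneg_pos)
  \<comment> \<open>The contraction carries the fraction \<open>\<theta> ^ N\<close> of the volume
    of the cap. This choice makes gain beat loss whatever the size of the cap, so \<open>s\<close>
    may be chosen afterwards.\<close>
  obtain \<theta> where \<theta>: "0 < \<theta>" "\<theta> < 1" "C * (1 - \<theta> ^ N) < \<epsilon> * \<theta> ^ N"
  proof -
    have "((\<lambda>\<theta>. \<epsilon> * \<theta> ^ N - C * (1 - \<theta> ^ N)) \<longlongrightarrow> \<epsilon> * 1 ^ N - C * (1 - 1 ^ N)) (at_left (1::real))"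
      by (intro tendsto_intros)
    then have "eventually (\<lambda>\<theta>. 0 < \<epsilon> * \<theta> ^ N - C * (1 - \<theta> ^ N)) (at_left 1)"
      using \<epsilon> by (intro order_tendstoD) auto
    moreover have "eventually (\<lambda>\<theta>. \<theta> \<in> {0<..<1}) (at_left (1::real))" by (intro eventually_at_left_real) simp
    ultimately have "eventually (\<lambda>\<theta>. 0 < \<epsilon> * \<theta> ^ N - C * (1 - \<theta> ^ N) \<and> \<theta> \<in> {0<..<1}) (at_left 1)" by (rule eventually_conj)
    then have "\<exists>\<theta>. 0 < \<epsilon> * \<theta> ^ N - C * (1 - \<theta> ^ N) \<and> \<theta> \<in> {0<..<1}"
      by (rule eventually_happens'[OF trivial_limit_at_left_real])
    then show thesis using that by auto
  qed
  define y where "y x = x0 + \<theta> *\<^sub>R (x - x0)" for x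
  obtain s0 where s0: "s0 > 0" and gain: "\<And>s x q. 0 < s \<Longrightarrow> s < s0 \<Longrightarrow> x \<in> U \<Longrightarrow> w x < w x0 + P \<bullet> (x - x0) + s \<Longrightarrow>
     q \<in> subdiff w (y x) \<Longrightarrow>
     1/2 * (norm (P - y x))\<^sup>2 + (w x0 + P \<bullet> (\<theta> *\<^sub>R (x - x0)) + s) + \<epsilon> \<le> 1/2 * (norm (q - y x))\<^sup>2 + w (y x)"
    using cap_density_gain[OF bdd w lip n p c \<theta>(1,2)] unfolding P_def y_def \<epsilon>_def by blast
  define s where "s = min (s0 / 2) 1"
  have s: "0 < s" "s < s0" "s \<le> 1" using s0 by (auto simp: s_def)
  define lin where "lin x = P \<bullet> x - (P \<bullet> x0 - w x0 - s)" for x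
  have lin_eq: "lin x = w x0 + P \<bullet> (x - x0) + s" for x by (simp add: lin_def inner_diff_right)
  have cw: "continuous_on UNIV w" by (rule convex_on_continuous[OF open_UNIV w])
  have cl: "continuous_on UNIV lin" unfolding lin_def by (intro continuous_intros)
  have opl: "open {x. w x < lin x}" by (rule open_Collect_less[OF cw cl])
  define K where "K = U \<inter> {x. w x < lin x}"
  have opK: "open K" unfolding K_def by (rule open_Int[OF op opl])
  \<comment> \<open>At \<open>x0\<close> the plane is higher by \<open>s\<close>, so the set where
    it is higher is an open neighbourhood of a point of the closure of \<open>U\<close>.\<close>
  have Kne: "K \<noteq> {}"
  proof -
    have "x0 \<in> {x. w x < lin x}" using s by (simp add: lin_eq)
    then show ?thesis unfolding K_def using x0 opl open_Int_closure_eq_empty[of "{x. w x < lin x}" U] by blast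
  qed
  define A where "A = y ` K"
  have yinv: "x0 + (y x - x0) /\<^sub>R \<theta> = x" for x using \<theta> by (simp add: y_def)
  have y_surj: "y (x0 + (z - x0) /\<^sub>R \<theta>) = z" for z using \<theta> by (simp add: y_def)
  have A_eq: "A = (\<lambda>z. x0 + (z - x0) /\<^sub>R \<theta>) -` K"
  proof
    show "A \<subseteq> (\<lambda>z. x0 + (z - x0) /\<^sub>R \<theta>) -` K" using yinv by (auto simp: A_def)
    show "(\<lambda>z. x0 + (z - x0) /\<^sub>R \<theta>) -` K \<subseteq> A"
    proof
      fix z assume "z \<in> (\<lambda>z. x0 + (z - x0) /\<^sub>R \<theta>) -` K"
      then have "x0 + (z - x0) /\<^sub>R \<theta> \<in> K" by simp
      then show "z \<in> A" unfolding A_def by (rule image_eqI[rotated]) (simp add: y_surj)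
    qed
  qed
  have opA: "open A" unfolding A_eq by (intro open_vimage opK continuous_intros)
  \<comment> \<open>The cap is star-shaped about \<open>x0\<close>: \<open>w - lin\<close> is convex
    and negative at both ends of the segment, and the half-open segment towards a closure point
    stays in the open convex set \<open>U\<close>.\<close>
  have AK: "A \<subseteq> K"
  proof
    fix z assume "z \<in> A"
    then obtain x where x: "x \<in> K" "z = y x" by (auto simp: A_def)
    have "x0 - (1 - (1 - \<theta>)) *\<^sub>R (x0 - x) \<in> interior U"
      using x x0 op \<theta> by (intro mem_interior_closure_convex_shrink[OF conv]) (auto simp: K_def interior_open)
    moreover have "x0 - (1 - (1 - \<theta>)) *\<^sub>R (x0 - x) = z" by (simp add: x y_def algebra_simps)
    ultimately have zU: "z \<in> U" using op by (simp add: interior_open)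
    have ze: "z = (1 - \<theta>) *\<^sub>R x0 + \<theta> *\<^sub>R x" by (simp add: x y_def algebra_simps)
    have "w z \<le> (1 - \<theta>) * w x0 + \<theta> * w x" unfolding ze using \<theta> by (intro convex_onD[OF w]) auto
    also have "\<dots> < (1 - \<theta>) * lin x0 + \<theta> * lin x"
    proof (rule add_strict_mono)
      show "(1 - \<theta>) * w x0 < (1 - \<theta>) * lin x0" using s \<theta> by (simp add: lin_eq)
      show "\<theta> * w x < \<theta> * lin x" using x \<theta> by (simp add: K_def)
    qed
    also have "\<dots> = lin z" unfolding ze lin_def by (simp add: inner_add_right algebra_simps)
    finally show "z \<in> K" using zU by (simp add: K_def)
  qed
  define k where "k = measure lborel K"
  have finK: "emeasure lborel K \<noteq> \<infinity>"
  proof -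
    have "bounded K" using bdd by (rule bounded_subset) (auto simp: K_def)
    then show ?thesis using emeasure_bounded_finite[of K] by auto
  qed
  have eK: "emeasure lborel K = ennreal k" unfolding k_def using finK by (intro emeasure_eq_ennreal_measure) simp
  have kpos: "k > 0"
  proof (rule ccontr)
    assume "\<not> k > 0"
    then have "emeasure lborel K = 0" unfolding eK by (simp add: ennreal_eq_0_iff)
    then have "K \<in> null_sets lborel" using opK by auto
    then have "negligible K" unfolding negligible_iff_null_sets by (rule null_sets_completionI)
    then show False using open_not_negligible[OF opK Kne] by blast
  qed
  have eA: "emeasure lborel A = ennreal (\<theta> ^ N * k)"
  proof -
    have "A = (\<lambda>x. (x0 - \<theta> *\<^sub>R x0) + \<theta> *\<^sub>R x) ` K" unfolding A_def y_def by (intro image_cong refl) (simp add: algebra_simps)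
    then have "emeasure lebesgue A = ennreal (\<bar>\<theta>\<bar> ^ N) * emeasure lebesgue K"
      using emeasure_lebesgue_affine[of \<theta> "x0 - \<theta> *\<^sub>R x0" K] \<theta> by (simp add: N_def add.commute ennreal_power)
    moreover have "emeasure lebesgue A = emeasure lborel A" "emeasure lebesgue K = emeasure lborel K"
      using opA opK by (simp_all add: emeasure_completion)
    ultimately show ?thesis using \<theta> kpos by (simp add: eK ennreal_mult)
  qed
  have eB: "emeasure lborel (K - A) = ennreal (k - \<theta> ^ N * k)"
    using AK opA opK \<theta> kpos by (subst emeasure_Diff) (auto simp: eA eK ennreal_minus)
  define v where "v x = max (w x) (lin x)" for x
  have conv_l: "convex_on UNIV lin"
    by (rule convex_onI) (auto simp: lin_def inner_add_right algebra_simps)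
  have conv_v: "convex_on UNIV v" unfolding v_def by (rule convex_on_max[OF w conv_l])
  have v_adm: "v \<in> admissible U"
    by (rule admissibleI_convex_UNIV[OF conv_v conv]) (use nonneg in \<open>auto simp: v_def le_max_iff_disj\<close>)
  have wO: "convex_on U w" and vO: "convex_on U v"
    using convex_on_subset[OF w subset_UNIV conv] convex_on_subset[OF conv_v subset_UNIV conv] by auto
  have nonneg_U: "0 \<le> w x" "0 \<le> v x" if "x \<in> U" for x
    using nonneg[of x] closure_subset[of U] that by (auto simp: v_def le_max_iff_disj)
  have dens: "AE x in lborel. x \<in> U \<longrightarrow> energy_density v x + \<epsilon> * indicator A x \<le> energy_density w x + C * indicator (K - A) x"
    using convex_on_AE_GDERIV[OF wO op] convex_on_AE_GDERIV[OF vO op]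
  proof eventually_elim
    case (elim x)
    show ?case
    proof
      assume x: "x \<in> U"
      obtain q where q: "GDERIV w x :> q" using elim x by blast
      obtain q' where q': "GDERIV v x :> q'" using elim x by blast
      show "energy_density v x + \<epsilon> * indicator A x \<le> energy_density w x + C * indicator (K - A) x"
      proof (cases "x \<in> K")
        case False
        then have vw: "w x = v x" using x by (simp add: K_def v_def)
        \<comment> \<open>Off the cap \<open>v\<close> touches \<open>w\<close> from above, also at
          points where the plane equals \<open>w\<close>, so the contact set needs no separate
          measure argument.\<close>
        have "q = q'" by (rule GDERIV_touching_unique[OF q q' vw open_UNIV]) (simp_all add: v_def)
        then have "energy_density v x = energy_density w x" using vw grad_eq[OF q] grad_eq[OF q'] by simp
        moreover have "x \<notin> A" using False AK by blast
        ultimately show ?thesis using False by simp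
      next
        case True
        have vl: "v z = lin z" if "z \<in> K" for z using that by (simp add: K_def v_def)
        have "grad v x = grad lin x" by (rule grad_cong_open[OF opK True vl])
        also have "\<dots> = P" unfolding lin_def by (rule grad_eq[OF GDERIV_affine])
        finally have dv: "energy_density v x = 1/2 * (norm (P - x))\<^sup>2 + lin x" using vl[OF True] by simp
        have dw: "energy_density w x = 1/2 * (norm (q - x))\<^sup>2 + w x" using grad_eq[OF q] by simp
        show ?thesis
        proof (cases "x \<in> A")
          case inA: True
          then obtain x' where x': "x' \<in> K" "x = y x'" by (auto simp: A_def)
          have qs: "q \<in> subdiff w (y x')"
            unfolding subdiff_def x'(2)[symmetric] using convex_on_GDERIV_subgradient[OF w open_UNIV _ q] by auto
          have "1/2 * (norm (P - y x'))\<^sup>2 + (w x0 + P \<bullet> (\<theta> *\<^sub>R (x' - x0)) + s) + \<epsilon> \<le> 1/2 * (norm (q - y x'))\<^sup>2 + w (y x')"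
            using x'(1) by (intro gain s qs) (auto simp: K_def lin_eq)
          moreover have "lin x = w x0 + P \<bullet> (\<theta> *\<^sub>R (x' - x0)) + s" unfolding lin_eq x'(2) by (simp add: y_def)
          ultimately have "energy_density v x + \<epsilon> \<le> energy_density w x" unfolding dv dw x'(2)[symmetric] by linarith
          then show ?thesis using inA by simp
        next
          \<comment> \<open>Over \<open>U\<close> the tilt in direction \<open>n\<close> can only
            lower the plane, so it stays below the support plane raised by \<open>s\<close>.\<close>
          case notA: False
          have "w x \<ge> w x0 + p \<bullet> (x - x0)" using p(1) unfolding subdiff_def by blast
          moreover have "P \<bullet> (x - x0) = p \<bullet> (x - x0) + c * ((x - x0) \<bullet> n)"
            by (simp only: P_def inner_add_left inner_scaleR_left inner_commute[of n "x - x0"])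
          moreover have "c * ((x - x0) \<bullet> n) \<le> 0" using c(1) n(2)[OF x] by (simp add: mult_le_0_iff)
          ultimately have 1: "lin x \<le> w x + 1" using s(3) unfolding lin_eq by linarith
          have "norm (P - x) \<le> norm P + D" using norm_triangle_ineq4[of P x] D[OF x] by linarith
          then have "(norm (P - x))\<^sup>2 \<le> (norm P + D)\<^sup>2" by (rule power_mono) simp
          then have "energy_density v x \<le> C + w x" unfolding dv C_def using 1 by linarith
          also have "\<dots> \<le> energy_density w x + C" unfolding dw by simp
          finally show ?thesis using notA True by simp
        qed
      qed
    qed
  qed
  have "energy U v + ennreal \<epsilon> * emeasure lborel A \<le> energy U w + ennreal C * emeasure lborel (K - A)"
  proof (rule energy_perturbation_le[OF op wO vO nonneg_U _ _ _ _ _ _ dens])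
    show "A \<in> sets borel" "K - A \<in> sets borel" using opA opK by auto
    show "A \<subseteq> U" "K - A \<subseteq> U" using AK by (auto simp: K_def)
    show "0 \<le> \<epsilon>" "0 \<le> C" using \<epsilon> C by auto
  qed
  moreover have "energy U w + ennreal \<epsilon> * emeasure lborel A \<le> energy U v + ennreal \<epsilon> * emeasure lborel A"
    by (intro add_right_mono min v_adm)
  ultimately have "energy U w + ennreal \<epsilon> * emeasure lborel A \<le> energy U w + ennreal C * emeasure lborel (K - A)" by (rule order_trans[rotated])
  then have "ennreal \<epsilon> * emeasure lborel A \<le> ennreal C * emeasure lborel (K - A)"
    using fin by (simp add: ennreal_add_left_cancel_le)
  then have "ennreal (\<epsilon> * (\<theta> ^ N * k)) \<le> ennreal (C * (k - \<theta> ^ N * k))"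
    unfolding eA eB using \<epsilon> C by (simp add: ennreal_mult' less_imp_le)
  moreover have "\<theta> ^ N * k \<le> 1 * k" using \<theta> kpos by (intro mult_right_mono power_le_one) auto
  ultimately have "\<epsilon> * (\<theta> ^ N * k) \<le> C * (k - \<theta> ^ N * k)" using C by (subst (asm) ennreal_le_iff) (auto intro!: mult_nonneg_nonneg)
  then have "(\<epsilon> * \<theta> ^ N) * k \<le> (C * (1 - \<theta> ^ N)) * k" by (simp add: algebra_simps)
  then show False using \<theta>(3) kpos by simp
qed

theorem proposition2p3:
  fixes \<Omega> :: "'a::euclidean_space set" and u :: "'a \<Rightarrow> real"
  assumes "bounded \<Omega>" and "open \<Omega>" and "convex \<Omega>"
    and "is_arg_min (energy \<Omega>) (\<lambda>v. v \<in> admissible \<Omega>) u"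
  shows "hausdorff_measure (DIM('a) - 1)
           (frontier \<Omega> - dom_D_minus \<Omega> (min_convex_ext \<Omega> u)) = 0 \<and>
         (\<forall>x0 \<in> frontier \<Omega> \<inter> dom_D_minus \<Omega> (min_convex_ext \<Omega> u). \<forall>n.
           outer_unit_normal \<Omega> x0 n \<longrightarrow>
           (D_plus \<Omega> (min_convex_ext \<Omega> u) x0 - x0) \<bullet> n \<ge> 0)"
proof (cases "\<Omega> = {}")
  case True
  have "minkowski_codim2 ({} :: 'a set)"
    unfolding minkowski_codim2_def by (intro exI[of _ 0] allI impI exI[of _ "{}"]) simp
  then have "hausdorff_measure (DIM('a) - 1) ({} :: 'a set) = 0"
    by (rule hausdorff_measure_eq_0[where A = "\<lambda>_. {}"]) simp
  then show ?thesis using True by simp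
next
  case False
  obtain D where D: "\<And>x. x \<in> \<Omega> \<Longrightarrow> norm x \<le> D"
    using \<open>bounded \<Omega>\<close> unfolding bounded_iff by blast
  have D0: "D \<ge> 0" using False D norm_ge_zero order_trans by blast
  note minimizer = assms D D0
  define w where "w = min_convex_ext \<Omega> u"
  have w: "convex_on UNIV w" and lip: "\<And>x y. \<bar>w x - w y\<bar> \<le> 2 * D * norm (x - y)"
    and eq: "\<And>x. x \<in> \<Omega> \<Longrightarrow> w x = u x"
    unfolding w_def using min_convex_ext_minimizer[OF minimizer False] by blast+
  have nonneg: "0 \<le> w x" if "x \<in> \<Omega>" for x
    using minimizer_nonneg[OF minimizer that] eq[OF that] by simp
  have cont: "continuous_on UNIV w" by (rule convex_on_continuous[OF open_UNIV w])
  have nonneg_closure: "0 \<le> w x" if "x \<in> closure \<Omega>" for x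
    by (rule continuous_ge_on_closure[OF continuous_on_subset[OF cont subset_UNIV] that nonneg])
  \<comment> \<open>The energy sees only the open set, where \<open>w\<close> and \<open>u\<close>
    have equal values and gradients. So \<open>w\<close> has least energy itself, and being convex
    and Lipschitz on the whole space it can replace \<open>u\<close> in the boundary
    argument.\<close>
  have energy_eq: "energy \<Omega> w = energy \<Omega> u"
    unfolding energy_def
    by (intro nn_integral_cong) (auto simp: indicator_def eq grad_cong_open[OF assms(2) _ eq])
  have "(D_plus \<Omega> w x0 - x0) \<bullet> n \<ge> 0"
    if x0: "x0 \<in> frontier \<Omega> \<inter> dom_D_minus \<Omega> w" and n: "outer_unit_normal \<Omega> x0 n" for x0 n
  proof (rule energy_minimizer_boundary_condition[OF assms(1-3) w lip nonneg_closure])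
    show "energy \<Omega> w \<le> energy \<Omega> v" if "v \<in> admissible \<Omega>" for v
      unfolding energy_eq by (rule minimizer_energy_le[OF minimizer that])
    show "energy \<Omega> w \<noteq> \<infinity>" unfolding energy_eq by (rule minimizer_energy_finite[OF minimizer])
    show "x0 \<in> closure \<Omega>" using x0 by (simp add: frontier_def)
    show "norm n = 1" by (rule norm_outer_unit_normal[OF n assms(2,3)])
    show "(z - x0) \<bullet> n \<le> 0" if "z \<in> \<Omega>" for z by (rule outer_unit_normal_le[OF n assms(2,3) that])
    show "D_plus \<Omega> w x0 \<in> subdiff w x0" using x0 by (intro D_plus_extremal(1)[OF w n assms(2,3)]) simp
    show "\<exists>\<mu>\<ge>0. q = D_plus \<Omega> w x0 - \<mu> *\<^sub>R n" if "q \<in> subdiff w x0" for q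
      using x0 that by (intro D_plus_extremal(2)[OF w n assms(2,3)]) simp_all
  qed
  then show ?thesis
    using hausdorff_frontier_null[OF assms(2,3,1) False w lip nonneg] unfolding w_def by blast
qed

end
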